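(* Let $M$ and $N$ be smooth Banach manifolds modeled on the Banach spaces $\mathbb{E}$ and $\mathbb{E}'$, let $g:M\to N$ be a smooth map, let $\nabla_M$ and $\nabla_N$ be $g$-related linear connections on $M$ and $N$, and let $k\in\mathbb{N}$. Equip $\pi^k_M:T^kM\to M$ and $\pi^k_N:T^kN\to N$ with the vector bundle structures induced by $\nabla_M$ and $\nabla_N$ respectively. If $g$ is a diffeomorphism, then $T^kg:T^kM\to T^kN$ is a vector bundle isomorphism (over $g$).
   Context: All manifolds and maps are smooth ($C^\infty$ in the Fréchet sense), modeled on real Banach spaces. **Higher order tangent bundle.** For $x\in M$, two smooth curves $\gamma_1,\gamma_2:(-\epsilon,\epsilon)\to M$ with $\gamma_1(0)=\gamma_2(0)=x$ are $k$-equivalent if (in a chart) their derivatives at $0$ of orders $1,\dots,k$ agree; $[\gamma,x]_k$ is the class of $\gamma$, $T^k_xM$ the set of classes, $T^kM=\bigcup_{x}T^k_xM$, and $\pi^k_M([\gamma,x]_k)=x$. For a chart $(U_\alpha,\phi_\alpha)$ of $M$ put $\phi_\alpha^k([\gamma,x]_k)=\big(\gamma_\alpha(0),\gamma_\alpha'(0),\dots,\tfrac1{k!}\gamma_\alpha^{(k)}(0)\big)\in\phi_\alpha(U_\alpha)\times\mathbb{E}^k$, $\gamma_\alpha=\phi_\alpha\circ\gamma$; these charts make $T^kM$ a smooth fibre bundle over $M$. The $k$'th order differential of $g$ is $T^kg:T^kM\to T^kN$, $T^kg([\gamma,x]_k)=[g\circ\gamma,g(x)]_k$. **Linear connections and $g$-relatedness.**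 A linear connection $\nabla$ on $M$ is given in charts by smooth Christoffel symbols: $\Gamma_\alpha(x,\xi)y$, $x\in\phi_\alpha(U_\alpha)$, bilinear in $(\xi,y)\in\mathbb{E}^2$; its connection map $TTM\to TM$ is locally $(x,\xi;y,\eta)\mapsto(x,\eta+\Gamma_\alpha(x,\xi)y)$. $\nabla_M$ and $\nabla_N$ are $g$-related if their connection maps $K_M,K_N$ satisfy $K_N\circ TTg=Tg\circ K_M$; locally, with $g_{\beta\alpha}=\psi_\beta\circ g\circ\phi_\alpha^{-1}$ for charts $(U_\alpha,\phi_\alpha)$ of $M$ and $(V_\beta,\psi_\beta)$ of $N$ with $g(U_\alpha)\subseteq V_\beta$, $$dg_{\beta\alpha}(x)[\Gamma^M_\alpha(x,\xi)y]=d^2g_{\beta\alpha}(x)(\xi,y)+\Gamma^N_\beta\big(g_{\beta\alpha}(x),dg_{\beta\alpha}(x)\xi\big)dg_{\beta\alpha}(x)y .$$ **Local components induced by a linear connection.** Given $\nabla$ on $M$, define $M^{1}_\alpha(x,\xi_1)y=\Gamma_\alpha(x,\xi_1)y$ and, for $j\ge2$, $$M^{j}_\alpha(x,\xi_1,\dots,\xi_j)y=\frac1j\Big(\sum_{i=1}^{j}\partial_iM^{j-1}_\alpha(x,\xi_1,\dots,\xi_{j-1})(y,i\xi_i)+M^{1}_\alpha(x,\xi_1)\big[M^{j-1}_\alpha(x,\xi_1,\dots,\xi_{j-1})y\big]\Big),$$ where $\partial_iM^{j-1}_\alpha(\cdot)(y,w)$ is the partial derivative of $M^{j-1}_\alpha(\cdot)y$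 with respect to its $i$-th variable ($x$ being the first, $\xi_{i-1}$ the $i$-th) in the direction $w$. **Induced vector bundle structure on $T^kM$.** It is known that the following maps are trivializations of a smooth vector bundle structure on $\pi^k_M:T^kM\to M$ with fibre $\mathbb{E}^k$; this is the structure induced by $\nabla$: $$\Phi^k_\alpha:(\pi^k_M)^{-1}(U_\alpha)\to\phi_\alpha(U_\alpha)\times\mathbb{E}^k,\quad [\gamma,x]_k\mapsto(\gamma_\alpha(0),\gamma_\alpha^{(1)}(0),z^2_\alpha,\dots,z^k_\alpha),$$ where for $2\le i\le k$ $$z^i_\alpha=\frac1i\Big\{\frac{\gamma_\alpha^{(i)}(0)}{(i-1)!}+\sum_{j=1}^{i-1}M^{j}_\alpha\Big[\gamma_\alpha(0),\gamma_\alpha^{(1)}(0),\dots,\frac{\gamma_\alpha^{(j)}(0)}{j!}\Big]\frac{\gamma_\alpha^{(i-j)}(0)}{(i-j-1)!}\Big\}.$$ The same construction applies on $N$. Vector bundle morphisms are fibre preserving, continuous linear on fibres, and in trivializations given by smooth maps into the Banach space $\mathcal{L}(\mathbb{E}^k,\mathbb{E}'^k)$; an isomorphism is a morphism with an inverse morphism. *)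

theory Defs
  imports "HOL-Analysis.Analysis"
begin

section \<open>Smooth maps between normed spaces\<close>

text \<open>
  An \<open>n\<close>-linear map is a function on lists of length \<open>n\<close>; its values on lists of
  other lengths are irrelevant.
\<close>

definition bounded_multilinear ::
    "nat \<Rightarrow> ('a::real_normed_vector list \<Rightarrow> 'b::real_normed_vector) \<Rightarrow> bool" where
  "bounded_multilinear n m \<longleftrightarrow>
     (\<forall>us ws. length us + length ws + 1 = n \<longrightarrow> linear (\<lambda>v. m (us @ v # ws))) \<and>
     (\<exists>C. \<forall>vs. length vs = n \<longrightarrow> norm (m vs) \<le> C * prod_list (map norm vs))"

text \<open>
  Frechet smoothness on an open set. The iterated derivative of order \<open>n\<close> takes values in
  spaces whose type would depend on \<open>n\<close>, so the whole sequence \<open>D n x\<close> of derivatives is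
  given as a sequence of bounded \<open>n\<close>-linear maps. The last clause says that \<open>D (Suc n) x\<close>,
  read as the linear map \<open>h \<mapsto> D (Suc n) x (h # _)\<close>, is the Frechet derivative at \<open>x\<close> of
  \<open>D n\<close> with respect to the operator norm on \<open>n\<close>-linear maps.
\<close>

definition smooth_on ::
    "'a::real_normed_vector set \<Rightarrow> ('a \<Rightarrow> 'b::real_normed_vector) \<Rightarrow> bool" where
  "smooth_on S f \<longleftrightarrow> open S \<and>
     (\<exists>D :: nat \<Rightarrow> 'a \<Rightarrow> 'a list \<Rightarrow> 'b.
        (\<forall>x\<in>S. D 0 x [] = f x) \<and>
        (\<forall>n. \<forall>x\<in>S. bounded_multilinear n (D n x)) \<and>
        (\<forall>n. \<forall>x\<in>S. \<forall>e>0. \<exists>d>0. \<forall>y\<in>S. dist y x < d \<longrightarrow>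
           (\<forall>vs. length vs = n \<longrightarrow>
              norm (D n y vs - D n x vs - D (Suc n) x ((y - x) # vs))
                \<le> e * norm (y - x) * prod_list (map norm vs))))"


section \<open>Manifolds, smooth maps and curves\<close>

text \<open>
  A chart is a domain together with a coordinate map; the coordinate map is a total function of
  which only the values on the domain matter. A manifold is given by an atlas, which determines
  the underlying set and the topology. The atlas need not be maximal.
\<close>

type_synonym ('m, 'e) chart = "'m set \<times> ('m \<Rightarrow> 'e)"
type_synonym ('m, 'e) atlas = "('m, 'e) chart set"

definition points :: "('m, 'e) atlas \<Rightarrow> 'm set" where
  "points A = \<Union> (fst ` A)"

definition smooth_atlas :: "('m, 'e::real_normed_vector) atlas \<Rightarrow> bool" where
  "smooth_atlas A \<longleftrightarrow>
     (\<forall>(U, \<phi>)\<in>A. inj_on \<phi> U \<and> open (\<phi> ` U)) \<and>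
     (\<forall>(U, \<phi>)\<in>A. \<forall>(V, \<psi>)\<in>A. smooth_on (\<phi> ` (U \<inter> V)) (\<psi> \<circ> inv_into U \<phi>))"

text \<open>
  Continuity of \<open>f\<close> is contained in the openness that \<^term>\<open>smooth_on\<close> demands of the domain of
  each coordinate representation.
\<close>

definition smooth_map ::
    "('m, 'e::real_normed_vector) atlas \<Rightarrow> ('n, 'f::real_normed_vector) atlas \<Rightarrow>
     ('m \<Rightarrow> 'n) \<Rightarrow> bool" where
  "smooth_map A B f \<longleftrightarrow>
     f ` points A \<subseteq> points B \<and>
     (\<forall>(U, \<phi>)\<in>A. \<forall>(V, \<psi>)\<in>B. smooth_on (\<phi> ` (U \<inter> f -` V)) (\<psi> \<circ> f \<circ> inv_into U \<phi>))"

definition inverse_on :: "'m set \<Rightarrow> 'n set \<Rightarrow> ('m \<Rightarrow> 'n) \<Rightarrow> ('n \<Rightarrow> 'm) \<Rightarrow> bool" where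
  "inverse_on X Y f h \<longleftrightarrow> (\<forall>x\<in>X. f x \<in> Y \<and> h (f x) = x) \<and> (\<forall>y\<in>Y. h y \<in> X \<and> f (h y) = y)"

definition diffeomorphism ::
    "('m, 'e::real_normed_vector) atlas \<Rightarrow> ('n, 'f::real_normed_vector) atlas \<Rightarrow>
     ('m \<Rightarrow> 'n) \<Rightarrow> bool" where
  "diffeomorphism A B f \<longleftrightarrow>
     smooth_map A B f \<and> (\<exists>h. smooth_map B A h \<and> inverse_on (points A) (points B) f h)"

text \<open>
  A smooth curve on some \<open>(-\<epsilon>, \<epsilon>)\<close>, extended arbitrarily to a total function.
\<close>

definition smooth_curve :: "('m, 'e::real_normed_vector) atlas \<Rightarrow> (real \<Rightarrow> 'm) \<Rightarrow> bool" where
  "smooth_curve A \<gamma> \<longleftrightarrow> (\<exists>\<epsilon>>0. smooth_map {({-\<epsilon><..<\<epsilon>}, \<lambda>t. t)} A \<gamma>)"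

definition curve_deriv :: "nat \<Rightarrow> (real \<Rightarrow> 'e::real_normed_vector) \<Rightarrow> real \<Rightarrow> 'e" where
  "curve_deriv n c = ((\<lambda>f t. vector_derivative f (at t)) ^^ n) c"


section \<open>Higher order tangent bundles\<close>

definition jet_equiv ::
    "('m, 'e::real_normed_vector) atlas \<Rightarrow> nat \<Rightarrow> (real \<Rightarrow> 'm) \<Rightarrow> (real \<Rightarrow> 'm) \<Rightarrow> bool" where
  "jet_equiv A k \<gamma> \<delta> \<longleftrightarrow> \<gamma> 0 = \<delta> 0 \<and>
     (\<exists>(U, \<phi>)\<in>A. \<gamma> 0 \<in> U \<and>
        (\<forall>i\<in>{1..k}. curve_deriv i (\<phi> \<circ> \<gamma>) 0 = curve_deriv i (\<phi> \<circ> \<delta>) 0))"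

definition jet ::
    "('m, 'e::real_normed_vector) atlas \<Rightarrow> nat \<Rightarrow> (real \<Rightarrow> 'm) \<Rightarrow> (real \<Rightarrow> 'm) set" where
  "jet A k \<gamma> = {\<delta>. smooth_curve A \<delta> \<and> jet_equiv A k \<gamma> \<delta>}"

definition jet_bundle ::
    "('m, 'e::real_normed_vector) atlas \<Rightarrow> nat \<Rightarrow> (real \<Rightarrow> 'm) set set" where
  "jet_bundle A k = {jet A k \<gamma> |\<gamma>. smooth_curve A \<gamma>}"

text \<open>
  Functions of a class \<open>c\<close> are defined through its representatives: with \<^const>\<open>the_elem\<close> for
  functions into points and vectors, and as the union of the (equal) resulting classes for
  \<open>T\<^sup>kg\<close>.
\<close>

definition foot :: "(real \<Rightarrow> 'm) set \<Rightarrow> 'm" where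
  "foot c = the_elem ((\<lambda>\<gamma>. \<gamma> 0) ` c)"

definition jet_map ::
    "('n, 'f::real_normed_vector) atlas \<Rightarrow> nat \<Rightarrow> ('m \<Rightarrow> 'n) \<Rightarrow>
     (real \<Rightarrow> 'm) set \<Rightarrow> (real \<Rightarrow> 'n) set" where
  "jet_map B k g c = (\<Union>\<gamma>\<in>c. jet B k (g \<circ> \<gamma>))"


section \<open>Linear connections\<close>

definition tangent_chart ::
    "('m, 'e::real_normed_vector) atlas \<Rightarrow> ('m, 'e) chart \<Rightarrow> ((real \<Rightarrow> 'm) set, 'e \<times> 'e) chart" where
  "tangent_chart A = (\<lambda>(U, \<phi>).
     ({c \<in> jet_bundle A 1. foot c \<in> U},
      \<lambda>c. the_elem ((\<lambda>\<gamma>. (\<phi> (\<gamma> 0), curve_deriv 1 (\<phi> \<circ> \<gamma>) 0)) ` c)))"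

definition tangent_atlas ::
    "('m, 'e::real_normed_vector) atlas \<Rightarrow> ((real \<Rightarrow> 'm) set, 'e \<times> 'e) atlas" where
  "tangent_atlas A = tangent_chart A ` A"

text \<open>
  A linear connection is given by its Christoffel symbols \<open>\<Gamma>\<close>, one for each chart of the atlas,
  together with the connection map \<open>K : TTM \<rightarrow> TM\<close> that has the prescribed form in every chart.
  The existence of \<open>K\<close> is what makes the local symbols compatible on overlaps.
\<close>

type_synonym 'e christoffel = "'e \<Rightarrow> 'e \<Rightarrow>\<^sub>L ('e \<Rightarrow>\<^sub>L 'e)"
type_synonym 'm tangent = "(real \<Rightarrow> 'm) set"

definition linear_connection ::
    "('m, 'e::real_normed_vector) atlas \<Rightarrow> (('m, 'e) chart \<Rightarrow> 'e christoffel) \<Rightarrow>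
     ('m tangent tangent \<Rightarrow> 'm tangent) \<Rightarrow> bool" where
  "linear_connection A \<Gamma> K \<longleftrightarrow>
     (\<forall>(U, \<phi>)\<in>A. smooth_on (\<phi> ` U) (\<Gamma> (U, \<phi>))) \<and>
     (\<forall>w\<in>jet_bundle (tangent_atlas A) 1.
        K w \<in> jet_bundle A 1 \<and>
        (\<forall>(U, \<phi>)\<in>A. foot (foot w) \<in> U \<longrightarrow>
           foot (K w) \<in> U \<and>
           (\<forall>x \<xi> y \<eta>.
              snd (tangent_chart (tangent_atlas A) (tangent_chart A (U, \<phi>))) w = ((x, \<xi>), (y, \<eta>)) \<longrightarrow>
              snd (tangent_chart A (U, \<phi>)) (K w) = (x, \<eta> + \<Gamma> (U, \<phi>) x \<xi> y))))"

definition g_related ::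
    "('m, 'e::real_normed_vector) atlas \<Rightarrow> ('n, 'f::real_normed_vector) atlas \<Rightarrow> ('m \<Rightarrow> 'n) \<Rightarrow>
     ('m tangent tangent \<Rightarrow> 'm tangent) \<Rightarrow> ('n tangent tangent \<Rightarrow> 'n tangent) \<Rightarrow> bool" where
  "g_related A B g K\<^sub>M K\<^sub>N \<longleftrightarrow>
     (\<forall>w\<in>jet_bundle (tangent_atlas A) 1.
        K\<^sub>N (jet_map (tangent_atlas B) 1 (jet_map B 1 g) w) = jet_map B 1 g (K\<^sub>M w))"


section \<open>Vector bundles\<close>

text \<open>
  A vector bundle is given by its total space, projection, the atlas of its base, and its
  trivializations. A trivialization over a chart \<open>(U, \<phi>)\<close> of the base maps the part of the total
  space over \<open>U\<close> to \<open>\<phi> ` U \<times> 'v\<close>.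
\<close>

record ('t, 'm, 'e, 'v) vbundle =
  vb_total :: "'t set"
  vb_proj :: "'t \<Rightarrow> 'm"
  vb_base :: "('m, 'e) atlas"
  vb_trivs :: "(('m, 'e) chart \<times> ('t \<Rightarrow> 'e \<times> 'v)) set"

text \<open>
  The linear structure on a fibre is the one that makes the second component of the
  trivializations linear, so continuous linearity of \<open>h\<close> on fibres is the existence of the bounded
  linear maps \<open>L x\<close>.
\<close>

definition vb_morphism ::
    "('t, 'm, 'e::real_normed_vector, 'v::real_normed_vector) vbundle \<Rightarrow>
     ('s, 'n, 'f::real_normed_vector, 'w::real_normed_vector) vbundle \<Rightarrow>
     ('m \<Rightarrow> 'n) \<Rightarrow> ('t \<Rightarrow> 's) \<Rightarrow> bool" where
  "vb_morphism P Q g h \<longleftrightarrow>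
     smooth_map (vb_base P) (vb_base Q) g \<and>
     (\<forall>t\<in>vb_total P. h t \<in> vb_total Q \<and> vb_proj Q (h t) = g (vb_proj P t)) \<and>
     (\<forall>((U, \<phi>), \<Phi>)\<in>vb_trivs P. \<forall>((V, \<psi>), \<Psi>)\<in>vb_trivs Q.
        \<exists>L :: 'e \<Rightarrow> 'v \<Rightarrow>\<^sub>L 'w.
          smooth_on (\<phi> ` (U \<inter> g -` V)) L \<and>
          (\<forall>t\<in>vb_total P. vb_proj P t \<in> U \<and> g (vb_proj P t) \<in> V \<longrightarrow>
             snd (\<Psi> (h t)) = blinfun_apply (L (fst (\<Phi> t))) (snd (\<Phi> t))))"

definition vb_isomorphism ::
    "('t, 'm, 'e::real_normed_vector, 'v::real_normed_vector) vbundle \<Rightarrow>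
     ('s, 'n, 'f::real_normed_vector, 'w::real_normed_vector) vbundle \<Rightarrow>
     ('m \<Rightarrow> 'n) \<Rightarrow> ('t \<Rightarrow> 's) \<Rightarrow> bool" where
  "vb_isomorphism P Q g h \<longleftrightarrow>
     vb_morphism P Q g h \<and>
     (\<exists>g' h'. vb_morphism Q P g' h' \<and>
        inverse_on (points (vb_base P)) (points (vb_base Q)) g g' \<and>
        inverse_on (vb_total P) (vb_total Q) h h')"


section \<open>The vector bundle structure induced by a linear connection\<close>

text \<open>
  \<open>local_comp \<Gamma> j p y\<close> is \<open>M\<^sup>j(x, \<xi>\<^sub>1, \<dots>, \<xi>\<^sub>j) y\<close> with \<open>p 0 = x\<close> and \<open>p i = \<xi>\<^sub>i\<close>; further values of
  \<open>p\<close> are ignored. The \<open>i\<close>-th variable is \<open>p (i - 1)\<close>. The components start at \<open>j = 1\<close>; the value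
  at \<open>j = 0\<close> is a dummy.
\<close>

fun local_comp ::
    "('e::real_normed_vector) christoffel \<Rightarrow> nat \<Rightarrow> (nat \<Rightarrow> 'e) \<Rightarrow> 'e \<Rightarrow> 'e" where
  "local_comp \<Gamma> 0 p y = y"
| "local_comp \<Gamma> (Suc 0) p y = \<Gamma> (p 0) (p 1) y"
| "local_comp \<Gamma> (Suc (Suc n)) p y =
     (1 / real (Suc (Suc n))) *\<^sub>R
       ((\<Sum>i = 1..Suc (Suc n).
           frechet_derivative (\<lambda>u. local_comp \<Gamma> (Suc n) (p(i - 1 := u)) y) (at (p (i - 1)))
             (real i *\<^sub>R p i))
        + \<Gamma> (p 0) (p 1) (local_comp \<Gamma> (Suc n) p y))"

text \<open>
  \<open>z_comp \<Gamma> c i\<close> is \<open>z\<^sup>i\<close> for a curve \<open>c\<close> in coordinates; for \<open>i = 1\<close> the sum is empty and the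
  value is \<open>c'(0)\<close>.
\<close>

definition z_comp ::
    "('e::real_normed_vector) christoffel \<Rightarrow> (real \<Rightarrow> 'e) \<Rightarrow> nat \<Rightarrow> 'e" where
  "z_comp \<Gamma> c i =
     (1 / real i) *\<^sub>R
       ((1 / fact (i - 1)) *\<^sub>R curve_deriv i c 0
        + (\<Sum>j = 1..<i.
             local_comp \<Gamma> j (\<lambda>m. (1 / fact m) *\<^sub>R curve_deriv m c 0)
               ((1 / fact (i - j - 1)) *\<^sub>R curve_deriv (i - j) c 0)))"

text \<open>
  The fibre \<open>\<bbbE>\<^sup>k\<close> is the Banach space \<^typ>\<open>'e ^ 'k\<close>, where \<open>ix\<close> is a numbering of the index type
  \<^typ>\<open>'k\<close> by \<open>1, \<dots>, k\<close>.
\<close>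

definition induced_triv ::
    "('k::finite \<Rightarrow> nat) \<Rightarrow> ('e::real_normed_vector) christoffel \<Rightarrow> ('m \<Rightarrow> 'e) \<Rightarrow>
     (real \<Rightarrow> 'm) set \<Rightarrow> 'e \<times> ('e ^ 'k)" where
  "induced_triv ix \<Gamma> \<phi> c =
     the_elem ((\<lambda>\<gamma>. (\<phi> (\<gamma> 0), \<chi> a. z_comp \<Gamma> (\<phi> \<circ> \<gamma>) (ix a))) ` c)"

definition induced_bundle ::
    "('m, 'e::real_normed_vector) atlas \<Rightarrow> (('m, 'e) chart \<Rightarrow> 'e christoffel) \<Rightarrow> nat \<Rightarrow>
     ('k::finite \<Rightarrow> nat) \<Rightarrow> ((real \<Rightarrow> 'm) set, 'm, 'e, 'e ^ 'k) vbundle" where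
  "induced_bundle A \<Gamma> k ix =
     \<lparr>vb_total = jet_bundle A k,
      vb_proj = foot,
      vb_base = A,
      vb_trivs = (\<lambda>(U, \<phi>). ((U, \<phi>), induced_triv ix (\<Gamma> (U, \<phi>)) \<phi>)) ` A\<rparr>"

end

(* In a chart, z^i of a curve c is (1/i!) (D_t)^(i-1) c'(0), where D_t y = y' + Gamma(c, c') y is the
   covariant derivative along c: the recursion defining the local components M^j says exactly that
   (1/j!) (D_t)^j y is the sum over i <= j of M^i[c, c', ..., c^(i)/i!] y^(j-i)/(j-i)!, by the chain rule
   for the total derivative of M^i along the curve. For g-related connections dg commutes with
   covariant differentiation along curves, so z^i(g c) = dg(z^i(c)): in the trivializations T^k g is
   the constant diagonal matrix dg, hence linear and smooth. Applied to c = g^-1 d this also gives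
   z^i(g^-1 d) = d(g^-1) z^i(d), so the inverse is a morphism without a separate argument that the
   connections are g^-1-related. The local form of g-relatedness is read off from the curve
   t |-> (x + t y, xi) in the tangent bundle. *)

theory Submission
  imports Defs
begin

section \<open>Bounded multilinear maps along differentiable families\<close>

text \<open>The recursion for M^j is written with \<open>frechet_derivative\<close>, which says
  nothing unless the function is known to be differentiable, and it sums partial derivatives, which
  add up to a total derivative only under joint differentiability. Both obstacles disappear once M^j
  is identified with a formal polynomial in the derivatives of the Christoffel symbol: such
  expressions are closed under differentiation. The iterated derivatives of a smooth map have no
  common type of values. A smooth map is therefore handled through a sequence D of multilinear maps
  and one chain rule for t |-> D n (x t) [a_1 t, ..., a_n t]. From it follow that g o c is smooth,
  that its k-jet depends only on the k-jet of c, and the formulas for dg and d^2g along a curve. TTM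
  needs charts on TM. Their transition maps are only shown to act on smooth curves and on jets,
  which is all that the connection maps require. The test curve for g-relatedness yields d^2g with
  its arguments in the opposite order from the one met in covariant differentiation, so symmetry of
  d^2g has to be proved in Banach spaces.\<close>

lemma bounded_multilinear_bound:
  assumes "bounded_multilinear n m"
  obtains C where "C \<ge> 0" "\<And>vs. length vs = n \<Longrightarrow> norm (m vs) \<le> C * prod_list (map norm vs)"
proof -
  obtain C where C: "\<And>vs. length vs = n \<Longrightarrow> norm (m vs) \<le> C * prod_list (map norm vs)"
    using assms unfolding bounded_multilinear_def by blast
  show thesis
  proof (rule that[of "\<bar>C\<bar>"])
    fix vs :: "'a list" assume "length vs = n"
    moreover have "C * prod_list (map norm vs) \<le> \<bar>C\<bar> * prod_list (map norm vs)"
      by (intro mult_right_mono prod_list_nonneg) auto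
    ultimately show "norm (m vs) \<le> \<bar>C\<bar> * prod_list (map norm vs)"
      using C by fastforce
  qed simp
qed

lemma bounded_multilinear_linear:
  "bounded_multilinear n m \<Longrightarrow> length us + length ws + 1 = n \<Longrightarrow> linear (\<lambda>v. m (us @ v # ws))"
  unfolding bounded_multilinear_def by blast

lemma bounded_multilinear_linear_update:
  assumes "bounded_multilinear n m" "length vs = n" "k < n"
  shows "linear (\<lambda>v. m (vs[k := v]))"
  using bounded_multilinear_linear[OF assms(1), of "take k vs" "drop (Suc k) vs"] assms(2,3)
  by (simp add: upd_conv_take_nth_drop)

lemma bounded_multilinear_linear_Cons:
  "bounded_multilinear (Suc n) m \<Longrightarrow> length ws = n \<Longrightarrow> linear (\<lambda>v. m (v # ws))"
  using bounded_multilinear_linear[of "Suc n" m "[]" ws] by simp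

lemma bounded_multilinear_linear_snoc:
  "bounded_multilinear (Suc n) m \<Longrightarrow> length ws = n \<Longrightarrow> linear (\<lambda>v. m (ws @ [v]))"
  using bounded_multilinear_linear[of "Suc n" m ws "[]"] by simp

lemma prod_list_update_le:
  assumes "bounded_linear L" "k < length xs"
  obtains K where "K \<ge> 0" "\<And>h. prod_list (map norm (xs[k := L h])) \<le> K * norm h"
proof -
  obtain B where B: "\<And>h. norm (L h) \<le> norm h * B" "B \<ge> 0"
    using bounded_linear.nonneg_bounded[OF assms(1)] by blast
  let ?a = "prod_list (map norm (take k xs))" and ?b = "prod_list (map norm (drop (Suc k) xs))"
  have n: "?a \<ge> 0" "?b \<ge> 0" by (auto intro!: prod_list_nonneg)
  show thesis
  proof (rule that[of "?a * B * ?b"])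
    show "0 \<le> ?a * B * ?b" using n B by simp
    fix h
    have "prod_list (map norm (xs[k := L h])) = ?a * (norm (L h) * ?b)"
      using assms(2) by (simp add: upd_conv_take_nth_drop)
    also have "\<dots> \<le> ?a * ((norm h * B) * ?b)"
      using B n by (intro mult_left_mono mult_right_mono) auto
    finally show "prod_list (map norm (xs[k := L h])) \<le> ?a * B * ?b * norm h"
      by (simp add: ac_simps)
  qed
qed

lemma sum_prod_list_update_le:
  fixes as' :: "('w::real_normed_vector \<Rightarrow> 'a::real_normed_vector) list"
  assumes "\<And>k. k < length xs \<Longrightarrow> bounded_linear (as' ! k)"
  obtains K where "K \<ge> 0" "\<And>h. (\<Sum>k<length xs. prod_list (map norm (xs[k := (as' ! k) h]))) \<le> K * norm h"
proof -
  have "\<exists>K. K \<ge> 0 \<and> (\<forall>h. prod_list (map norm (xs[k := (as' ! k) h])) \<le> K * norm h)" if "k < length xs" for k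
    using prod_list_update_le[OF assms[OF that] that] by metis
  then have "\<exists>K. \<forall>k. k < length xs \<longrightarrow> K k \<ge> 0 \<and> (\<forall>h. prod_list (map norm (xs[k := (as' ! k) h])) \<le> K k * norm h)"
    by (intro choice) blast
  then obtain K where K: "\<And>k. k < length xs \<Longrightarrow> K k \<ge> 0"
    "\<And>k h. k < length xs \<Longrightarrow> prod_list (map norm (xs[k := (as' ! k) h])) \<le> K k * norm h"
    by blast
  show thesis
    by (rule that[of "\<Sum>k<length xs. K k"])
      (auto simp: sum_distrib_right intro!: sum_nonneg sum_mono K)
qed

text \<open>The differential of the multilinear map \<open>m\<close> at \<open>vs\<close> in the
  direction \<open>hs\<close>, by the Leibniz rule.\<close>

definition multi_deriv :: "('a list \<Rightarrow> 'b::real_normed_vector) \<Rightarrow> 'a list \<Rightarrow> 'a list \<Rightarrow> 'b" where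
  "multi_deriv m vs hs = (\<Sum>k<length vs. m (vs[k := hs ! k]))"

lemma multi_deriv_Nil [simp]: "multi_deriv m [] hs = 0"
  by (simp add: multi_deriv_def)

lemma multi_deriv_Cons [simp]:
  "multi_deriv m (v # vs) (h # hs) = m (h # vs) + multi_deriv (\<lambda>us. m (v # us)) vs hs"
  by (simp add: multi_deriv_def sum.lessThan_Suc_shift del: sum.lessThan_Suc)

text \<open>The radius is fixed before \<open>m\<close>, because the induction step applies the
  hypothesis to us |-> m (a y # us), a map that changes with the point y and of which only the bound
  is controlled. The remainder for \<open>a # as\<close> then splits into the remainder for the
  tail, the change of the Leibniz terms of the tail when the first slot moves from a w to a y, and
  the remainder of \<open>a\<close> itself in the first slot.\<close>

lemma multi_remainder:
  fixes as :: "('w::real_normed_vector \<Rightarrow> 'a::real_normed_vector) list"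
  assumes "list_all2 (\<lambda>a a'. (a has_derivative a') (at w)) as as'" "e > 0"
  shows "\<exists>d>0. \<forall>(m :: 'a list \<Rightarrow> 'b::real_normed_vector) C y. bounded_multilinear (length as) m \<longrightarrow>
     C \<ge> 0 \<longrightarrow> (\<forall>vs. length vs = length as \<longrightarrow> norm (m vs) \<le> C * prod_list (map norm vs)) \<longrightarrow>
     norm (y - w) < d \<longrightarrow>
     norm (m (map (\<lambda>a. a y) as) - m (map (\<lambda>a. a w) as)
        - multi_deriv m (map (\<lambda>a. a w) as) (map (\<lambda>a. a (y - w)) as')) \<le> C * e * norm (y - w)"
  using assms
proof (induction as as' arbitrary: e rule: list_all2_induct)
  case Nil
  then show ?case by (auto intro!: exI[of _ 1])
next
  case (Cons a as a' as')
  let ?ws = "map (\<lambda>a. a w) as"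
  have len: "length as' = length as" using Cons.hyps(2) by (simp add: list_all2_lengthD)
  have bl: "bounded_linear (as' ! k)" if "k < length ?ws" for k
    using Cons.hyps(2) that by (auto simp: list_all2_conv_all_nth intro: has_derivative_bounded_linear)
  obtain K where K: "K \<ge> 0" "\<And>h. (\<Sum>k<length ?ws. prod_list (map norm (?ws[k := (as' ! k) h]))) \<le> K * norm h"
    by (rule sum_prod_list_update_le[of ?ws as', OF bl]) blast+
  define N where "N = prod_list (map norm ?ws)"
  have N: "N \<ge> 0" unfolding N_def by (auto intro!: prod_list_nonneg)
  \<comment> \<open>Each of the three parts may cost e / 3: \<open>e1\<close> pays for the bound
    norm (a w) + 1 on the first slot, \<open>e2\<close> for the bound \<open>K\<close> of the
    Leibniz terms of the tail, \<open>e3\<close> for the product \<open>N\<close> of the norms of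
    the tail. The cap 1 in \<open>e2\<close> keeps norm (a y) below norm (a w) + 1.\<close>
  define e1 where "e1 = e / (3 * (norm (a w) + 1))"
  define e2 where "e2 = min 1 (e / (3 * (K + 1)))"
  define e3 where "e3 = e / (3 * (N + 1))"
  have pos: "e1 > 0" "e2 > 0" "e3 > 0"
    using \<open>e > 0\<close> K(1) N by (auto simp: e1_def e2_def e3_def add_nonneg_pos intro!: divide_pos_pos)
  have ee: "e1 * (norm (a w) + 1) \<le> e / 3" "e2 * K \<le> e / 3" "e3 * N \<le> e / 3" "e2 \<le> 1"
  proof -
    have "norm (a w) + 1 > 0" by (simp add: add_nonneg_pos)
    then show "e1 * (norm (a w) + 1) \<le> e / 3" by (simp add: e1_def field_simps)
    have "e2 * K \<le> e / (3 * (K + 1)) * K" using K(1) by (intro mult_right_mono) (auto simp: e2_def)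
    also have "\<dots> \<le> e / 3" using K(1) \<open>e > 0\<close> by (simp add: field_simps)
    finally show "e2 * K \<le> e / 3" .
    show "e3 * N \<le> e / 3" using N \<open>e > 0\<close> by (simp add: e3_def field_simps)
    show "e2 \<le> 1" by (simp add: e2_def)
  qed
  obtain d1 where d1: "d1 > 0"
    "\<And>(m :: 'a list \<Rightarrow> 'b) C y. bounded_multilinear (length as) m \<Longrightarrow> C \<ge> 0 \<Longrightarrow>
      (\<And>vs. length vs = length as \<Longrightarrow> norm (m vs) \<le> C * prod_list (map norm vs)) \<Longrightarrow>
     norm (y - w) < d1 \<Longrightarrow>
     norm (m (map (\<lambda>a. a y) as) - m (map (\<lambda>a. a w) as)
        - multi_deriv m (map (\<lambda>a. a w) as) (map (\<lambda>a. a (y - w)) as')) \<le> C * e1 * norm (y - w)"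
    using Cons.IH[OF pos(1)] by blast
  have "isCont a w" using Cons.hyps(1) by (rule has_derivative_continuous)
  then obtain d2 where d2: "d2 > 0" "\<And>y. norm (y - w) < d2 \<Longrightarrow> norm (a y - a w) < e2"
    using pos(2) unfolding continuous_at_eps_delta dist_norm by blast
  obtain d3 where d3: "d3 > 0" "\<And>y. norm (y - w) < d3 \<Longrightarrow> norm (a y - a w - a' (y - w)) \<le> e3 * norm (y - w)"
    using Cons.hyps(1) pos(3) unfolding has_derivative_at_alt by blast
  show ?case
  proof (intro exI[of _ "min d1 (min d2 d3)"] conjI allI impI)
    show "0 < min d1 (min d2 d3)" using d1 d2 d3 by simp
    fix m :: "'a list \<Rightarrow> 'b" and C y
    assume bm: "bounded_multilinear (length (a # as)) m" and C: "C \<ge> 0"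
      and bd: "\<forall>vs. length vs = length (a # as) \<longrightarrow> norm (m vs) \<le> C * prod_list (map norm vs)"
      and y: "norm (y - w) < min d1 (min d2 d3)"
    define h where "h = y - w"
    let ?ys = "map (\<lambda>a. a y) as" and ?hs = "map (\<lambda>a. a h) as'"
    have mb: "norm (m (v # vs)) \<le> C * norm v * prod_list (map norm vs)" if "length vs = length as" for v vs
      using bd[rule_format, of "v # vs"] that by (simp add: ac_simps)
    have bmc: "bounded_multilinear (length as) (\<lambda>us. m (v # us))" for v
      unfolding bounded_multilinear_def
    proof (intro conjI allI impI)
      fix us ws :: "'a list" assume "length us + length ws + 1 = length as"
      then show "linear (\<lambda>va. m (v # us @ va # ws))"
        using bounded_multilinear_linear[OF bm, of "v # us" ws] by simp
    next
      show "\<exists>Ca. \<forall>vs. length vs = length as \<longrightarrow> norm (m (v # vs)) \<le> Ca * prod_list (map norm vs)"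
        using mb by blast
    qed
    have lin: "linear (\<lambda>v. m (v # vs))" if "length vs = length as" for vs
      using bounded_multilinear_linear_Cons[of "length as" m vs] bm that by simp

    define R1 where "R1 = m (a y # ?ys) - m (a y # ?ws) - multi_deriv (\<lambda>us. m (a y # us)) ?ws ?hs"
    define R2 where "R2 = multi_deriv (\<lambda>us. m (a y # us)) ?ws ?hs - multi_deriv (\<lambda>us. m (a w # us)) ?ws ?hs"
    define R3 where "R3 = m (a y # ?ws) - m (a w # ?ws) - m (a' h # ?ws)"
    have "norm R1 \<le> (C * norm (a y)) * e1 * norm h"
      unfolding R1_def h_def using y C
      by (intro d1(2) bmc mb) auto
    also have "norm (a y) \<le> norm (a w) + 1"
      using d2(2)[of y] y ee(4) norm_triangle_sub[of "a y" "a w"] by simp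
    hence "(C * norm (a y)) * e1 * norm h \<le> (C * (norm (a w) + 1)) * e1 * norm h"
      using C pos by (intro mult_right_mono mult_left_mono) auto
    also have "\<dots> = C * norm h * (e1 * (norm (a w) + 1))" by (simp add: ac_simps)
    also have "\<dots> \<le> C * norm h * (e / 3)"
      using C ee by (intro mult_left_mono) auto
    finally have r1: "norm R1 \<le> C * norm h * (e / 3)" .
    have "R2 = (\<Sum>k<length as. m ((a y - a w) # ?ws[k := ?hs ! k]))"
      unfolding R2_def multi_deriv_def by (simp add: sum_subtractf[symmetric] linear_diff[OF lin])
    also have "norm \<dots> \<le> (\<Sum>k<length as. C * norm (a y - a w) * prod_list (map norm (?ws[k := ?hs ! k])))"
      by (intro order_trans[OF norm_sum] sum_mono mb) auto
    also have "\<dots> = C * norm (a y - a w) * (\<Sum>k<length ?ws. prod_list (map norm (?ws[k := (as' ! k) h])))"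
      using len by (simp add: sum_distrib_left)
    also have "\<dots> \<le> C * norm (a y - a w) * (K * norm h)"
      using C by (intro mult_left_mono K(2)) auto
    also have "\<dots> \<le> C * e2 * (K * norm h)"
      using C K(1) d2(2)[of y] y by (intro mult_left_mono mult_right_mono) (auto simp: less_imp_le)
    also have "\<dots> = C * norm h * (e2 * K)" by (simp add: ac_simps)
    also have "\<dots> \<le> C * norm h * (e / 3)" using C ee by (intro mult_left_mono) auto
    finally have r2: "norm R2 \<le> C * norm h * (e / 3)" .
    have "R3 = m ((a y - a w - a' h) # ?ws)"
      unfolding R3_def by (simp add: linear_diff[OF lin])
    also have "norm \<dots> \<le> C * norm (a y - a w - a' h) * N"
      unfolding N_def by (rule mb) simp
    also have "\<dots> \<le> C * (e3 * norm h) * N"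
      using C N d3(2)[of y] y by (intro mult_left_mono mult_right_mono) (auto simp: h_def)
    also have "\<dots> = C * norm h * (e3 * N)" by (simp add: ac_simps)
    also have "\<dots> \<le> C * norm h * (e / 3)" using C ee by (intro mult_left_mono) auto
    finally have r3: "norm R3 \<le> C * norm h * (e / 3)" .
    have eq: "m (map (\<lambda>a. a y) (a # as)) - m (map (\<lambda>a. a w) (a # as))
        - multi_deriv m (map (\<lambda>a. a w) (a # as)) (map (\<lambda>a. a (y - w)) (a' # as')) = R1 + R2 + R3"
      by (simp add: R1_def R2_def R3_def h_def)
    have "norm (R1 + R2 + R3) \<le> norm R1 + norm R2 + norm R3"
      by (meson add_right_mono norm_triangle_ineq norm_triangle_le order_trans)
    also have "\<dots> \<le> C * norm h * (e / 3) + C * norm h * (e / 3) + C * norm h * (e / 3)"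
      using r1 r2 r3 by linarith
    also have "\<dots> = C * e * norm (y - w)" by (simp add: h_def field_simps)
    finally show "norm (m (map (\<lambda>a. a y) (a # as)) - m (map (\<lambda>a. a w) (a # as))
        - multi_deriv m (map (\<lambda>a. a w) (a # as)) (map (\<lambda>a. a (y - w)) (a' # as'))) \<le> C * e * norm (y - w)"
      unfolding eq .
  qed
qed

lemma bounded_linear_multi_deriv:
  fixes as' :: "('w::real_normed_vector \<Rightarrow> 'a::real_normed_vector) list"
  assumes "bounded_multilinear (length vs) m" "length as' = length vs"
    "\<And>k. k < length vs \<Longrightarrow> bounded_linear (as' ! k)"
  shows "bounded_linear (\<lambda>h. multi_deriv m vs (map (\<lambda>a. a h) as'))"
proof -
  obtain C where C: "C \<ge> 0" "\<And>vs'. length vs' = length vs \<Longrightarrow> norm (m vs') \<le> C * prod_list (map norm vs')"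
    using bounded_multilinear_bound[OF assms(1)] by blast
  have "bounded_linear (\<lambda>h. m (vs[k := (as' ! k) h]))" if k: "k < length vs" for k
  proof -
    have l: "linear (\<lambda>h. m (vs[k := (as' ! k) h]))"
      using linear_compose[OF bounded_linear.linear[OF assms(3)[OF k]]
        bounded_multilinear_linear_update[OF assms(1) refl k]] by (simp add: o_def)
    obtain K where K: "K \<ge> 0" "\<And>h. prod_list (map norm (vs[k := (as' ! k) h])) \<le> K * norm h"
      using prod_list_update_le[OF assms(3)[OF k] k] by metis
    have "norm (m (vs[k := (as' ! k) h])) \<le> norm h * (C * K)" for h
    proof -
      have "norm (m (vs[k := (as' ! k) h])) \<le> C * prod_list (map norm (vs[k := (as' ! k) h]))"
        by (rule C) simp
      also have "\<dots> \<le> C * (K * norm h)" using C K by (intro mult_left_mono) auto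
      finally show ?thesis by (simp add: ac_simps)
    qed
    with l show ?thesis by (intro bounded_linear_intro[where K="C * K"])
        (auto simp: linear_add[OF l] linear_scale[OF l])
  qed
  then show ?thesis
    unfolding multi_deriv_def using assms(2) by (intro bounded_linear_sum) auto
qed

section \<open>Derivative sequences\<close>

text \<open>The arguments carry a fixed derivative sequence rather than a smooth function, so that
  dg and d^2g can be named: they are its terms of order 1 and 2.\<close>

definition derivs_on ::
    "'a::real_normed_vector set \<Rightarrow> (nat \<Rightarrow> 'a \<Rightarrow> 'a list \<Rightarrow> 'b::real_normed_vector) \<Rightarrow> bool" where
  "derivs_on S D \<longleftrightarrow> open S \<and>
        (\<forall>n. \<forall>x\<in>S. bounded_multilinear n (D n x)) \<and>
        (\<forall>n. \<forall>x\<in>S. \<forall>e>0. \<exists>d>0. \<forall>y\<in>S. dist y x < d \<longrightarrow>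
           (\<forall>vs. length vs = n \<longrightarrow>
              norm (D n y vs - D n x vs - D (Suc n) x ((y - x) # vs))
                \<le> e * norm (y - x) * prod_list (map norm vs)))"

lemma smooth_on_derivs:
  "smooth_on S f \<longleftrightarrow> (\<exists>D. derivs_on S D \<and> (\<forall>x\<in>S. D 0 x [] = f x))"
  unfolding smooth_on_def derivs_on_def by blast

lemma derivs_on_open: "derivs_on S D \<Longrightarrow> open S"
  and derivs_on_multilinear: "derivs_on S D \<Longrightarrow> x \<in> S \<Longrightarrow> bounded_multilinear n (D n x)"
  unfolding derivs_on_def by auto

lemma derivs_on_remainder:
  assumes "derivs_on S D" "x \<in> S" "e > 0"
  obtains d where "d > 0" "\<And>y vs. norm (y - x) < d \<Longrightarrow> y \<in> S \<and> (length vs = n \<longrightarrow>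
              norm (D n y vs - D n x vs - D (Suc n) x ((y - x) # vs))
                \<le> e * norm (y - x) * prod_list (map norm vs))"
proof -
  obtain d1 where "d1 > 0" and d1: "\<forall>y\<in>S. dist y x < d1 \<longrightarrow>
           (\<forall>vs. length vs = n \<longrightarrow>
              norm (D n y vs - D n x vs - D (Suc n) x ((y - x) # vs))
                \<le> e * norm (y - x) * prod_list (map norm vs))"
    using assms unfolding derivs_on_def by blast
  obtain d2 where "d2 > 0" and d2: "\<And>y. dist y x < d2 \<Longrightarrow> y \<in> S"
    using derivs_on_open[OF assms(1)] assms(2) unfolding open_dist by blast
  show thesis
    using d1 d2 \<open>d1 > 0\<close> \<open>d2 > 0\<close>
    by (intro that[of "min d1 d2"]) (auto simp: dist_norm)
qed

text \<open>Chain rule and Leibniz rule in one. Write D n (x y) (as y) as R y + D (Suc n) (x w) ((x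
  y - x w) # as y) + D n (x w) (as y). The operator norm estimate makes R y of order o(y - w), and
  in the other two terms the multilinear map is frozen at x w, so that
  \<open>multi_remainder\<close> differentiates them.\<close>

lemma derivs_on_has_derivative:
  fixes as :: "('w::real_normed_vector \<Rightarrow> 'a::real_normed_vector) list"
    and D :: "nat \<Rightarrow> 'a \<Rightarrow> 'a list \<Rightarrow> 'b::real_normed_vector"
  assumes D: "derivs_on S D" and x: "(x has_derivative x') (at w)" "x w \<in> S"
    and as: "list_all2 (\<lambda>a a'. (a has_derivative a') (at w)) as as'" and n: "n = length as"
  shows "((\<lambda>w. D n (x w) (map (\<lambda>a. a w) as)) has_derivative
     (\<lambda>h. D (Suc n) (x w) (x' h # map (\<lambda>a. a w) as)
        + multi_deriv (D n (x w)) (map (\<lambda>a. a w) as) (map (\<lambda>a. a h) as'))) (at w)"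
proof -
  let ?as = "\<lambda>w. map (\<lambda>a. a w) as" and ?as' = "\<lambda>w. map (\<lambda>a. a w) as'"
  have bm: "bounded_multilinear (length as) (D n (x w))"
    using derivs_on_multilinear[OF D x(2), of n] n by simp
  have lens: "length as' = length as" using as by (simp add: list_all2_lengthD)
  have bl: "bounded_linear (as' ! k)" if "k < length as" for k
    using as that by (auto simp: list_all2_conv_all_nth intro: has_derivative_bounded_linear)
  have multi: "((\<lambda>w'. m (map (\<lambda>a. a w') as)) has_derivative (\<lambda>h. multi_deriv m (map (\<lambda>a. a w) as) (map (\<lambda>a. a h) as'))) (at w)"
    if m: "bounded_multilinear (length as) m" 
      and as: "list_all2 (\<lambda>a a'. (a has_derivative a') (at w)) as as'"
    for m :: "'a list \<Rightarrow> 'b" and as :: "('w \<Rightarrow> 'a) list" and as'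
    unfolding has_derivative_at_alt
  proof (intro conjI allI impI)
    have "bounded_linear (as' ! k)" if "k < length as" for k
      using as that by (auto simp: list_all2_conv_all_nth intro: has_derivative_bounded_linear)
    then show "bounded_linear (\<lambda>h. multi_deriv m (map (\<lambda>a. a w) as) (map (\<lambda>a. a h) as'))"
      using as m by (intro bounded_linear_multi_deriv) (auto simp: list_all2_lengthD)
    fix e :: real assume "e > 0"
    obtain C where C: "C \<ge> 0" "\<And>vs'. length vs' = length as \<Longrightarrow> norm (m vs') \<le> C * prod_list (map norm vs')"
      using bounded_multilinear_bound[OF m] by blast
    have e': "e / (C + 1) > 0" using \<open>e > 0\<close> C by auto
    have "C * (e / (C + 1)) \<le> e" using C(1) \<open>e > 0\<close> by (simp add: field_simps)
    then have "C * (e / (C + 1)) * norm y \<le> e * norm y" for y :: 'w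
      by (intro mult_right_mono) auto
    then show "\<exists>d>0. \<forall>y. norm (y - w) < d \<longrightarrow>
        norm (m (map (\<lambda>a. a y) as) - m (map (\<lambda>a. a w) as)
         - multi_deriv m (map (\<lambda>a. a w) as) (map (\<lambda>a. a (y - w)) as')) \<le> e * norm (y - w)"
      using multi_remainder[OF as e', where 'b='b] C m by (meson order_trans)
  qed
  define R where "R = (\<lambda>y. D n (x y) (?as y) - D n (x w) (?as y) - D (Suc n) (x w) ((x y - x w) # ?as y))"
  have R: "(R has_derivative (\<lambda>h. 0)) (at w)"
    unfolding has_derivative_at_alt
  proof (intro conjI allI impI)
    show "bounded_linear (\<lambda>h::'w. 0::'b)" by (rule bounded_linear_zero)
    fix e :: real assume "e > 0"
    have "((\<lambda>y. prod_list (map (\<lambda>a. norm (a y)) as)) \<longlongrightarrow> prod_list (map (\<lambda>a. norm (a w)) as)) (at w)"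
      using as
    proof (induction as as' rule: list_all2_induct)
      case (Cons a as a' as')
      have "(a \<longlongrightarrow> a w) (at w)" using Cons.hyps(1) has_derivative_continuous isContD by blast
      then show ?case using Cons.IH by (auto intro!: tendsto_intros)
    qed simp
    then have "eventually (\<lambda>y. prod_list (map (\<lambda>a. norm (a y)) as) < prod_list (map (\<lambda>a. norm (a w)) as) + 1) (at w)"
      by (rule order_tendstoD) simp
    then obtain d1 where "d1 > 0" and d1: "\<And>y. y \<noteq> w \<Longrightarrow> norm (y - w) < d1 \<Longrightarrow>
        prod_list (map (\<lambda>a. norm (a y)) as) < prod_list (map (\<lambda>a. norm (a w)) as) + 1"
      unfolding eventually_at dist_norm by auto
    define P where "P = prod_list (map (\<lambda>a. norm (a w)) as) + 1"
    have P: "P > 0" unfolding P_def by (auto intro!: add_nonneg_pos prod_list_nonneg)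
    obtain B where B: "\<And>h. norm (x' h) \<le> norm h * B" "B \<ge> 0"
      using bounded_linear.nonneg_bounded[OF has_derivative_bounded_linear[OF x(1)]] by blast
    obtain d2 where "d2 > 0" and d2: "\<And>y. norm (y - w) < d2 \<Longrightarrow> norm (x y - x w - x' (y - w)) \<le> 1 * norm (y - w)"
      using x(1) zero_less_one unfolding has_derivative_at_alt by metis
    \<comment> \<open>Near w, norm (x y - x w) is at most (B + 1) norm (y - w), and the product of
      the norms of the arguments is at most \<open>P\<close>.\<close>
    define e' where "e' = e / ((B + 1) * P)"
    have e': "e' > 0" using \<open>e > 0\<close> B P by (auto simp: e'_def)
    obtain d3 where "d3 > 0" and d3: "\<And>y vs. norm (y - x w) < d3 \<Longrightarrow> y \<in> S \<and> (length vs = n \<longrightarrow>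
              norm (D n y vs - D n (x w) vs - D (Suc n) (x w) ((y - x w) # vs))
                \<le> e' * norm (y - x w) * prod_list (map norm vs))"
      using derivs_on_remainder[OF D x(2) e'] by metis
    have "isCont x w" using x(1) by (rule has_derivative_continuous)
    then obtain d4 where "d4 > 0" and d4: "\<And>y. norm (y - w) < d4 \<Longrightarrow> norm (x y - x w) < d3"
      using \<open>d3 > 0\<close> unfolding continuous_at_eps_delta dist_norm by blast
    show "\<exists>d>0. \<forall>y. norm (y - w) < d \<longrightarrow> norm (R y - R w - 0) \<le> e * norm (y - w)"
    proof (intro exI[of _ "min d1 (min d2 d4)"] conjI allI impI)
      show "0 < min d1 (min d2 d4)" using \<open>d1 > 0\<close> \<open>d2 > 0\<close> \<open>d4 > 0\<close> by simp
      fix y assume y: "norm (y - w) < min d1 (min d2 d4)"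
      have lin: "linear (\<lambda>v. D (Suc n) (x w) (v # ?as w))"
        using bounded_multilinear_linear_Cons[OF derivs_on_multilinear[OF D x(2)], of "?as w" n] n by simp
      have Rw: "R w = 0" unfolding R_def using linear_0[OF lin] by simp
      show "norm (R y - R w - 0) \<le> e * norm (y - w)"
      proof (cases "y = w")
        case False
        have "norm (R y) \<le> e' * norm (x y - x w) * prod_list (map norm (?as y))"
          unfolding R_def using d3[of "x y" "?as y"] d4[of y] y n by simp
        also have "prod_list (map norm (?as y)) \<le> P"
          using d1[OF False] y by (simp add: P_def o_def less_imp_le)
        hence "e' * norm (x y - x w) * prod_list (map norm (?as y)) \<le> e' * norm (x y - x w) * P"
          using e' by (intro mult_left_mono) auto
        also have "norm (x y - x w) \<le> (B + 1) * norm (y - w)"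
          using d2[of y] y B(1)[of "y - w"] norm_triangle_sub[of "x y - x w" "x' (y - w)"]
          by (simp add: algebra_simps)
        hence "e' * norm (x y - x w) * P \<le> e' * ((B + 1) * norm (y - w)) * P"
          using e' P by (intro mult_left_mono mult_right_mono) auto
        also have "\<dots> = e * norm (y - w)"
          using P B(2) by (simp add: e'_def)
        finally show ?thesis using Rw by simp
      qed (simp)
    qed
  qed
  have x1: "((\<lambda>w'. x w' - x w) has_derivative x') (at w)"
    using has_derivative_diff[OF x(1) has_derivative_const] by simp
  have m1: "((\<lambda>w'. D (Suc n) (x w) (map (\<lambda>a. a w') ((\<lambda>w'. x w' - x w) # as))) has_derivative
     (\<lambda>h. multi_deriv (D (Suc n) (x w)) (map (\<lambda>a. a w) ((\<lambda>w'. x w' - x w) # as)) (map (\<lambda>a. a h) (x' # as')))) (at w)"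
    using derivs_on_multilinear[OF D x(2), of "Suc n"] n as x1 by (intro multi) auto
  \<comment> \<open>At w the new first slot x y - x w is zero, so the Leibniz terms that
    differentiate any other slot vanish.\<close>
  have z: "D (Suc n) (x w) (0 # us) = 0" if "length us = n" for us
    using linear_0[OF bounded_multilinear_linear_Cons[OF derivs_on_multilinear[OF D x(2)] that]] .
  have z2: "multi_deriv (\<lambda>us. D (Suc n) (x w) (0 # us)) (?as w) hs = 0" for hs
    unfolding multi_deriv_def using z n by auto
  have "((\<lambda>y. R y + D (Suc n) (x w) ((x y - x w) # ?as y) + D n (x w) (?as y)) has_derivative
     (\<lambda>h. 0 + D (Suc n) (x w) (x' h # ?as w) + multi_deriv (D n (x w)) (?as w) (?as' h))) (at w)"
    using m1 by (intro has_derivative_add R multi bm as) (simp_all add: z2)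
  then show ?thesis by (simp add: R_def)
qed

section \<open>Smooth curves in normed spaces\<close>

lemma curve_deriv_0 [simp]: "curve_deriv 0 c = c"
  by (simp add: curve_deriv_def)

lemma curve_deriv_Suc: "curve_deriv (Suc n) c t = vector_derivative (curve_deriv n c) (at t)"
  by (simp add: curve_deriv_def)

lemma curve_deriv_curve_deriv: "curve_deriv m (curve_deriv n c) = curve_deriv (m + n) c"
  by (simp add: curve_deriv_def funpow_add)

text \<open>The derivatives of a curve all stay in one type, so no sequence of multilinear maps is
  needed; \<open>smooth_on_curve_iff\<close> identifies this notion with
  \<open>smooth_on\<close>.\<close>

definition csmooth :: "real set \<Rightarrow> (real \<Rightarrow> 'a::real_normed_vector) \<Rightarrow> bool" where
  "csmooth I c \<longleftrightarrow> open I \<and> (\<forall>n. \<forall>t\<in>I. curve_deriv n c differentiable at t)"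

lemma csmooth_open: "csmooth I c \<Longrightarrow> open I"
  by (simp add: csmooth_def)

lemma csmooth_deriv:
  "csmooth I c \<Longrightarrow> t \<in> I \<Longrightarrow> (curve_deriv n c has_vector_derivative curve_deriv (Suc n) c t) (at t)"
  by (simp add: csmooth_def curve_deriv_Suc vector_derivative_works)

lemma csmooth_deriv_0:
  "csmooth I c \<Longrightarrow> t \<in> I \<Longrightarrow> (c has_vector_derivative curve_deriv (Suc 0) c t) (at t)"
  using csmooth_deriv[of I c t 0] by simp

lemma csmooth_curve_deriv: "csmooth I c \<Longrightarrow> csmooth I (curve_deriv n c)"
  by (simp add: csmooth_def curve_deriv_curve_deriv)

lemma csmooth_subset: "csmooth I c \<Longrightarrow> open J \<Longrightarrow> J \<subseteq> I \<Longrightarrow> csmooth J c"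
  by (auto simp: csmooth_def)

lemma csmooth_coinduct:
  assumes "open I" "Q c"
    and step: "\<And>c. Q c \<Longrightarrow> \<exists>c'. Q c' \<and> (\<forall>t\<in>I. (c has_vector_derivative c' t) (at t))"
  shows "csmooth I c"
proof -
  have *: "\<exists>c'. Q c' \<and> (\<forall>t\<in>I. curve_deriv n c t = c' t)" for n
  proof (induction n)
    case 0 then show ?case using \<open>Q c\<close> by auto
  next
    case (Suc n)
    then obtain c' where c': "Q c'" "\<forall>t\<in>I. curve_deriv n c t = c' t" by blast
    obtain c'' where c'': "Q c''" "\<forall>t\<in>I. (c' has_vector_derivative c'' t) (at t)"
      using step[OF c'(1)] by blast
    have "(curve_deriv n c has_vector_derivative c'' t) (at t)" if "t \<in> I" for t
      using c''(2) c'(2) that \<open>open I\<close>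
      by (auto intro: has_vector_derivative_transform_within_open[of c' _ t I])
    then show ?case using c''(1) by (auto simp: curve_deriv_Suc vector_derivative_at)
  qed
  show ?thesis
    unfolding csmooth_def
  proof (intro conjI allI ballI)
    fix n t assume t: "t \<in> I"
    obtain c' where c': "Q c'" "\<forall>t\<in>I. curve_deriv n c t = c' t" using * by blast
    obtain c'' where c'': "\<forall>t\<in>I. (c' has_vector_derivative c'' t) (at t)"
      using step[OF c'(1)] by blast
    have "(curve_deriv n c has_vector_derivative c'' t) (at t)"
      using c'' c'(2) t \<open>open I\<close>
      by (auto intro: has_vector_derivative_transform_within_open[of c' _ t I])
    then show "curve_deriv n c differentiable at t" by (rule differentiableI_vector)
  qed (fact \<open>open I\<close>)
qed

lemma curve_deriv_cong:
  assumes "open I" "\<And>t. t \<in> I \<Longrightarrow> c t = d t" "t \<in> I"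
  shows "curve_deriv n c t = curve_deriv n d t"
  using assms(3)
proof (induction n arbitrary: t)
  case 0 then show ?case using assms by simp
next
  case (Suc n)
  have "eventually (\<lambda>s. curve_deriv n c s = curve_deriv n d s) (nhds t)"
    using Suc \<open>open I\<close> eventually_nhds by blast
  then show ?case unfolding curve_deriv_Suc
    by (intro vector_derivative_cong_eq) (auto elim: eventually_mono)
qed

lemma csmooth_cong:
  assumes "\<And>t. t \<in> I \<Longrightarrow> c t = d t" "csmooth I c"
  shows "csmooth I d"
proof (rule csmooth_coinduct[where Q="\<lambda>d. \<exists>c. csmooth I c \<and> (\<forall>t\<in>I. c t = d t)"])
  show I: "open I" using assms(2) by (rule csmooth_open)
  fix d assume "\<exists>c. csmooth I c \<and> (\<forall>t\<in>I. c t = d t)"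
  then obtain c where c: "csmooth I c" "\<forall>t\<in>I. c t = d t" by blast
  then have "\<forall>t\<in>I. (d has_vector_derivative curve_deriv (Suc 0) c t) (at t)"
    using I by (auto intro: has_vector_derivative_transform_within_open[of c] csmooth_deriv_0)
  then show "\<exists>c'. (\<exists>c. csmooth I c \<and> (\<forall>t\<in>I. c t = c' t)) \<and> (\<forall>t\<in>I. (d has_vector_derivative c' t) (at t))"
    using csmooth_curve_deriv[OF c(1)] by blast
qed (use assms in blast)



lemma csmooth_linear:
  assumes "bounded_linear L" "csmooth I c"
  shows "csmooth I (\<lambda>t. L (c t))"
proof (rule csmooth_coinduct[where Q="\<lambda>d. \<exists>c. csmooth I c \<and> d = (\<lambda>t. L (c t))"])
  show "open I" using assms(2) by (rule csmooth_open)
  fix d assume "\<exists>c. csmooth I c \<and> d = (\<lambda>t. L (c t))"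
  then obtain c where c: "csmooth I c" "d = (\<lambda>t. L (c t))" by blast
  have "\<forall>t\<in>I. (d has_vector_derivative L (curve_deriv (Suc 0) c t)) (at t)"
    unfolding c(2) by (auto intro!: bounded_linear.has_vector_derivative[OF assms(1)] csmooth_deriv_0[OF c(1)])
  then show "\<exists>c'. (\<exists>c. csmooth I c \<and> c' = (\<lambda>t. L (c t))) \<and> (\<forall>t\<in>I. (d has_vector_derivative c' t) (at t))"
    using csmooth_curve_deriv[OF c(1)] by (intro exI[of _ "\<lambda>t. L (curve_deriv (Suc 0) c t)"]) auto
qed (use assms in blast)

lemma curve_deriv_linear:
  assumes "bounded_linear L" "csmooth I c" "t \<in> I"
  shows "curve_deriv n (\<lambda>t. L (c t)) t = L (curve_deriv n c t)"
  using assms(3)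
proof (induction n arbitrary: t)
  case (Suc n)
  have I: "open I" using assms(2) by (rule csmooth_open)
  have "((\<lambda>t. L (curve_deriv n c t)) has_vector_derivative L (curve_deriv (Suc n) c t)) (at t)"
    by (intro bounded_linear.has_vector_derivative[OF assms(1)] csmooth_deriv[OF assms(2)] Suc.prems)
  then have "(curve_deriv n (\<lambda>t. L (c t)) has_vector_derivative L (curve_deriv (Suc n) c t)) (at t)"
    using Suc I by (auto intro: has_vector_derivative_transform_within_open[of "\<lambda>t. L (curve_deriv n c t)"])
  then show ?case by (simp add: curve_deriv_Suc[of n "\<lambda>t. L (c t)"] vector_derivative_at)
qed simp

lemma csmooth_Pair:
  assumes "csmooth I c" "csmooth I d"
  shows "csmooth I (\<lambda>t. (c t, d t))"
proof (rule csmooth_coinduct[where Q="\<lambda>e. \<exists>c d. csmooth I c \<and> csmooth I d \<and> e = (\<lambda>t. (c t, d t))"])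
  show "open I" using assms(2) by (rule csmooth_open)
  fix e assume "\<exists>c d. csmooth I c \<and> csmooth I d \<and> e = (\<lambda>t. (c t, d t))"
  then obtain c d where c: "csmooth I c" "csmooth I d" "e = (\<lambda>t. (c t, d t))" by blast
  have "\<forall>t\<in>I. (e has_vector_derivative (curve_deriv (Suc 0) c t, curve_deriv (Suc 0) d t)) (at t)"
    unfolding c(3) using c by (auto intro!: has_vector_derivative_Pair csmooth_deriv_0)
  then show "\<exists>c'. (\<exists>c d. csmooth I c \<and> csmooth I d \<and> c' = (\<lambda>t. (c t, d t))) \<and> (\<forall>t\<in>I. (e has_vector_derivative c' t) (at t))"
    using csmooth_curve_deriv[OF c(1)] csmooth_curve_deriv[OF c(2)] by blast
qed (use assms in blast)

lemma csmooth_affine: "open I \<Longrightarrow> csmooth I (\<lambda>t. a + t *\<^sub>R b)"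
  for a :: "'a::real_normed_vector"
proof (rule csmooth_coinduct[where Q="\<lambda>c. \<exists>a b. c = (\<lambda>t. a + t *\<^sub>R b)"])
  fix c :: "real \<Rightarrow> 'a" assume "\<exists>a b. c = (\<lambda>t. a + t *\<^sub>R b)"
  then obtain a b where "c = (\<lambda>t. a + t *\<^sub>R b)" by blast
  then have "\<forall>t\<in>I. (c has_vector_derivative (b + t *\<^sub>R 0)) (at t)"
    by (auto intro!: derivative_eq_intros simp: has_vector_derivative_def)
  then show "\<exists>c'. (\<exists>a b. c' = (\<lambda>t. a + t *\<^sub>R b)) \<and> (\<forall>t\<in>I. (c has_vector_derivative c' t) (at t))"
    by (intro exI[of _ "\<lambda>t. b + t *\<^sub>R 0"]) blast
qed blast+

section \<open>Smooth maps act on jets of curves\<close>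

text \<open>Order 0 is included, in contrast to the derivative clause of \<open>jet_equiv\<close>,
  so that (k+1)-jets reduce to values and the k-jets of the first derivatives.\<close>

definition jeteq :: "nat \<Rightarrow> real \<Rightarrow> (real \<Rightarrow> 'a::real_normed_vector) \<Rightarrow> (real \<Rightarrow> 'a) \<Rightarrow> bool" where
  "jeteq k t c d \<longleftrightarrow> (\<forall>i\<le>k. curve_deriv i c t = curve_deriv i d t)"

lemma jeteq_Suc:
  "jeteq (Suc k) t c d \<longleftrightarrow> c t = d t \<and> jeteq k t (curve_deriv (Suc 0) c) (curve_deriv (Suc 0) d)"
  unfolding jeteq_def curve_deriv_curve_deriv
  by (metis One_nat_def Suc_le_mono add.right_neutral add_Suc_right curve_deriv_0 le0 not0_implies_Suc)

lemma jeteq_cong: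
  assumes "open I" "t \<in> I" "\<And>s. s \<in> I \<Longrightarrow> c s = c' s" "\<And>s. s \<in> I \<Longrightarrow> d s = d' s"
  shows "jeteq k t c d \<longleftrightarrow> jeteq k t c' d'"
  unfolding jeteq_def using curve_deriv_cong[OF assms(1)] assms by metis

lemma jeteq_mono: "jeteq k t c d \<Longrightarrow> j \<le> k \<Longrightarrow> jeteq j t c d"
  by (auto simp: jeteq_def)

lemma jeteq_at: "jeteq k t c d \<Longrightarrow> c t = d t"
  by (metis curve_deriv_0 jeteq_def le0)

text \<open>The consequences of smoothness that jets of curves depend on. For the coordinate changes
  of the tangent bundle only these are established, which avoids a derivative sequence for (x, v)
  |-> (g x, dg(x) v).\<close>

definition jet_smooth :: "'a::real_normed_vector set \<Rightarrow> ('a \<Rightarrow> 'b::real_normed_vector) \<Rightarrow> bool" where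
  "jet_smooth S f \<longleftrightarrow> open S \<and>
     (\<forall>I c. csmooth I c \<longrightarrow> c ` I \<subseteq> S \<longrightarrow> csmooth I (f \<circ> c)) \<and>
     (\<forall>I c d t k. csmooth I c \<longrightarrow> csmooth I d \<longrightarrow> c ` I \<subseteq> S \<longrightarrow> d ` I \<subseteq> S \<longrightarrow> t \<in> I \<longrightarrow>
        jeteq k t c d \<longrightarrow> jeteq k t (f \<circ> c) (f \<circ> d))"

lemma jet_smooth_open: "jet_smooth S f \<Longrightarrow> open S"
  and jet_smooth_csmooth: "jet_smooth S f \<Longrightarrow> csmooth I c \<Longrightarrow> c ` I \<subseteq> S \<Longrightarrow> csmooth I (f \<circ> c)"
  and jet_smooth_jeteq: "jet_smooth S f \<Longrightarrow> csmooth I c \<Longrightarrow> csmooth I d \<Longrightarrow> c ` I \<subseteq> S \<Longrightarrow> d ` I \<subseteq> S \<Longrightarrow>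
     t \<in> I \<Longrightarrow> jeteq k t c d \<Longrightarrow> jeteq k t (f \<circ> c) (f \<circ> d)"
  unfolding jet_smooth_def by blast+

lemma jet_smooth_cong:
  assumes "jet_smooth S f" "\<And>x. x \<in> S \<Longrightarrow> f x = g x"
  shows "jet_smooth S g"
  unfolding jet_smooth_def
proof (intro conjI allI impI)
  show "open S" using assms jet_smooth_open by blast
  have eq: "(f \<circ> c) s = (g \<circ> c) s" if "c ` I \<subseteq> S" "s \<in> I" for c :: "real \<Rightarrow> 'a" and I s
    using that assms(2) by auto
  fix I and c :: "real \<Rightarrow> 'a" assume c: "csmooth I c" "c ` I \<subseteq> S"
  show "csmooth I (g \<circ> c)"
    using csmooth_cong[OF eq[OF c(2)] jet_smooth_csmooth[OF assms(1) c]] .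
  fix d and t :: real and k assume d: "csmooth I d" "d ` I \<subseteq> S" and t: "t \<in> I" "jeteq k t c d"
  have "jeteq k t (f \<circ> c) (f \<circ> d)"
    using jet_smooth_jeteq[OF assms(1) c(1) d(1) c(2) d(2) t] .
  then show "jeteq k t (g \<circ> c) (g \<circ> d)"
    using jeteq_cong[OF csmooth_open[OF c(1)] t(1), of "f \<circ> c" "g \<circ> c" "f \<circ> d" "g \<circ> d" k]
      eq[OF c(2)] eq[OF d(2)] by blast
qed

text \<open>Sums of this form contain f o c, as the case of the single empty list, and are closed
  under differentiation in t. This is the formula of Faa di Bruno with coefficients replaced by
  repetition in the outer list.\<close>

definition deriv_sum :: "(nat \<Rightarrow> 'a \<Rightarrow> 'a list \<Rightarrow> 'b::real_normed_vector) \<Rightarrow> (real \<Rightarrow> 'a) \<Rightarrow> (real \<Rightarrow> 'a) list list \<Rightarrow> real \<Rightarrow> 'b" where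
  "deriv_sum D c ass t = (\<Sum>as\<leftarrow>ass. D (length as) (c t) (map (\<lambda>a. a t) as))"

definition dterm :: "(real \<Rightarrow> 'a::real_normed_vector) \<Rightarrow> (real \<Rightarrow> 'a) list \<Rightarrow> (real \<Rightarrow> 'a) list list" where
  "dterm c as = (curve_deriv (Suc 0) c # as) # map (\<lambda>k. as[k := curve_deriv (Suc 0) (as ! k)]) [0..<length as]"

definition dterms :: "(real \<Rightarrow> 'a::real_normed_vector) \<Rightarrow> (real \<Rightarrow> 'a) list list \<Rightarrow> (real \<Rightarrow> 'a) list list" where
  "dterms c ass = concat (map (dterm c) ass)"

lemma derivs_on_has_vector_derivative:
  assumes D: "derivs_on S D" and c: "(c has_vector_derivative c') (at t)" "c t \<in> S"
    and as: "list_all2 (\<lambda>a a'. (a has_vector_derivative a') (at t)) as as'" and n: "n = length as"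
  shows "((\<lambda>t. D n (c t) (map (\<lambda>a. a t) as)) has_vector_derivative
     (D (Suc n) (c t) (c' # map (\<lambda>a. a t) as)
        + (\<Sum>k<length as. D n (c t) ((map (\<lambda>a. a t) as)[k := as' ! k])))) (at t)"
proof -
  have len: "length as' = length as" using as by (simp add: list_all2_lengthD)
  have a2: "list_all2 (\<lambda>a a'. (a has_derivative a') (at t)) as (map (\<lambda>v h. h *\<^sub>R v) as')"
    using as by (simp add: list_all2_conv_all_nth has_vector_derivative_def)
  have lin: "linear (\<lambda>v. D (Suc n) (c t) (v # map (\<lambda>a. a t) as))"
    using n by (intro bounded_multilinear_linear_Cons[OF derivs_on_multilinear[OF D c(2)]]) simp
  have bm: "bounded_multilinear (length as) (D n (c t))"
    using derivs_on_multilinear[OF D c(2)] n by simp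
  have "multi_deriv (D n (c t)) (map (\<lambda>a. a t) as) (map (\<lambda>a. a h) (map (\<lambda>v h. h *\<^sub>R v) as'))
     = h *\<^sub>R (\<Sum>k<length as. D n (c t) ((map (\<lambda>a. a t) as)[k := as' ! k]))" for h
    unfolding multi_deriv_def scaleR_sum_right using len
    by (auto simp: linear_scale[OF bounded_multilinear_linear_update[OF bm]] intro!: sum.cong)
  then show ?thesis
    using derivs_on_has_derivative[OF D c(1)[unfolded has_vector_derivative_def] c(2) a2 n]
    by (simp add: has_vector_derivative_def linear_scale[OF lin] scaleR_add_right)
qed

lemma deriv_sum_deriv:
  assumes D: "derivs_on S D" and c: "csmooth I c" "c ` I \<subseteq> S" and t: "t \<in> I"
    and as: "\<And>as a. as \<in> set ass \<Longrightarrow> a \<in> set as \<Longrightarrow> csmooth I a"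
  shows "(deriv_sum D c ass has_vector_derivative deriv_sum D c (dterms c ass) t) (at t)"
  using as
proof (induction ass)
  case Nil then show ?case by (simp add: deriv_sum_def dterms_def)
next
  case (Cons as ass)
  have all: "list_all2 (\<lambda>a a'. (a has_vector_derivative a') (at t)) as (map (\<lambda>a. curve_deriv (Suc 0) a t) as)"
    using Cons.prems[of as] t by (auto simp: list_all2_conv_all_nth intro!: csmooth_deriv_0[of I])
  have cs: "c t \<in> S" using c t by auto
  have "((\<lambda>t. D (length as) (c t) (map (\<lambda>a. a t) as)) has_vector_derivative
      D (Suc (length as)) (c t) (curve_deriv (Suc 0) c t # map (\<lambda>a. a t) as)
        + (\<Sum>k<length as. D (length as) (c t) ((map (\<lambda>a. a t) as)[k := map (\<lambda>a. curve_deriv (Suc 0) a t) as ! k]))) (at t)"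
    by (rule derivs_on_has_vector_derivative[OF D csmooth_deriv_0[OF c(1) t] cs all refl])
  also have "D (Suc (length as)) (c t) (curve_deriv (Suc 0) c t # map (\<lambda>a. a t) as)
        + (\<Sum>k<length as. D (length as) (c t) ((map (\<lambda>a. a t) as)[k := map (\<lambda>a. curve_deriv (Suc 0) a t) as ! k]))
     = deriv_sum D c (dterm c as) t"
    by (simp add: deriv_sum_def dterm_def o_def map_update interv_sum_list_conv_sum_set_nat atLeast0LessThan)
  finally have "((\<lambda>t. D (length as) (c t) (map (\<lambda>a. a t) as) + deriv_sum D c ass t) has_vector_derivative
       deriv_sum D c (dterm c as) t + deriv_sum D c (dterms c ass) t) (at t)"
    using Cons by (intro has_vector_derivative_add) auto
  then show ?case by (simp add: deriv_sum_def[abs_def] dterms_def)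
qed

lemma dterms_csmooth:
  assumes "csmooth I c" "\<And>as a. as \<in> set ass \<Longrightarrow> a \<in> set as \<Longrightarrow> csmooth I a"
    "as \<in> set (dterms c ass)" "a \<in> set as"
  shows "csmooth I a"
proof -
  obtain bs where bs: "bs \<in> set ass" "as \<in> set (dterm c bs)"
    using assms(3) unfolding dterms_def by auto
  have b: "csmooth I b" if "b \<in> set bs" for b using assms(2) bs(1) that by blast
  have "a \<in> insert (curve_deriv (Suc 0) c) (set bs) \<or> (\<exists>b\<in>set bs. a = curve_deriv (Suc 0) b)"
    using bs(2) assms(4) unfolding dterm_def
    by (auto dest!: set_update_subset_insert[THEN subsetD])
  then show ?thesis
    using b assms(1) csmooth_curve_deriv by blast
qed

lemma deriv_sum_csmooth:
  assumes D: "derivs_on S D" and c: "csmooth I c" "c ` I \<subseteq> S"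
    and as: "\<And>as a. as \<in> set ass \<Longrightarrow> a \<in> set as \<Longrightarrow> csmooth I a"
  shows "csmooth I (deriv_sum D c ass)"
proof (rule csmooth_coinduct[where Q="\<lambda>f. \<exists>ass. (\<forall>as\<in>set ass. \<forall>a\<in>set as. csmooth I a) \<and> f = deriv_sum D c ass"])
  show "open I" using c(1) by (rule csmooth_open)
  fix f assume "\<exists>ass. (\<forall>as\<in>set ass. \<forall>a\<in>set as. csmooth I a) \<and> f = deriv_sum D c ass"
  then obtain ass where a: "\<And>as a. as \<in> set ass \<Longrightarrow> a \<in> set as \<Longrightarrow> csmooth I a" "f = deriv_sum D c ass" by blast
  have "\<forall>as\<in>set (dterms c ass). \<forall>a\<in>set as. csmooth I a"
    using dterms_csmooth[OF c(1), of ass] a(1) by blast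
  then show "\<exists>f'. (\<exists>ass. (\<forall>as\<in>set ass. \<forall>a\<in>set as. csmooth I a) \<and> f' = deriv_sum D c ass) \<and>
      (\<forall>t\<in>I. (f has_vector_derivative f' t) (at t))"
    unfolding a(2) using deriv_sum_deriv[OF D c _ a(1)] by (intro exI[of _ "deriv_sum D c (dterms c ass)"]) auto
qed (use as in blast)

text \<open>Differentiating the sum differentiates only c and the entries, so it costs one order of
  agreement: the (k+1)-jets of c and of the entries of \<open>ass\<close> determine the k-jets of
  the entries of \<open>dterms c ass\<close>. The lists grow at each step and therefore have to be
  arbitrary in the induction.\<close>

lemma deriv_sum_jeteq:
  assumes D: "derivs_on S D" and c: "csmooth I c" "c ` I \<subseteq> S" and d: "csmooth I d" "d ` I \<subseteq> S"
    and t: "t \<in> I" and as: "\<And>as a. as \<in> set ass \<Longrightarrow> a \<in> set as \<Longrightarrow> csmooth I a"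
    and bs: "\<And>as a. as \<in> set bss \<Longrightarrow> a \<in> set as \<Longrightarrow> csmooth I a"
    and "jeteq k t c d" "list_all2 (list_all2 (jeteq k t)) ass bss"
  shows "jeteq k t (deriv_sum D c ass) (deriv_sum D d bss)"
  using assms(7-)
proof (induction k arbitrary: ass bss)
  case 0
  have "map (\<lambda>a. a t) as = map (\<lambda>a. a t) bs \<and> length as = length bs" if "list_all2 (jeteq 0 t) as bs" for as bs :: "(real \<Rightarrow> 'a) list"
    using that by (auto simp: list_all2_conv_all_nth jeteq_def list_eq_iff_nth_eq)
  moreover have "c t = d t" using 0 by (simp add: jeteq_def)
  ultimately have "list_all2 (\<lambda>as bs. D (length as) (c t) (map (\<lambda>a. a t) as) = D (length bs) (d t) (map (\<lambda>a. a t) bs)) ass bss"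
    using 0(4) by (auto elim!: list_all2_mono)
  then have "map (\<lambda>as. D (length as) (c t) (map (\<lambda>a. a t) as)) ass = map (\<lambda>bs. D (length bs) (d t) (map (\<lambda>a. a t) bs)) bss"
    by (simp add: list_all2_conv_all_nth list_eq_iff_nth_eq)
  then show ?case by (simp add: jeteq_def deriv_sum_def)
next
  case (Suc k)
  have I: "open I" using c(1) by (rule csmooth_open)
  have eq1: "curve_deriv (Suc 0) (deriv_sum D c ass) s = deriv_sum D c (dterms c ass) s" if "s \<in> I" for s
    using deriv_sum_deriv[OF D c that Suc.prems(1)] by (simp add: curve_deriv_Suc vector_derivative_at)
  have eq2: "curve_deriv (Suc 0) (deriv_sum D d bss) s = deriv_sum D d (dterms d bss) s" if "s \<in> I" for s
    using deriv_sum_deriv[OF D d that Suc.prems(2)] by (simp add: curve_deriv_Suc vector_derivative_at)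
  have j: "jeteq k t (curve_deriv (Suc 0) c) (curve_deriv (Suc 0) d)" "jeteq k t c d"
    using Suc.prems(3) jeteq_mono[OF Suc.prems(3), of k] by (auto simp: jeteq_Suc)
  have l: "list_all2 (list_all2 (jeteq k t)) ass bss"
    using Suc.prems(4) by (auto elim!: list_all2_mono intro: jeteq_mono)
  have dt: "list_all2 (list_all2 (jeteq k t)) (dterm c as) (dterm d bs)" if "list_all2 (jeteq (Suc k) t) as bs" for as bs
  proof -
    have "list_all2 (jeteq k t) as bs" using that by (auto elim!: list_all2_mono intro: jeteq_mono)
    moreover have "length as = length bs" using that by (rule list_all2_lengthD)
    moreover have "list_all2 (jeteq k t) (as[i := curve_deriv (Suc 0) (as ! i)]) (bs[i := curve_deriv (Suc 0) (bs ! i)])" if "i < length bs" for i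
      using that \<open>list_all2 (jeteq (Suc k) t) as bs\<close> \<open>list_all2 (jeteq k t) as bs\<close>
      by (intro list_all2_update_cong) (auto simp: list_all2_conv_all_nth jeteq_Suc)
    ultimately show ?thesis using j(1)
      by (auto simp: dterm_def list.rel_map intro!: list.rel_refl_strong)
  qed
  have "list_all2 (list_all2 (jeteq k t)) (dterms c ass) (dterms d bss)"
    using Suc.prems(4) unfolding dterms_def
    by (induction ass bss rule: list_all2_induct) (auto intro!: list_all2_appendI dt)
  then have "jeteq k t (deriv_sum D c (dterms c ass)) (deriv_sum D d (dterms d bss))"
    using dterms_csmooth[OF c(1) Suc.prems(1)] dterms_csmooth[OF d(1) Suc.prems(2)] j(2)
    by (intro Suc.IH) auto
  then have "jeteq k t (curve_deriv (Suc 0) (deriv_sum D c ass)) (curve_deriv (Suc 0) (deriv_sum D d bss))"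
    using jeteq_cong[OF I t, of "curve_deriv (Suc 0) (deriv_sum D c ass)" _ "curve_deriv (Suc 0) (deriv_sum D d bss)"]
      eq1 eq2 by blast
  moreover have "deriv_sum D c ass t = deriv_sum D d bss t"
  proof -
    have "jeteq k t (deriv_sum D c ass) (deriv_sum D d bss)"
      using Suc.prems j(2) l by (intro Suc.IH) auto
    then show ?thesis by (rule jeteq_at)
  qed
  ultimately show ?case by (simp add: jeteq_Suc)
qed

lemma derivs_on_jet_smooth:
  assumes "derivs_on S D"
  shows "jet_smooth S (\<lambda>x. D 0 x [])"
proof -
  have eq: "(\<lambda>x. D 0 x []) \<circ> c = deriv_sum D c [[]]" for c by (auto simp: deriv_sum_def)
  show ?thesis
    unfolding jet_smooth_def eq using derivs_on_open[OF assms]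
    by (auto intro!: deriv_sum_csmooth[OF assms] deriv_sum_jeteq[OF assms])
qed

lemma smooth_on_jet_smooth: "smooth_on S f \<Longrightarrow> jet_smooth S f"
  using derivs_on_jet_smooth jet_smooth_cong unfolding smooth_on_derivs by metis

text \<open>Along a curve (a, b) both components of the tangent map are again of the form
  \<open>deriv_sum\<close>, for the lists [[]] and [[b]], so the preceding results apply to each of
  them.\<close>

lemma derivs_on_tangent_jet_smooth:
  assumes "derivs_on S D"
  shows "jet_smooth (S \<times> UNIV) (\<lambda>p. (D 0 (fst p) [], D (Suc 0) (fst p) [snd p]))"
proof -
  let ?f = "\<lambda>p. (D 0 (fst p) [], D (Suc 0) (fst p) [snd p])"
  have eq: "?f \<circ> c = (\<lambda>t. (deriv_sum D (\<lambda>t. fst (c t)) [[]] t, deriv_sum D (\<lambda>t. fst (c t)) [[\<lambda>t. snd (c t)]] t))" for c :: "real \<Rightarrow> _"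
    by (auto simp: deriv_sum_def)
  have fs: "csmooth I (\<lambda>t. fst (c t))" "csmooth I (\<lambda>t. snd (c t))" if "csmooth I c" for I and c :: "real \<Rightarrow> 'a \<times> 'a"
    using that csmooth_linear bounded_linear_fst bounded_linear_snd by blast+
  have jf: "jeteq k t (\<lambda>t. fst (c t)) (\<lambda>t. fst (d t))" "jeteq k t (\<lambda>t. snd (c t)) (\<lambda>t. snd (d t))"
    if "csmooth I c" "csmooth I d" "jeteq k t c d" "t \<in> I" for I k t and c d :: "real \<Rightarrow> 'a \<times> 'a"
    using that curve_deriv_linear[OF bounded_linear_fst that(1,4)] curve_deriv_linear[OF bounded_linear_fst that(2,4)]
      curve_deriv_linear[OF bounded_linear_snd that(1,4)] curve_deriv_linear[OF bounded_linear_snd that(2,4)]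
    by (auto simp: jeteq_def)
  have jp: "jeteq k t (\<lambda>t. (a t, b t)) (\<lambda>t. (a' t, b' t))"
    if "csmooth I a" "csmooth I a'" "csmooth I b" "csmooth I b'" "jeteq k t a a'" "jeteq k t b b'" "t \<in> I"
    for I k t and a a' b b' :: "real \<Rightarrow> 'b"
  proof -
    have f: "csmooth I (\<lambda>t. (a t, b t))" "csmooth I (\<lambda>t. (a' t, b' t))" using that by (auto intro: csmooth_Pair)
    show ?thesis
      using that curve_deriv_linear[OF bounded_linear_fst f(1) that(7)] curve_deriv_linear[OF bounded_linear_fst f(2) that(7)]
      curve_deriv_linear[OF bounded_linear_snd f(1) that(7)] curve_deriv_linear[OF bounded_linear_snd f(2) that(7)]
      by (auto simp: jeteq_def prod_eq_iff)
  qed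
  have sub: "(\<lambda>t. fst (c t)) ` I \<subseteq> S" if "c ` I \<subseteq> S \<times> UNIV" for I :: "real set" and c :: "real \<Rightarrow> 'a \<times> 'a"
    using that by auto
  have cs: "csmooth I (deriv_sum D (\<lambda>t. fst (c t)) [[]])" "csmooth I (deriv_sum D (\<lambda>t. fst (c t)) [[\<lambda>t. snd (c t)]])"
    if "csmooth I c" "c ` I \<subseteq> S \<times> UNIV" for I c
    using that fs[OF that(1)] sub[OF that(2)] by (auto intro!: deriv_sum_csmooth[OF assms])
  show ?thesis
    unfolding jet_smooth_def eq
  proof (intro conjI allI impI)
    show "open (S \<times> (UNIV :: 'a set))" using derivs_on_open[OF assms] by (intro open_Times) auto
    fix I and c :: "real \<Rightarrow> 'a \<times> 'a" assume c: "csmooth I c" "c ` I \<subseteq> S \<times> UNIV"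
    show "csmooth I (\<lambda>t. (deriv_sum D (\<lambda>t. fst (c t)) [[]] t, deriv_sum D (\<lambda>t. fst (c t)) [[\<lambda>t. snd (c t)]] t))"
      using cs[OF c] by (intro csmooth_Pair)
    fix d :: "real \<Rightarrow> 'a \<times> 'a" and t k
    assume d: "csmooth I d" "d ` I \<subseteq> S \<times> UNIV" and t: "t \<in> I" "jeteq k t c d"
    show "jeteq k t (\<lambda>t. (deriv_sum D (\<lambda>t. fst (c t)) [[]] t, deriv_sum D (\<lambda>t. fst (c t)) [[\<lambda>t. snd (c t)]] t))
      (\<lambda>t. (deriv_sum D (\<lambda>t. fst (d t)) [[]] t, deriv_sum D (\<lambda>t. fst (d t)) [[\<lambda>t. snd (d t)]] t))"
      using cs[OF c] cs[OF d] t(1) jf[OF c(1) d(1) t(2,1)] fs[OF c(1)] fs[OF d(1)] sub[OF c(2)] sub[OF d(2)]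
      by (intro jp) (auto intro!: deriv_sum_jeteq[OF assms, of I])
  qed
qed

lemma smooth_on_curve_iff: "smooth_on I c \<longleftrightarrow> csmooth I c" for c :: "real \<Rightarrow> 'a::real_normed_vector"
proof
  assume "smooth_on I c"
  then have j: "jet_smooth I c" by (rule smooth_on_jet_smooth)
  have "csmooth I (\<lambda>t. 0 + t *\<^sub>R 1 :: real)" using jet_smooth_open[OF j] by (rule csmooth_affine)
  then have "csmooth I (\<lambda>t. t :: real)" by simp
  then show "csmooth I c" using jet_smooth_csmooth[OF j, of I "\<lambda>t. t"] by (simp add: o_def)
next
  assume c: "csmooth I c"
  have norm_prod: "\<bar>prod_list vs\<bar> = prod_list (map norm vs)" for vs :: "real list"
    by (induction vs) (auto simp: abs_mult)
  show "smooth_on I c"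
    unfolding smooth_on_def
  \<comment> \<open>On the line an n-linear map is the product of its arguments times its value at
    (1, ..., 1), which here is the n-th derivative of c.\<close>
  proof (intro conjI exI[of _ "\<lambda>n t vs. prod_list vs *\<^sub>R curve_deriv n c t"] ballI allI impI)
    show "open I" using c by (rule csmooth_open)
    show "prod_list [] *\<^sub>R curve_deriv 0 c x = c x" for x by simp
  next
    fix n x assume "x \<in> I"
    show "bounded_multilinear n (\<lambda>vs. prod_list vs *\<^sub>R curve_deriv n c x)"
      unfolding bounded_multilinear_def
      by (auto intro!: linearI exI[of _ "norm (curve_deriv n c x)"] simp: algebra_simps norm_prod)
  next
    fix n x and e :: real assume x: "x \<in> I" and e: "e > 0"
    obtain d where "d > 0" and d: "\<And>y. norm (y - x) < d \<Longrightarrow>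
        norm (curve_deriv n c y - curve_deriv n c x - (y - x) *\<^sub>R curve_deriv (Suc n) c x) \<le> e * norm (y - x)"
      using csmooth_deriv[OF c x, of n] e unfolding has_vector_derivative_def has_derivative_at_alt by metis
    have "norm (prod_list vs *\<^sub>R curve_deriv n c y - prod_list vs *\<^sub>R curve_deriv n c x
           - prod_list ((y - x) # vs) *\<^sub>R curve_deriv (Suc n) c x)
           \<le> e * norm (y - x) * prod_list (map norm vs)" if "dist y x < d" for y vs
    proof -
      have "prod_list vs *\<^sub>R curve_deriv n c y - prod_list vs *\<^sub>R curve_deriv n c x
           - prod_list ((y - x) # vs) *\<^sub>R curve_deriv (Suc n) c x
         = prod_list vs *\<^sub>R (curve_deriv n c y - curve_deriv n c x - (y - x) *\<^sub>R curve_deriv (Suc n) c x)"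
        by (simp add: algebra_simps)
      also have "norm \<dots> \<le> prod_list (map norm vs) * (e * norm (y - x))"
        using d[of y] that unfolding norm_scaleR norm_prod
        by (intro mult_left_mono) (auto simp: dist_norm intro!: prod_list_nonneg)
      finally show ?thesis by (simp only: ac_simps)
    qed
    then show "\<exists>d>0. \<forall>y\<in>I. dist y x < d \<longrightarrow> (\<forall>vs. length vs = n \<longrightarrow>
         norm (prod_list vs *\<^sub>R curve_deriv n c y - prod_list vs *\<^sub>R curve_deriv n c x
           - prod_list ((y - x) # vs) *\<^sub>R curve_deriv (Suc n) c x)
           \<le> e * norm (y - x) * prod_list (map norm vs))"
      using \<open>d > 0\<close> by blast
  qed
qed

section \<open>Jets in an atlas whose transition maps act on jets\<close>

text \<open>Stated so as to cover both a smooth atlas and its tangent atlas; the results below on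
  curves and jets are thus available for M and for TM, hence for TTM as jets in TM.\<close>

definition jet_atlas :: "('m, 'e::real_normed_vector) atlas \<Rightarrow> bool" where
  "jet_atlas A \<longleftrightarrow>
     (\<forall>(U, \<phi>)\<in>A. inj_on \<phi> U \<and> open (\<phi> ` U)) \<and>
     (\<forall>(U, \<phi>)\<in>A. \<forall>(V, \<psi>)\<in>A. jet_smooth (\<phi> ` (U \<inter> V)) (\<psi> \<circ> inv_into U \<phi>))"

definition jet_smooth_map ::
    "('m, 'e::real_normed_vector) atlas \<Rightarrow> ('n, 'f::real_normed_vector) atlas \<Rightarrow>
     ('m \<Rightarrow> 'n) \<Rightarrow> bool" where
  "jet_smooth_map A B f \<longleftrightarrow>
     f ` points A \<subseteq> points B \<and>
     (\<forall>(U, \<phi>)\<in>A. \<forall>(V, \<psi>)\<in>B. jet_smooth (\<phi> ` (U \<inter> f -` V)) (\<psi> \<circ> f \<circ> inv_into U \<phi>))"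

lemma smooth_atlas_jet_atlas: "smooth_atlas A \<Longrightarrow> jet_atlas A"
  unfolding smooth_atlas_def jet_atlas_def using smooth_on_jet_smooth by fast

lemma smooth_map_jet_smooth_map: "smooth_map A B f \<Longrightarrow> jet_smooth_map A B f"
  unfolding smooth_map_def jet_smooth_map_def using smooth_on_jet_smooth by fast

lemma jet_atlas_id: "jet_atlas A \<Longrightarrow> jet_smooth_map A A (\<lambda>x. x)"
  unfolding jet_atlas_def jet_smooth_map_def by (auto simp: o_def)

lemma smooth_atlas_id: "smooth_atlas A \<Longrightarrow> smooth_map A A (\<lambda>x. x)"
  unfolding smooth_atlas_def smooth_map_def by (auto simp: o_def)

lemma jet_atlas_inj: "jet_atlas A \<Longrightarrow> (U, \<phi>) \<in> A \<Longrightarrow> inj_on \<phi> U"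
  and jet_atlas_open: "jet_atlas A \<Longrightarrow> (U, \<phi>) \<in> A \<Longrightarrow> open (\<phi> ` U)"
  and jet_atlas_transition: "jet_atlas A \<Longrightarrow> (U, \<phi>) \<in> A \<Longrightarrow> (V, \<psi>) \<in> A \<Longrightarrow> jet_smooth (\<phi> ` (U \<inter> V)) (\<psi> \<circ> inv_into U \<phi>)"
  unfolding jet_atlas_def by fast+

lemma jet_atlas_inv: "jet_atlas A \<Longrightarrow> (U, \<phi>) \<in> A \<Longrightarrow> x \<in> U \<Longrightarrow> inv_into U \<phi> (\<phi> x) = x"
  by (intro inv_into_f_f jet_atlas_inj)

lemma jet_smooth_map_local:
  "jet_smooth_map A B f \<Longrightarrow> (U, \<phi>) \<in> A \<Longrightarrow> (V, \<psi>) \<in> B \<Longrightarrow> jet_smooth (\<phi> ` (U \<inter> f -` V)) (\<psi> \<circ> f \<circ> inv_into U \<phi>)"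
  unfolding jet_smooth_map_def by fast

lemma points_iff: "x \<in> points A \<longleftrightarrow> (\<exists>U \<phi>. (U, \<phi>) \<in> A \<and> x \<in> U)"
  unfolding points_def by force

lemma csmooth_continuous: "csmooth I c \<Longrightarrow> continuous_on I c"
  by (intro continuous_at_imp_continuous_on ballI has_vector_derivative_continuous) (rule csmooth_deriv_0)

lemma csmooth_vimage_open: "csmooth I c \<Longrightarrow> open S \<Longrightarrow> open (I \<inter> c -` S)"
  using continuous_open_preimage[OF csmooth_continuous csmooth_open] by blast

lemma smooth_curve_iff:
  "smooth_curve A \<gamma> \<longleftrightarrow> (\<exists>\<epsilon>>0. \<gamma> ` {-\<epsilon><..<\<epsilon>} \<subseteq> points A \<and>
     (\<forall>(V, \<psi>)\<in>A. csmooth ({-\<epsilon><..<\<epsilon>} \<inter> \<gamma> -` V) (\<psi> \<circ> \<gamma>)))"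
proof -
  have inv: "inv_into {-\<epsilon><..<\<epsilon>} (\<lambda>t. t) t = t" if "t \<in> {-\<epsilon><..<\<epsilon>}" for t \<epsilon> :: real
    using f_inv_into_f[of t "\<lambda>t. t"] that by simp
  have "csmooth ({-\<epsilon><..<\<epsilon>} \<inter> \<gamma> -` V) (\<psi> \<circ> \<gamma> \<circ> inv_into {-\<epsilon><..<\<epsilon>} (\<lambda>t. t)) \<longleftrightarrow>
      csmooth ({-\<epsilon><..<\<epsilon>} \<inter> \<gamma> -` V) (\<psi> \<circ> \<gamma>)" for \<epsilon> V and \<psi> :: "'a \<Rightarrow> 'b"
    by (intro iffI; erule csmooth_cong[rotated]) (auto simp: inv)
  then show ?thesis
    unfolding smooth_curve_def smooth_map_def by (simp add: points_def smooth_on_curve_iff image_ident case_prod_unfold)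
qed

lemma smooth_curve_chart:
  assumes "smooth_curve A \<gamma>" "(U, \<phi>) \<in> A" "\<gamma> 0 \<in> U"
  obtains I where "0 \<in> I" "\<gamma> ` I \<subseteq> U" "csmooth I (\<phi> \<circ> \<gamma>)"
proof -
  obtain \<epsilon> where "\<epsilon> > 0" "\<forall>(V, \<psi>)\<in>A. csmooth ({-\<epsilon><..<\<epsilon>} \<inter> \<gamma> -` V) (\<psi> \<circ> \<gamma>)"
    using assms(1) unfolding smooth_curve_iff by blast
  then show thesis
    using assms(2,3) by (intro that[of "{-\<epsilon><..<\<epsilon>} \<inter> \<gamma> -` U"]) auto
qed

lemma smooth_curve_points: "smooth_curve A \<gamma> \<Longrightarrow> \<gamma> 0 \<in> points A"
  unfolding smooth_curve_iff by force

text \<open>One chart around \<gamma> 0 is enough: on a small interval the curve stays in U, and in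
  any other chart it is the image under a transition map. The times spent in V form an open set
  because the image of U \<inter> V under \<phi> is open.\<close>

lemma smooth_curveI:
  assumes A: "jet_atlas A" "(U, \<phi>) \<in> A" and I: "0 \<in> I" "\<gamma> ` I \<subseteq> U" "csmooth I (\<phi> \<circ> \<gamma>)"
  shows "smooth_curve A \<gamma>"
proof -
  obtain \<epsilon> where \<epsilon>: "\<epsilon> > 0" "{-\<epsilon><..<\<epsilon>} \<subseteq> I"
  proof -
    obtain \<epsilon> where "\<epsilon> > 0" "\<And>t. dist t 0 < \<epsilon> \<Longrightarrow> t \<in> I"
      using csmooth_open[OF I(3)] I(1) unfolding open_dist by blast
    then show thesis by (intro that[of \<epsilon>]) (auto simp: dist_real_def)
  qed
  show ?thesis
    unfolding smooth_curve_iff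
  proof (intro exI conjI ballI, rule \<epsilon>(1))
    show "\<gamma> ` {-\<epsilon><..<\<epsilon>} \<subseteq> points A" using \<epsilon> I(2) A(2) by (force simp: points_iff)
    fix V\<psi> assume "V\<psi> \<in> A"
    then obtain V \<psi> where V: "V\<psi> = (V, \<psi>)" "(V, \<psi>) \<in> A" by (cases V\<psi>) auto
    have j: "jet_smooth (\<phi> ` (U \<inter> V)) (\<psi> \<circ> inv_into U \<phi>)" using jet_atlas_transition[OF A V(2)] .
    let ?J = "{-\<epsilon><..<\<epsilon>} \<inter> \<gamma> -` V"
    have "?J = {-\<epsilon><..<\<epsilon>} \<inter> (\<phi> \<circ> \<gamma>) -` (\<phi> ` (U \<inter> V))"
      using \<epsilon>(2) I(2) inj_onD[OF jet_atlas_inj[OF A]] by (fastforce simp: image_subset_iff)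
    also have "open \<dots>"
      by (intro csmooth_vimage_open[OF csmooth_subset[OF I(3)]] jet_smooth_open[OF j] \<epsilon>) auto
    finally have c: "csmooth ?J (\<phi> \<circ> \<gamma>)" using \<epsilon>(2) by (intro csmooth_subset[OF I(3)]) auto
    have "csmooth ?J ((\<psi> \<circ> inv_into U \<phi>) \<circ> (\<phi> \<circ> \<gamma>))"
      using \<epsilon>(2) I(2) by (intro jet_smooth_csmooth[OF j c]) auto
    then have "csmooth ?J (\<psi> \<circ> \<gamma>)"
      by (rule csmooth_cong[rotated]) (use \<epsilon>(2) I(2) in \<open>auto simp: image_subset_iff subset_iff jet_atlas_inv[OF A]\<close>)
    then show "case V\<psi> of (V, \<psi>) \<Rightarrow> csmooth ({-\<epsilon><..<\<epsilon>} \<inter> \<gamma> -` V) (\<psi> \<circ> \<gamma>)" using V by simp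
  qed
qed

text \<open>One set of times serves both coordinate expressions. It is open because
  \<open>jet_smooth\<close> includes the openness of its domain, the form in which continuity of g
  is available.\<close>

lemma jet_smooth_map_chart:
  assumes A: "jet_atlas A" and g: "jet_smooth_map A B g" and \<gamma>: "smooth_curve A \<gamma>"
    and U: "(U, \<phi>) \<in> A" "\<gamma> 0 \<in> U" and V: "(V, \<psi>) \<in> B" "g (\<gamma> 0) \<in> V"
  obtains I where "0 \<in> I" "\<gamma> ` I \<subseteq> U \<inter> g -` V" "csmooth I (\<phi> \<circ> \<gamma>)" "csmooth I (\<psi> \<circ> (g \<circ> \<gamma>))"
proof -
  obtain J where J: "0 \<in> J" "\<gamma> ` J \<subseteq> U" "csmooth J (\<phi> \<circ> \<gamma>)"
    using smooth_curve_chart[OF \<gamma> U] .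
  have j: "jet_smooth (\<phi> ` (U \<inter> g -` V)) (\<psi> \<circ> g \<circ> inv_into U \<phi>)"
    using jet_smooth_map_local[OF g U(1) V(1)] .
  let ?I = "J \<inter> (\<phi> \<circ> \<gamma>) -` (\<phi> ` (U \<inter> g -` V))"
  have c: "csmooth ?I (\<phi> \<circ> \<gamma>)"
    by (intro csmooth_subset[OF J(3)] csmooth_vimage_open[OF J(3)] jet_smooth_open[OF j]) auto
  have sub: "\<gamma> ` ?I \<subseteq> U \<inter> g -` V"
    using J(2) inj_onD[OF jet_atlas_inj[OF A U(1)]] by (fastforce simp: image_subset_iff)
  have "csmooth ?I ((\<psi> \<circ> g \<circ> inv_into U \<phi>) \<circ> (\<phi> \<circ> \<gamma>))"
    by (intro jet_smooth_csmooth[OF j c]) auto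
  moreover have "((\<psi> \<circ> g \<circ> inv_into U \<phi>) \<circ> (\<phi> \<circ> \<gamma>)) t = (\<psi> \<circ> (g \<circ> \<gamma>)) t" if "t \<in> ?I" for t
  proof -
    have "\<gamma> t \<in> U" using sub that by blast
    then show ?thesis by (simp add: jet_atlas_inv[OF A U(1)])
  qed
  ultimately have "csmooth ?I (\<psi> \<circ> (g \<circ> \<gamma>))"
    using csmooth_cong by blast
  moreover have "0 \<in> ?I" using J(1) U(2) V(2) by simp
  ultimately show thesis using that[OF _ sub c] by metis
qed

lemma smooth_curve_comp:
  assumes A: "jet_atlas A" and B: "jet_atlas B" and g: "jet_smooth_map A B g" and \<gamma>: "smooth_curve A \<gamma>"
  shows "smooth_curve B (g \<circ> \<gamma>)"
proof -
  obtain U \<phi> where U: "(U, \<phi>) \<in> A" "\<gamma> 0 \<in> U"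
    using smooth_curve_points[OF \<gamma>] unfolding points_iff by blast
  obtain V \<psi> where V: "(V, \<psi>) \<in> B" "g (\<gamma> 0) \<in> V"
    using smooth_curve_points[OF \<gamma>] g unfolding jet_smooth_map_def
    by (metis image_subset_iff points_iff)
  obtain I where "0 \<in> I" "\<gamma> ` I \<subseteq> U \<inter> g -` V" "csmooth I (\<psi> \<circ> (g \<circ> \<gamma>))"
    using jet_smooth_map_chart[OF A g \<gamma> U V] by metis
  then show ?thesis by (intro smooth_curveI[OF B V(1)]) auto
qed

lemma jeteq_comp:
  assumes A: "jet_atlas A" and g: "jet_smooth_map A B g" and \<gamma>: "smooth_curve A \<gamma>" and \<delta>: "smooth_curve A \<delta>"
    and U: "(U, \<phi>) \<in> A" "\<gamma> 0 \<in> U" and V: "(V, \<psi>) \<in> B" "g (\<gamma> 0) \<in> V"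
    and eq: "\<gamma> 0 = \<delta> 0" "jeteq k 0 (\<phi> \<circ> \<gamma>) (\<phi> \<circ> \<delta>)"
  shows "jeteq k 0 (\<psi> \<circ> (g \<circ> \<gamma>)) (\<psi> \<circ> (g \<circ> \<delta>))"
proof -
  obtain I where I: "0 \<in> I" "\<gamma> ` I \<subseteq> U \<inter> g -` V" "csmooth I (\<phi> \<circ> \<gamma>)"
    using jet_smooth_map_chart[OF A g \<gamma> U V] by metis
  obtain J where J: "0 \<in> J" "\<delta> ` J \<subseteq> U \<inter> g -` V" "csmooth J (\<phi> \<circ> \<delta>)"
    using jet_smooth_map_chart[OF A g \<delta> U(1) _ V(1)] U(2) V(2) eq(1) by metis
  have o: "open (I \<inter> J)" using csmooth_open I(3) J(3) by blast
  have "jeteq k 0 ((\<psi> \<circ> g \<circ> inv_into U \<phi>) \<circ> (\<phi> \<circ> \<gamma>)) ((\<psi> \<circ> g \<circ> inv_into U \<phi>) \<circ> (\<phi> \<circ> \<delta>))"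
    using I J eq(2) o
    by (intro jet_smooth_jeteq[OF jet_smooth_map_local[OF g U(1) V(1)], of "I \<inter> J"] csmooth_subset[OF I(3)] csmooth_subset[OF J(3)])
      (auto simp: image_subset_iff)
  moreover have "jeteq k 0 ((\<psi> \<circ> g \<circ> inv_into U \<phi>) \<circ> (\<phi> \<circ> \<gamma>)) ((\<psi> \<circ> g \<circ> inv_into U \<phi>) \<circ> (\<phi> \<circ> \<delta>))
     \<longleftrightarrow> jeteq k 0 (\<psi> \<circ> (g \<circ> \<gamma>)) (\<psi> \<circ> (g \<circ> \<delta>))"
    using I J o by (intro jeteq_cong[of "I \<inter> J"]) (auto simp: image_subset_iff jet_atlas_inv[OF A U(1)])
  ultimately show ?thesis by blast
qed

section \<open>Jets as equivalence classes of curves\<close>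

lemma jet_equiv_iff:
  assumes A: "jet_atlas A" and \<gamma>: "smooth_curve A \<gamma>" and \<delta>: "smooth_curve A \<delta>" and U: "(U, \<phi>) \<in> A" "\<gamma> 0 \<in> U"
  shows "jet_equiv A k \<gamma> \<delta> \<longleftrightarrow> \<gamma> 0 = \<delta> 0 \<and> jeteq k 0 (\<phi> \<circ> \<gamma>) (\<phi> \<circ> \<delta>)"
proof -
  have j: "jeteq k 0 (\<phi> \<circ> \<gamma>) (\<phi> \<circ> \<delta>) \<longleftrightarrow> (\<forall>i\<in>{1..k}. curve_deriv i (\<phi> \<circ> \<gamma>) 0 = curve_deriv i (\<phi> \<circ> \<delta>) 0)"
    if "\<gamma> 0 = \<delta> 0" for \<phi> :: "'a \<Rightarrow> 'b"
  proof -
    have "curve_deriv 0 (\<phi> \<circ> \<gamma>) 0 = curve_deriv 0 (\<phi> \<circ> \<delta>) 0" using that by simp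
    then show ?thesis unfolding jeteq_def by (metis One_nat_def Suc_leI atLeastAtMost_iff not_gr_zero le0)
  qed
  show ?thesis
  proof
    assume "jet_equiv A k \<gamma> \<delta>"
    then obtain V \<psi> where V: "(V, \<psi>) \<in> A" "\<gamma> 0 \<in> V" "\<gamma> 0 = \<delta> 0" "jeteq k 0 (\<psi> \<circ> \<gamma>) (\<psi> \<circ> \<delta>)"
      unfolding jet_equiv_def using j by blast
    \<comment> \<open>Independence of the chart is the action on jets of the identity map, read from
      the chart \<psi> to the chart \<phi>.\<close>
    then show "\<gamma> 0 = \<delta> 0 \<and> jeteq k 0 (\<phi> \<circ> \<gamma>) (\<phi> \<circ> \<delta>)"
      using jeteq_comp[OF A jet_atlas_id[OF A] \<gamma> \<delta> V(1,2) U(1), of k] U(2) by (simp add: o_def)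
  next
    assume "\<gamma> 0 = \<delta> 0 \<and> jeteq k 0 (\<phi> \<circ> \<gamma>) (\<phi> \<circ> \<delta>)"
    then show "jet_equiv A k \<gamma> \<delta>"
      unfolding jet_equiv_def using U j by blast
  qed
qed

lemma jet_self: "smooth_curve A \<gamma> \<Longrightarrow> \<gamma> \<in> jet A k \<gamma>"
  using smooth_curve_points[of A \<gamma>] by (auto simp: jet_def jet_equiv_def points_iff)

lemma jet_eq_iff:
  assumes A: "jet_atlas A" and \<gamma>: "smooth_curve A \<gamma>" and \<delta>: "smooth_curve A \<delta>"
  shows "jet A k \<gamma> = jet A k \<delta> \<longleftrightarrow> jet_equiv A k \<gamma> \<delta>"
proof -
  obtain U \<phi> where U: "(U, \<phi>) \<in> A" "\<gamma> 0 \<in> U"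
    using smooth_curve_points[OF \<gamma>] unfolding points_iff by blast
  \<comment> \<open>In one fixed chart the relation is equality of derivatives, so symmetry and
    transitivity come for free.\<close>
  note iff = jet_equiv_iff[OF A _ _ U(1)]
  show ?thesis
  proof
    assume "jet A k \<gamma> = jet A k \<delta>"
    then show "jet_equiv A k \<gamma> \<delta>" using jet_self[OF \<delta>, of k] by (auto simp: jet_def)
  next
    assume e: "jet_equiv A k \<gamma> \<delta>"
    have "jet_equiv A k \<gamma> \<eta> \<longleftrightarrow> jet_equiv A k \<delta> \<eta>" if "smooth_curve A \<eta>" for \<eta>
      using e iff[OF \<gamma> that U(2)] iff[OF \<gamma> \<delta> U(2)] iff[OF \<delta> that] U(2)
      by (auto simp: jeteq_def)
    then show "jet A k \<gamma> = jet A k \<delta>" by (auto simp: jet_def)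
  qed
qed

text \<open>Curves are total functions with arbitrary values away from 0. Identities such as h o g o
  \<gamma> = \<gamma> hold only near 0, and this is enough for jets.\<close>

lemma jet_germ:
  assumes A: "jet_atlas A" and \<gamma>: "smooth_curve A \<gamma>" and \<delta>: "smooth_curve A \<delta>"
    and I: "open I" "0 \<in> I" "\<And>t. t \<in> I \<Longrightarrow> \<gamma> t = \<delta> t"
  shows "jet A k \<gamma> = jet A k \<delta>"
proof -
  obtain U \<phi> where U: "(U, \<phi>) \<in> A" "\<gamma> 0 \<in> U"
    using smooth_curve_points[OF \<gamma>] unfolding points_iff by blast
  have "curve_deriv i (\<phi> \<circ> \<gamma>) 0 = curve_deriv i (\<phi> \<circ> \<delta>) 0" for i
    by (rule curve_deriv_cong[OF I(1) _ I(2)]) (simp add: I(3))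
  then show ?thesis
    using I(2,3) by (simp add: jet_eq_iff[OF A \<gamma> \<delta>] jet_equiv_iff[OF A \<gamma> \<delta> U] jeteq_def)
qed

lemma the_elem_jet:
  assumes "smooth_curve A \<gamma>" "\<And>\<delta>. smooth_curve A \<delta> \<Longrightarrow> jet_equiv A k \<gamma> \<delta> \<Longrightarrow> F \<delta> = F \<gamma>"
  shows "the_elem (F ` jet A k \<gamma>) = F \<gamma>"
proof -
  have "F ` jet A k \<gamma> = {F \<gamma>}"
  proof
    show "F ` jet A k \<gamma> \<subseteq> {F \<gamma>}"
    proof (rule image_subsetI)
      fix \<delta> assume "\<delta> \<in> jet A k \<gamma>"
      then show "F \<delta> \<in> {F \<gamma>}" using assms(2)[of \<delta>] by (simp add: jet_def)
    qed
    show "{F \<gamma>} \<subseteq> F ` jet A k \<gamma>" using jet_self[OF assms(1)] by blast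
  qed
  then show ?thesis by simp
qed

lemma foot_jet: "smooth_curve A \<gamma> \<Longrightarrow> foot (jet A k \<gamma>) = \<gamma> 0"
  unfolding foot_def by (rule the_elem_jet) (auto simp: jet_equiv_def)

lemma jet_map_jet:
  assumes A: "jet_atlas A" and B: "jet_atlas B" and g: "jet_smooth_map A B g" and \<gamma>: "smooth_curve A \<gamma>"
  shows "jet_map B k g (jet A k \<gamma>) = jet B k (g \<circ> \<gamma>)"
proof -
  obtain U \<phi> where U: "(U, \<phi>) \<in> A" "\<gamma> 0 \<in> U"
    using smooth_curve_points[OF \<gamma>] unfolding points_iff by blast
  obtain V \<psi> where V: "(V, \<psi>) \<in> B" "g (\<gamma> 0) \<in> V"
    using smooth_curve_points[OF \<gamma>] g unfolding jet_smooth_map_def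
    by (metis image_subset_iff points_iff)
  have "jet B k (g \<circ> \<delta>) = jet B k (g \<circ> \<gamma>)" if "\<delta> \<in> jet A k \<gamma>" for \<delta>
  proof -
    have \<delta>: "smooth_curve A \<delta>" "jet_equiv A k \<gamma> \<delta>" using that by (auto simp: jet_def)
    have e: "\<gamma> 0 = \<delta> 0" "jeteq k 0 (\<phi> \<circ> \<gamma>) (\<phi> \<circ> \<delta>)"
      using \<delta> jet_equiv_iff[OF A \<gamma> \<delta>(1) U] by auto
    have "jeteq k 0 (\<psi> \<circ> (g \<circ> \<gamma>)) (\<psi> \<circ> (g \<circ> \<delta>))"
      using jeteq_comp[OF A g \<gamma> \<delta>(1) U V e] .
    note gs = smooth_curve_comp[OF A B g \<gamma>] smooth_curve_comp[OF A B g \<delta>(1)]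
    have "jet_equiv B k (g \<circ> \<gamma>) (g \<circ> \<delta>)"
      using \<open>jeteq k 0 (\<psi> \<circ> (g \<circ> \<gamma>)) (\<psi> \<circ> (g \<circ> \<delta>))\<close> e(1) V(2)
      by (subst jet_equiv_iff[OF B gs V(1)]) auto
    then show ?thesis using jet_eq_iff[OF B gs] by blast
  qed
  then show ?thesis
    unfolding jet_map_def using jet_self[OF \<gamma>, of k] by blast
qed

lemma jet_bundleE:
  assumes "c \<in> jet_bundle A k"
  obtains \<gamma> where "smooth_curve A \<gamma>" "c = jet A k \<gamma>"
  using assms unfolding jet_bundle_def by blast

lemma jet_bundleI: "smooth_curve A \<gamma> \<Longrightarrow> jet A k \<gamma> \<in> jet_bundle A k"
  unfolding jet_bundle_def by blast

section \<open>The tangent bundle\<close>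

lemma tangent_chart_jet:
  assumes A: "jet_atlas A" and \<gamma>: "smooth_curve A \<gamma>" and U: "(U, \<phi>) \<in> A" "\<gamma> 0 \<in> U"
  shows "snd (tangent_chart A (U, \<phi>)) (jet A 1 \<gamma>) = (\<phi> (\<gamma> 0), curve_deriv 1 (\<phi> \<circ> \<gamma>) 0)"
  unfolding tangent_chart_def using jet_equiv_iff[OF A \<gamma> _ U]
  by (simp, intro the_elem_jet[OF \<gamma>]) (auto simp: jeteq_def)

lemma fst_tangent_chart: "fst (tangent_chart A u) = {c \<in> jet_bundle A 1. foot c \<in> fst u}"
  by (simp add: tangent_chart_def split_beta)

text \<open>A straight line in the chart has any prescribed velocity. Applied to the charts of M
  this gives surjectivity of the tangent charts; applied to the charts of TM it gives the test curve
  for the connection maps.\<close>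

lemma chart_curve:
  assumes A: "jet_atlas A" and U: "(U, \<phi>) \<in> A" and x: "x \<in> \<phi> ` U"
  obtains \<gamma> where "smooth_curve A \<gamma>" "\<gamma> 0 \<in> U" "\<phi> (\<gamma> 0) = x" "curve_deriv (Suc 0) (\<phi> \<circ> \<gamma>) 0 = v"
proof -
  let ?c = "\<lambda>t. x + t *\<^sub>R v" and ?\<gamma> = "\<lambda>t. inv_into U \<phi> (x + t *\<^sub>R v)"
  let ?I = "?c -` (\<phi> ` U)"
  have o: "open ?I" using csmooth_vimage_open[OF csmooth_affine[OF open_UNIV, of x v] jet_atlas_open[OF A U]] by simp
  then have c: "csmooth ?I ?c" by (rule csmooth_affine)
  have eq: "\<phi> (?\<gamma> t) = ?c t" if "t \<in> ?I" for t using that by (simp add: f_inv_into_f)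
  have c': "csmooth ?I (\<phi> \<circ> ?\<gamma>)" by (rule csmooth_cong[OF _ c]) (simp add: eq)
  have 0: "0 \<in> ?I" using x by simp
  show thesis
  proof (rule that)
    show "smooth_curve A ?\<gamma>" by (rule smooth_curveI[OF A U 0 _ c']) (auto simp: inv_into_into)
    show "?\<gamma> 0 \<in> U" using x by (simp add: inv_into_into)
    show "\<phi> (?\<gamma> 0) = x" using eq[OF 0] by simp
    have "curve_deriv (Suc 0) (\<phi> \<circ> ?\<gamma>) 0 = curve_deriv (Suc 0) ?c 0"
      by (rule curve_deriv_cong[OF o _ 0]) (simp add: eq)
    also have "(?c has_vector_derivative v) (at 0)"
      by (auto intro!: derivative_eq_intros simp: has_vector_derivative_def)
    then have "curve_deriv (Suc 0) ?c 0 = v" by (simp add: curve_deriv_Suc vector_derivative_at)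
    finally show "curve_deriv (Suc 0) (\<phi> \<circ> ?\<gamma>) 0 = v" .
  qed
qed

lemma tangent_chart_image:
  assumes A: "jet_atlas A" and U: "(U, \<phi>) \<in> A" and W: "W \<subseteq> U"
  shows "snd (tangent_chart A (U, \<phi>)) ` {c \<in> jet_bundle A 1. foot c \<in> W} = \<phi> ` W \<times> UNIV"
proof (intro equalityI subsetI)
  fix p assume "p \<in> snd (tangent_chart A (U, \<phi>)) ` {c \<in> jet_bundle A 1. foot c \<in> W}"
  then obtain \<gamma> where "smooth_curve A \<gamma>" "\<gamma> 0 \<in> W" "p = snd (tangent_chart A (U, \<phi>)) (jet A 1 \<gamma>)"
    by (auto elim!: jet_bundleE simp: foot_jet)
  then show "p \<in> \<phi> ` W \<times> UNIV"
    using W tangent_chart_jet[OF A _ U, of \<gamma>] by auto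
next
  fix p assume "p \<in> \<phi> ` W \<times> (UNIV :: 'b set)"
  then obtain x v where p: "p = (\<phi> x, v)" "x \<in> W" by auto
  obtain \<gamma> where \<gamma>: "smooth_curve A \<gamma>" "\<gamma> 0 \<in> U" "\<phi> (\<gamma> 0) = \<phi> x" "curve_deriv (Suc 0) (\<phi> \<circ> \<gamma>) 0 = v"
    using chart_curve[OF A U] p(2) W by (metis image_eqI subsetD)
  then have "\<gamma> 0 = x" using inj_onD[OF jet_atlas_inj[OF A U]] p(2) W by blast
  then show "p \<in> snd (tangent_chart A (U, \<phi>)) ` {c \<in> jet_bundle A 1. foot c \<in> W}"
    using p \<gamma> by (intro image_eqI[of _ _ "jet A 1 \<gamma>"])
      (auto simp: tangent_chart_jet[OF A \<gamma>(1) U \<gamma>(2), simplified] foot_jet intro: jet_bundleI)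
qed

lemma tangent_chart_inj:
  assumes A: "jet_atlas A" and U: "(U, \<phi>) \<in> A"
  shows "inj_on (snd (tangent_chart A (U, \<phi>))) {c \<in> jet_bundle A 1. foot c \<in> U}"
proof (rule inj_onI)
  fix c d assume c: "c \<in> {c \<in> jet_bundle A 1. foot c \<in> U}" and d: "d \<in> {c \<in> jet_bundle A 1. foot c \<in> U}"
    and eq: "snd (tangent_chart A (U, \<phi>)) c = snd (tangent_chart A (U, \<phi>)) d"
  obtain \<gamma> where \<gamma>: "smooth_curve A \<gamma>" "c = jet A 1 \<gamma>" using c by (auto elim: jet_bundleE)
  obtain \<delta> where \<delta>: "smooth_curve A \<delta>" "d = jet A 1 \<delta>" using d by (auto elim: jet_bundleE)
  have f: "\<gamma> 0 \<in> U" "\<delta> 0 \<in> U" using c d \<gamma> \<delta> by (auto simp: foot_jet)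
  have e: "\<phi> (\<gamma> 0) = \<phi> (\<delta> 0)" "curve_deriv 1 (\<phi> \<circ> \<gamma>) 0 = curve_deriv 1 (\<phi> \<circ> \<delta>) 0"
    using eq unfolding \<gamma>(2) \<delta>(2) tangent_chart_jet[OF A \<gamma>(1) U f(1)] tangent_chart_jet[OF A \<delta>(1) U f(2)] by auto
  have "\<gamma> 0 = \<delta> 0" using inj_onD[OF jet_atlas_inj[OF A U] e(1) f] .
  moreover have "jeteq 1 0 (\<phi> \<circ> \<gamma>) (\<phi> \<circ> \<delta>)"
    using e by (simp add: jeteq_def le_Suc_eq)
  ultimately show "c = d"
    unfolding \<gamma>(2) \<delta>(2) jet_eq_iff[OF A \<gamma>(1) \<delta>(1)] jet_equiv_iff[OF A \<gamma>(1) \<delta>(1) U f(1)] by blast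
qed



lemma tangent_map_chart:
  assumes A: "jet_atlas A" and B: "jet_atlas B" and g: "jet_smooth_map A B g"
    and U: "(U, \<phi>) \<in> A" and V: "(V, \<psi>) \<in> B"
    and D: "derivs_on (\<phi> ` (U \<inter> g -` V)) D" "\<And>x. x \<in> \<phi> ` (U \<inter> g -` V) \<Longrightarrow> D 0 x [] = (\<psi> \<circ> g \<circ> inv_into U \<phi>) x"
    and c: "c \<in> jet_bundle A 1" "foot c \<in> U" "g (foot c) \<in> V"
  shows "snd (tangent_chart B (V, \<psi>)) (jet_map B 1 g c) =
    (\<lambda>p. (D 0 (fst p) [], D (Suc 0) (fst p) [snd p])) (snd (tangent_chart A (U, \<phi>)) c)"
proof -
  obtain \<gamma> where \<gamma>: "smooth_curve A \<gamma>" "c = jet A 1 \<gamma>" using c by (auto elim: jet_bundleE)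
  have f: "\<gamma> 0 \<in> U" "g (\<gamma> 0) \<in> V" using c \<gamma> by (auto simp: foot_jet)
  obtain I where I: "0 \<in> I" "\<gamma> ` I \<subseteq> U \<inter> g -` V" "csmooth I (\<phi> \<circ> \<gamma>)"
    using jet_smooth_map_chart[OF A g \<gamma>(1) U f(1) V f(2)] by metis
  have inv: "inv_into U \<phi> (\<phi> x) = x" if "x \<in> U" for x using jet_atlas_inj[OF A U] that by simp
  have eq: "D 0 ((\<phi> \<circ> \<gamma>) t) [] = (\<psi> \<circ> (g \<circ> \<gamma>)) t" if "t \<in> I" for t
    using D(2)[of "\<phi> (\<gamma> t)"] I(2) that by (auto simp: inv image_subset_iff)
  have "((\<lambda>t. D 0 ((\<phi> \<circ> \<gamma>) t) []) has_vector_derivative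
      (D (Suc 0) ((\<phi> \<circ> \<gamma>) 0) [curve_deriv (Suc 0) (\<phi> \<circ> \<gamma>) 0])) (at 0)"
    using derivs_on_has_vector_derivative[OF D(1) csmooth_deriv_0[OF I(3,1)], of "[]" "[]" 0] f by simp
  then have "((\<psi> \<circ> (g \<circ> \<gamma>)) has_vector_derivative D (Suc 0) (\<phi> (\<gamma> 0)) [curve_deriv (Suc 0) (\<phi> \<circ> \<gamma>) 0]) (at 0)"
    using csmooth_open[OF I(3)] I(1) eq
    by (auto intro: has_vector_derivative_transform_within_open[where S=I])
  then have "curve_deriv 1 (\<psi> \<circ> (g \<circ> \<gamma>)) 0 = D (Suc 0) (\<phi> (\<gamma> 0)) [curve_deriv (Suc 0) (\<phi> \<circ> \<gamma>) 0]"
    by (simp add: curve_deriv_Suc vector_derivative_at)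
  then show ?thesis
    unfolding \<gamma>(2) jet_map_jet[OF A B g \<gamma>(1)]
    using f eq[OF I(1)] tangent_chart_jet[OF A \<gamma>(1) U f(1)]
      tangent_chart_jet[OF B smooth_curve_comp[OF A B g \<gamma>(1)] V]
    by simp
qed

lemma tangent_map_jet_smooth:
  assumes A: "jet_atlas A" and B: "jet_atlas B" and g: "smooth_map A B g"
    and U: "(U, \<phi>) \<in> A" and V: "(V, \<psi>) \<in> B"
  shows "jet_smooth (snd (tangent_chart A (U, \<phi>)) ` {c \<in> jet_bundle A 1. foot c \<in> U \<and> g (foot c) \<in> V})
     (snd (tangent_chart B (V, \<psi>)) \<circ> jet_map B 1 g \<circ>
       inv_into {c \<in> jet_bundle A 1. foot c \<in> U} (snd (tangent_chart A (U, \<phi>))))"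
proof -
  have jg: "jet_smooth_map A B g" using smooth_map_jet_smooth_map[OF g] .
  obtain D where D: "derivs_on (\<phi> ` (U \<inter> g -` V)) D" "\<And>x. x \<in> \<phi> ` (U \<inter> g -` V) \<Longrightarrow> D 0 x [] = (\<psi> \<circ> g \<circ> inv_into U \<phi>) x"
    using g U V unfolding smooth_map_def smooth_on_derivs by fast
  have set: "{c \<in> jet_bundle A 1. foot c \<in> U \<and> g (foot c) \<in> V} = {c \<in> jet_bundle A 1. foot c \<in> U \<inter> g -` V}"
    by auto
  have im: "snd (tangent_chart A (U, \<phi>)) ` {c \<in> jet_bundle A 1. foot c \<in> U \<and> g (foot c) \<in> V} = \<phi> ` (U \<inter> g -` V) \<times> UNIV"
    unfolding set by (rule tangent_chart_image[OF A U]) auto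
  show ?thesis
    unfolding im
  proof (rule jet_smooth_cong[OF derivs_on_tangent_jet_smooth[OF D(1)]])
    fix p assume "p \<in> \<phi> ` (U \<inter> g -` V) \<times> (UNIV :: 'b set)"
    then obtain c where c: "c \<in> jet_bundle A 1" "foot c \<in> U" "g (foot c) \<in> V" "p = snd (tangent_chart A (U, \<phi>)) c"
      unfolding im[symmetric] by blast
    have "inv_into {c \<in> jet_bundle A 1. foot c \<in> U} (snd (tangent_chart A (U, \<phi>))) p = c"
      using tangent_chart_inj[OF A U] c by (auto intro: inv_into_f_f)
    then show "(D 0 (fst p) [], D (Suc 0) (fst p) [snd p]) = (snd (tangent_chart B (V, \<psi>)) \<circ> jet_map B 1 g \<circ>
       inv_into {c \<in> jet_bundle A 1. foot c \<in> U} (snd (tangent_chart A (U, \<phi>)))) p"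
      using tangent_map_chart[OF A B jg U V D c(1-3)] c(4) by simp
  qed
qed

lemma jet_map_id: "jet_atlas A \<Longrightarrow> c \<in> jet_bundle A k \<Longrightarrow> jet_map A k (\<lambda>x. x) c = c"
  by (auto elim!: jet_bundleE simp: jet_map_jet jet_atlas_id o_def)

lemma points_tangent_atlas: "points (tangent_atlas A) = jet_bundle A 1"
proof (intro equalityI subsetI)
  fix c assume "c \<in> points (tangent_atlas A)"
  then show "c \<in> jet_bundle A 1" by (auto simp: tangent_atlas_def points_def tangent_chart_def)
next
  fix c assume c: "c \<in> jet_bundle A 1"
  then obtain \<gamma> where \<gamma>: "smooth_curve A \<gamma>" "c = jet A 1 \<gamma>" by (elim jet_bundleE)
  then show "c \<in> points (tangent_atlas A)"
    using c smooth_curve_points[OF \<gamma>(1)] unfolding points_iff[of "\<gamma> 0"]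
    by (force simp: tangent_atlas_def points_def tangent_chart_def foot_jet)
qed

text \<open>A transition map of TM is the coordinate form of the tangent map of the identity of M,
  so it is covered by the result on tangent maps of smooth maps.\<close>

lemma tangent_atlas_jet_atlas:
  assumes "smooth_atlas A"
  shows "jet_atlas (tangent_atlas A)"
proof -
  have A: "jet_atlas A" using assms by (rule smooth_atlas_jet_atlas)
  let ?T = "\<lambda>U. {c \<in> jet_bundle A 1. foot c \<in> U}"
  have 1: "inj_on (snd (tangent_chart A u)) (?T (fst u)) \<and> open (snd (tangent_chart A u) ` ?T (fst u))"
    if "u \<in> A" for u
  proof -
    obtain U \<phi> where u: "u = (U, \<phi>)" by (cases u)
    show ?thesis
      using tangent_chart_inj[OF A that[unfolded u]] jet_atlas_open[OF A that[unfolded u]]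
      unfolding u fst_conv tangent_chart_image[OF A that[unfolded u] order_refl] by (auto intro: open_Times)
  qed
  have 2: "jet_smooth (snd (tangent_chart A (U, \<phi>)) ` (?T U \<inter> ?T V)) (snd (tangent_chart A (V, \<psi>)) \<circ> inv_into (?T U) (snd (tangent_chart A (U, \<phi>))))"
    if "(U, \<phi>) \<in> A" "(V, \<psi>) \<in> A" for U \<phi> V \<psi>
  proof -
    have eq: "?T U \<inter> ?T V = {c \<in> jet_bundle A 1. foot c \<in> U \<and> foot c \<in> V}" by auto
    show ?thesis
      unfolding eq
      by (rule jet_smooth_cong[OF tangent_map_jet_smooth[OF A A smooth_atlas_id[OF assms] that]])
       (use tangent_chart_inj[OF A that(1)] in \<open>auto simp: inv_into_f_f jet_map_id[OF A]\<close>)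
  qed
  have 2: "jet_smooth (snd (tangent_chart A u) ` (?T (fst u) \<inter> ?T (fst v))) (snd (tangent_chart A v) \<circ> inv_into (?T (fst u)) (snd (tangent_chart A u)))"
    if "u \<in> A" "v \<in> A" for u v
    using 2[of "fst u" "snd u" "fst v" "snd v"] that by simp
  show ?thesis
    unfolding jet_atlas_def tangent_atlas_def case_prod_unfold ball_simps fst_tangent_chart
    using 1 2 by blast
qed

lemma tangent_map_jet_smooth_map:
  assumes A: "smooth_atlas A" and B: "smooth_atlas B" and g: "smooth_map A B g"
  shows "jet_smooth_map (tangent_atlas A) (tangent_atlas B) (jet_map B 1 g)"
proof -
  note jA = smooth_atlas_jet_atlas[OF A] and jB = smooth_atlas_jet_atlas[OF B]
    and jg = smooth_map_jet_smooth_map[OF g]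
  let ?T = "\<lambda>U. {c \<in> jet_bundle A 1. foot c \<in> U}" and ?TB = "\<lambda>U. {c \<in> jet_bundle B 1. foot c \<in> U}"

  have f: "jet_map B 1 g c \<in> jet_bundle B 1" "foot (jet_map B 1 g c) = g (foot c)" if "c \<in> jet_bundle A 1" for c
    using that by (auto elim!: jet_bundleE simp: jet_map_jet[OF jA jB jg] foot_jet
       foot_jet[OF smooth_curve_comp[OF jA jB jg]] intro!: jet_bundleI smooth_curve_comp[OF jA jB jg])
  have eq: "?T U \<inter> jet_map B 1 g -` ?TB V = {c \<in> jet_bundle A 1. foot c \<in> U \<and> g (foot c) \<in> V}" for U V
    using f by auto
  have 2: "jet_smooth (snd (tangent_chart A (U, \<phi>)) ` (?T U \<inter> jet_map B 1 g -` ?TB V))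
      (snd (tangent_chart B (V, \<psi>)) \<circ> jet_map B 1 g \<circ> inv_into (?T U) (snd (tangent_chart A (U, \<phi>))))"
    if "(U, \<phi>) \<in> A" "(V, \<psi>) \<in> B" for U \<phi> V \<psi>
    unfolding eq by (rule tangent_map_jet_smooth[OF jA jB g that])
  have 2: "jet_smooth (snd (tangent_chart A u) ` (?T (fst u) \<inter> jet_map B 1 g -` ?TB (fst v)))
      (snd (tangent_chart B v) \<circ> jet_map B 1 g \<circ> inv_into (?T (fst u)) (snd (tangent_chart A u)))"
    if "u \<in> A" "v \<in> B" for u v
    using 2[of "fst u" "snd u" "fst v" "snd v"] that by simp
  show ?thesis
    unfolding jet_smooth_map_def points_tangent_atlas
  proof (intro conjI)
    show "jet_map B 1 g ` jet_bundle A 1 \<subseteq> jet_bundle B 1" using f by blast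
    show "\<forall>(U, \<phi>)\<in>tangent_atlas A. \<forall>(V, \<psi>)\<in>tangent_atlas B.
       jet_smooth (\<phi> ` (U \<inter> jet_map B 1 g -` V)) (\<psi> \<circ> jet_map B 1 g \<circ> inv_into U \<phi>)"
      unfolding tangent_atlas_def case_prod_unfold ball_simps fst_tangent_chart using 2 by blast
  qed
qed

section \<open>The local components as iterated covariant derivatives\<close>

text \<open>
  The local components are polynomial expressions in the derivatives of the Christoffel symbol:
  \<open>Fac is m\<close> denotes the endomorphism \<open>D\<^sup>n\<Gamma>(\<xi>\<^sub>0)[\<xi>\<^sub>i | i \<leftarrow> is] \<xi>\<^sub>m\<close> of \<open>\<bbbE>\<close>, where \<open>\<xi>\<^sub>0 = x\<close> and \<open>n\<close> is the
  length of \<open>is\<close>. Since derivatives of expressions are expressions, joint differentiability is available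
  at every stage of the recursion.
\<close>

datatype lexp = Fac "nat list" nat | Add lexp lexp | Cmp lexp lexp | Scl real lexp

fun ev :: "(nat \<Rightarrow> 'e \<Rightarrow> 'e list \<Rightarrow> 'e \<Rightarrow>\<^sub>L 'e \<Rightarrow>\<^sub>L 'e) \<Rightarrow> lexp \<Rightarrow> (nat \<Rightarrow> 'e::real_normed_vector) \<Rightarrow> 'e \<Rightarrow>\<^sub>L 'e" where
  "ev D (Fac is m) p = blinfun_apply (D (length is) (p 0) (map p is)) (p m)"
| "ev D (Add a b) p = ev D a p + ev D b p"
| "ev D (Cmp a b) p = ev D a p o\<^sub>L ev D b p"
| "ev D (Scl r a) p = r *\<^sub>R ev D a p"

fun dv :: "(nat \<Rightarrow> 'e \<Rightarrow> 'e list \<Rightarrow> 'e \<Rightarrow>\<^sub>L 'e \<Rightarrow>\<^sub>L 'e) \<Rightarrow> lexp \<Rightarrow> (nat \<Rightarrow> 'e::real_normed_vector) \<Rightarrow> (nat \<Rightarrow> 'e) \<Rightarrow> 'e \<Rightarrow>\<^sub>L 'e" where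
  "dv D (Fac is m) p q =
     blinfun_apply (D (length is) (p 0) (map p is)) (q m)
     + blinfun_apply (D (Suc (length is)) (p 0) (q 0 # map p is)
         + multi_deriv (D (length is) (p 0)) (map p is) (map q is)) (p m)"
| "dv D (Add a b) p q = dv D a p q + dv D b p q"
| "dv D (Cmp a b) p q = (ev D a p o\<^sub>L dv D b p q) + (dv D a p q o\<^sub>L ev D b p)"
| "dv D (Scl r a) p q = r *\<^sub>R dv D a p q"

fun vars :: "lexp \<Rightarrow> nat set" where
  "vars (Fac is m) = insert 0 (insert m (set is))"
| "vars (Add a b) = vars a \<union> vars b"
| "vars (Cmp a b) = vars a \<union> vars b"
| "vars (Scl r a) = vars a"

text \<open>The derivative in the direction \<open>\<xi>\<^sub>i \<mapsto> (i + 1) \<xi>\<^sub>i\<^sub>+\<^sub>1\<close>, in which \<open>\<xi>\<^sub>i = c\<^sup>(\<^sup>i\<^sup>) / i!\<close> moves along a curve.\<close>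

fun shift_deriv :: "lexp \<Rightarrow> lexp" where
  "shift_deriv (Fac is m) =
     foldr (\<lambda>k. Add (Scl (real (Suc (is ! k))) (Fac (is[k := Suc (is ! k)]) m))) [0..<length is]
       (Add (Scl (real (Suc m)) (Fac is (Suc m))) (Fac (Suc 0 # is) m))"
| "shift_deriv (Add a b) = Add (shift_deriv a) (shift_deriv b)"
| "shift_deriv (Cmp a b) = Add (Cmp a (shift_deriv b)) (Cmp (shift_deriv a) b)"
| "shift_deriv (Scl r a) = Scl r (shift_deriv a)"

definition shift :: "(nat \<Rightarrow> 'e::real_normed_vector) \<Rightarrow> nat \<Rightarrow> 'e" where
  "shift p i = real (Suc i) *\<^sub>R p (Suc i)"

text \<open>\<open>local_exp j\<close> stands for M^(j+1), as the components start at M^1; hence the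
  factor 1 / (j + 2) in the step.\<close>

fun local_exp :: "nat \<Rightarrow> lexp" where
  "local_exp 0 = Fac [] (Suc 0)"
| "local_exp (Suc j) = Scl (1 / real (Suc (Suc j))) (Add (shift_deriv (local_exp j)) (Cmp (Fac [] (Suc 0)) (local_exp j)))"

lemma vars_shift_deriv: "vars a \<subseteq> {..N} \<Longrightarrow> vars (shift_deriv a) \<subseteq> {..Suc N}"
proof (induction a)
  case (Fac "is" m)
  have *: "vars (foldr (\<lambda>k. Add (Scl (real (Suc (is ! k))) (Fac (is[k := Suc (is ! k)]) m))) ks a) \<subseteq> {..Suc N}"
    if "set ks \<subseteq> {..<length is}" "vars a \<subseteq> {..Suc N}" for ks a
    using that
  proof (induction ks)
    case (Cons k ks)
    have "is ! k \<in> set is" using Cons.prems by auto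
    then have "is ! k \<le> N" using Fac by auto
    then have "set (is[k := Suc (is ! k)]) \<subseteq> {..Suc N}"
      using Fac set_update_subset_insert[of "is" k "Suc (is ! k)"] by force
    then show ?case using Cons Fac by auto
  qed simp
  show ?case unfolding shift_deriv.simps
    by (rule *) (use Fac in \<open>auto simp: subset_iff intro: le_SucI\<close>)
next
  case (Cmp a b) then show ?case by fastforce
qed auto

text \<open>M^(j+1) involves only x, \<xi>_1, ..., \<xi>_(j+1). This is why the finitely many
  partial derivatives in the recursion exhaust the total derivative.\<close>

lemma vars_local_exp: "vars (local_exp j) \<subseteq> {..Suc j}"
proof (induction j)
  case (Suc j)
  then show ?case using vars_shift_deriv[OF Suc] by (auto simp: subset_iff le_Suc_eq)
qed auto

lemma dv_cong: "(\<And>i. i \<in> vars a \<Longrightarrow> q i = q' i) \<Longrightarrow> dv D a p q = dv D a p q'"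
proof (induction a)
  case (Fac "is" m)
  then have "q 0 = q' 0" "q m = q' m" "map q is = map q' is" by simp_all
  then show ?case by (simp only: dv.simps)
qed simp_all

context
  fixes S :: "'e::real_normed_vector set" and D :: "nat \<Rightarrow> 'e \<Rightarrow> 'e list \<Rightarrow> 'e \<Rightarrow>\<^sub>L 'e \<Rightarrow>\<^sub>L 'e"
  assumes D: "derivs_on S D"
begin

text \<open>The parameter w is arbitrary because two families are needed: a single variable moving,
  for the partial derivatives in the recursion, and all variables moving at once, for the Taylor
  coefficients along a curve.\<close>

lemma ev_has_derivative:
  fixes P :: "'w::real_normed_vector \<Rightarrow> nat \<Rightarrow> 'e"
  assumes P: "\<And>i. ((\<lambda>w. P w i) has_derivative P' i) (at w)" and S: "P w 0 \<in> S"
  shows "((\<lambda>w. ev D a (P w)) has_derivative (\<lambda>h. dv D a (P w) (\<lambda>i. P' i h))) (at w)"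
proof (induction a)
  case (Fac "is" m)
  have "list_all2 (\<lambda>a a'. (a has_derivative a') (at w)) (map (\<lambda>i w. P w i) is) (map P' is)"
    using P by (simp add: list.rel_map list.rel_refl_strong)
  from derivs_on_has_derivative[OF D P[of 0] S this refl]
  have "((\<lambda>w. D (length is) (P w 0) (map (P w) is)) has_derivative
     (\<lambda>h. D (Suc (length is)) (P w 0) (P' 0 h # map (P w) is)
        + multi_deriv (D (length is) (P w 0)) (map (P w) is) (map (\<lambda>i. P' i h) is))) (at w)"
    by (simp add: o_def)
  from bounded_bilinear.FDERIV[OF bounded_bilinear_blinfun_apply this P[of m]]
  show ?case by simp
next
  case (Add a b)
  from has_derivative_add[OF Add] show ?case by simp
next
  case (Cmp a b)
  from bounded_bilinear.FDERIV[OF bounded_bilinear_blinfun_compose Cmp] show ?case by simp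
next
  case (Scl r a)
  from has_derivative_scaleR_right[OF Scl] show ?case by simp
qed

lemma dv_sum:
  assumes S: "p 0 \<in> S" and "finite L"
  shows "dv D a p (\<lambda>i. \<Sum>l\<in>L. q l i) = (\<Sum>l\<in>L. dv D a p (q l))"
proof (induction a)
  case (Fac "is" m)
  have bm: "bounded_multilinear n (D n (p 0))" for n using derivs_on_multilinear[OF D S] .
  have m: "multi_deriv (D (length is) (p 0)) (map p is) (map (\<lambda>i. \<Sum>l\<in>L. q l i) is)
     = (\<Sum>l\<in>L. multi_deriv (D (length is) (p 0)) (map p is) (map (q l) is))"
  proof -
    have "multi_deriv (D (length is) (p 0)) (map p is) (map (\<lambda>i. \<Sum>l\<in>L. q l i) is)
      = (\<Sum>k<length is. \<Sum>l\<in>L. D (length is) (p 0) ((map p is)[k := q l (is ! k)]))"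
      unfolding multi_deriv_def
      by (intro sum.cong) (simp_all add: linear_sum[OF bounded_multilinear_linear_update[OF bm]])
    then show ?thesis
      unfolding multi_deriv_def by (simp add: sum.swap[of _ L])
  qed
  have "D (Suc (length is)) (p 0) ((\<Sum>l\<in>L. q l 0) # map p is) = (\<Sum>l\<in>L. D (Suc (length is)) (p 0) (q l 0 # map p is))"
    by (intro linear_sum bounded_multilinear_linear_Cons[OF bm]) simp
  with m show ?case
    by (simp add: blinfun.sum_left blinfun.sum_right sum.distrib blinfun.add_left)
next
  case (Cmp a b)
  have "(\<Sum>l\<in>L. ev D a p o\<^sub>L dv D b p (q l)) = ev D a p o\<^sub>L (\<Sum>l\<in>L. dv D b p (q l))"
    "(\<Sum>l\<in>L. dv D a p (q l) o\<^sub>L ev D b p) = (\<Sum>l\<in>L. dv D a p (q l)) o\<^sub>L ev D b p"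
    using bounded_bilinear.sum_left[OF bounded_bilinear_blinfun_compose, of "\<lambda>l. dv D a p (q l)" L "ev D b p"]
      bounded_bilinear.sum_right[OF bounded_bilinear_blinfun_compose, of "ev D a p" "\<lambda>l. dv D b p (q l)" L] by simp_all
  with Cmp show ?case by (simp add: sum.distrib)
qed (simp_all add: sum.distrib scaleR_sum_right)

lemma ev_shift_deriv:
  assumes S: "p 0 \<in> S"
  shows "ev D (shift_deriv a) p = dv D a p (shift p)"
proof (induction a)
  case (Fac "is" m)
  have bm: "bounded_multilinear n (D n (p 0))" for n using derivs_on_multilinear[OF D S] .
  \<comment> \<open>The factor is ! k + 1 of each formal summand is absorbed into its slot by
    multilinearity, which turns the entry into \<open>shift p (is ! k)\<close> and the whole into a
    Leibniz sum.\<close>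
  have 1: "ev D (foldr (\<lambda>k. Add (Scl (real (Suc (is ! k))) (Fac (is[k := Suc (is ! k)]) m))) ks a) p
    = (\<Sum>k\<leftarrow>ks. blinfun_apply (D (length is) (p 0) ((map p is)[k := shift p (is ! k)])) (p m)) + ev D a p"
    if "set ks \<subseteq> {..<length is}" for ks a
    using that
  proof (induction ks)
    case (Cons k ks)
    then show ?case
      using linear_scale[OF bounded_multilinear_linear_update[OF bm, of "map p is" "length is" k]]
      by (simp add: map_update shift_def blinfun.scaleR_left)
  qed simp
  have m: "multi_deriv (D (length is) (p 0)) (map p is) (map (shift p) is)
     = (\<Sum>k\<leftarrow>[0..<length is]. D (length is) (p 0) ((map p is)[k := shift p (is ! k)]))"
    by (simp add: multi_deriv_def interv_sum_list_conv_sum_set_nat atLeast0LessThan)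
  have sl: "blinfun_apply (\<Sum>k\<leftarrow>ks. f k) y = (\<Sum>k\<leftarrow>ks. blinfun_apply (f k) y)" for f :: "nat \<Rightarrow> 'e \<Rightarrow>\<^sub>L 'e \<Rightarrow>\<^sub>L 'e" and ks y
    by (induction ks) (auto simp: blinfun.add_left)
  have sh: "blinfun_apply X (shift p m) = real (Suc m) *\<^sub>R blinfun_apply X (p (Suc m))" "shift p 0 = p (Suc 0)"
    for X :: "'e \<Rightarrow>\<^sub>L 'e \<Rightarrow>\<^sub>L 'e"
    by (simp_all add: shift_def blinfun.scaleR_right)
  have "ev D (shift_deriv (Fac is m)) p = blinfun_apply (multi_deriv (D (length is) (p 0)) (map p is) (map (shift p) is)) (p m)
      + (real (Suc m) *\<^sub>R blinfun_apply (D (length is) (p 0) (map p is)) (p (Suc m))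
         + blinfun_apply (D (Suc (length is)) (p 0) (p (Suc 0) # map p is)) (p m))"
    unfolding shift_deriv.simps by (subst 1) (auto simp: m sl)
  then show ?case
    by (simp add: sh blinfun.add_left del: of_nat_Suc shift_deriv.simps)
qed simp_all

context
  fixes \<Gamma> :: "'e christoffel"
  assumes \<Gamma>: "\<And>x. x \<in> S \<Longrightarrow> \<Gamma> x = D 0 x []"
begin

text \<open>Inductively M^j is given by an expression, so the partial derivatives in the recursion
  exist and are values of one differential \<open>dv\<close>. Linearity in the direction adds them
  up to the differential in the direction \<open>shift p\<close>, which is what
  \<open>shift_deriv\<close> computes formally.\<close>

lemma local_comp_eq_ev:
  "p 0 \<in> S \<Longrightarrow> local_comp \<Gamma> (Suc j) p y = blinfun_apply (ev D (local_exp j) p) y"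
proof (induction j arbitrary: p y)
  case 0
  then show ?case by (simp add: \<Gamma>)
next
  case (Suc n)
  have part: "frechet_derivative (\<lambda>u. local_comp \<Gamma> (Suc n) (p(i - 1 := u)) y) (at (p (i - 1))) h
     = blinfun_apply (dv D (local_exp n) p (\<lambda>j. if j = i - 1 then h else 0)) y" for i h
  proof -
    let ?P = "\<lambda>u. p(i - 1 := u)" and ?P' = "\<lambda>j h. if j = i - 1 then h else 0"
    have P: "((\<lambda>u. ?P u j) has_derivative ?P' j) (at (p (i - 1)))" for j
      by (cases "j = i - 1") auto
    have "((\<lambda>u. ev D (local_exp n) (?P u)) has_derivative
      (\<lambda>h. dv D (local_exp n) (?P (p (i - 1))) (\<lambda>j. ?P' j h))) (at (p (i - 1)))"
      using Suc.prems by (intro ev_has_derivative P) simp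
    then have "((\<lambda>u. ev D (local_exp n) (?P u)) has_derivative
      (\<lambda>h. dv D (local_exp n) p (\<lambda>j. ?P' j h))) (at (p (i - 1)))" by simp
    from bounded_linear.has_derivative[OF blinfun.bounded_linear_left[of y] this]
    have "((\<lambda>u. blinfun_apply (ev D (local_exp n) (?P u)) y) has_derivative
      (\<lambda>h. blinfun_apply (dv D (local_exp n) p (\<lambda>j. ?P' j h)) y)) (at (p (i - 1)))" .
    then have "((\<lambda>u. local_comp \<Gamma> (Suc n) (?P u) y) has_derivative
      (\<lambda>h. blinfun_apply (dv D (local_exp n) p (\<lambda>j. ?P' j h)) y)) (at (p (i - 1)))"
    proof (rule has_derivative_transform_within_open)
      \<comment> \<open>Only the base point x is confined to S; the other variables range over the
        whole space.\<close>
      let ?T = "if i - 1 = 0 then S else UNIV"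
      show "open ?T" "p (i - 1) \<in> ?T" using derivs_on_open[OF D] Suc.prems by auto
      fix u assume "u \<in> ?T"
      then have "?P u 0 \<in> S" using Suc.prems by (auto split: if_splits)
      then show "blinfun_apply (ev D (local_exp n) (?P u)) y = local_comp \<Gamma> (Suc n) (?P u) y"
        by (rule Suc.IH[symmetric])
    qed
    from frechet_derivative_at[OF this, symmetric] show ?thesis by metis
  qed
  \<comment> \<open>The i-th variable is p (i - 1), and its direction i \<xi>_i is
    \<open>shift p (i - 1)\<close>. With l = i - 1 the summands are the coordinate pieces of the
    direction \<open>shift p\<close>.\<close>
  have sh: "shift p (i - 1) = real i *\<^sub>R p i" "shift p (i - Suc 0) = real i *\<^sub>R p i" if "Suc 0 \<le> i" for i
    using that by (cases i; simp add: shift_def)+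
  have "(\<Sum>i = 1..Suc (Suc n). frechet_derivative (\<lambda>u. local_comp \<Gamma> (Suc n) (p(i - 1 := u)) y) (at (p (i - 1))) (real i *\<^sub>R p i))
    = (\<Sum>l\<in>{..Suc n}. blinfun_apply (dv D (local_exp n) p (\<lambda>j. if j = l then shift p l else 0)) y)"
    unfolding part by (rule sum.reindex_bij_witness[of _ Suc "\<lambda>i. i - 1"]) (auto simp: sh cong: if_cong)
  also have "\<dots> = blinfun_apply (\<Sum>l\<in>{..Suc n}. dv D (local_exp n) p (\<lambda>j. if j = l then shift p l else 0)) y"
    by (rule blinfun.sum_left[symmetric])
  also have "(\<Sum>l\<in>{..Suc n}. dv D (local_exp n) p (\<lambda>j. if j = l then shift p l else 0))
      = dv D (local_exp n) p (\<lambda>j. \<Sum>l\<in>{..Suc n}. if j = l then shift p l else 0)"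
    using Suc.prems by (intro dv_sum[symmetric]) auto
  also have "\<dots> = dv D (local_exp n) p (shift p)"
    using vars_local_exp[of n] by (intro dv_cong) (auto simp: subset_iff sum.delta simp del: sum.atMost_Suc)
  also have "\<dots> = ev D (shift_deriv (local_exp n)) p"
    using ev_shift_deriv[of p] Suc.prems by simp
  finally have sum: "(\<Sum>i = 1..Suc (Suc n). frechet_derivative (\<lambda>u. local_comp \<Gamma> (Suc n) (p(i - 1 := u)) y) (at (p (i - 1))) (real i *\<^sub>R p i))
    = blinfun_apply (ev D (shift_deriv (local_exp n)) p) y" .
  show ?case
    unfolding local_comp.simps sum
    using \<Gamma>[OF Suc.prems] Suc.IH[of p y] Suc.prems by (simp add: blinfun.add_left blinfun.scaleR_left)
qed

end
end

section \<open>Iterated covariant derivatives along a curve\<close>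

definition covD :: "'e::real_normed_vector christoffel \<Rightarrow> (real \<Rightarrow> 'e) \<Rightarrow> (real \<Rightarrow> 'e) \<Rightarrow> real \<Rightarrow> 'e" where
  "covD \<Gamma> c y t = vector_derivative y (at t) + \<Gamma> (c t) (curve_deriv (Suc 0) c t) (y t)"

definition taylor :: "(real \<Rightarrow> 'e::real_normed_vector) \<Rightarrow> real \<Rightarrow> nat \<Rightarrow> 'e" where
  "taylor c t m = (1 / fact m) *\<^sub>R curve_deriv m c t"

lemma taylor_0: "taylor c t 0 = c t" by (simp add: taylor_def)

lemma taylor_Suc: "real (Suc m) *\<^sub>R taylor c t (Suc m) = (1 / fact m) *\<^sub>R curve_deriv (Suc m) c t"
  by (simp add: taylor_def del: of_nat_Suc)

lemma taylor_deriv: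
  "csmooth I c \<Longrightarrow> t \<in> I \<Longrightarrow> ((\<lambda>t. taylor c t m) has_vector_derivative shift (taylor c t) m) (at t)"
  unfolding shift_def taylor_Suc unfolding taylor_def
  by (intro bounded_linear.has_vector_derivative[OF bounded_linear_scaleR_right] csmooth_deriv)

text \<open>Adjoins M^0 = id, so that the leading term of z^i becomes the summand with index
  0.\<close>

definition local_op :: "(nat \<Rightarrow> 'e \<Rightarrow> 'e list \<Rightarrow> 'e \<Rightarrow>\<^sub>L 'e \<Rightarrow>\<^sub>L 'e) \<Rightarrow> nat \<Rightarrow> (nat \<Rightarrow> 'e::real_normed_vector) \<Rightarrow> 'e \<Rightarrow>\<^sub>L 'e" where
  "local_op D i p = (case i of 0 \<Rightarrow> id_blinfun | Suc j \<Rightarrow> ev D (local_exp j) p)"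

context
  fixes S :: "'e::real_normed_vector set" and D :: "nat \<Rightarrow> 'e \<Rightarrow> 'e list \<Rightarrow> 'e \<Rightarrow>\<^sub>L 'e \<Rightarrow>\<^sub>L 'e"
    and \<Gamma> :: "'e christoffel"
  assumes D: "derivs_on S D"
    and \<Gamma>: "\<And>x. x \<in> S \<Longrightarrow> \<Gamma> x = D 0 x []"
begin

text \<open>This is the recursion for M^(i+1) solved for the sum of the partial derivatives, which
  along the Taylor coefficients of c is a time derivative. For i = 0 it reads 0 = M^1 - \<Gamma>(c,
  c').\<close>

lemma local_op_deriv:
  assumes c: "csmooth I c" "c ` I \<subseteq> S" and t: "t \<in> I"
  shows "((\<lambda>t. local_op D i (taylor c t)) has_vector_derivative
     (real (Suc i) *\<^sub>R local_op D (Suc i) (taylor c t)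
        - (\<Gamma> (c t) (curve_deriv (Suc 0) c t) o\<^sub>L local_op D i (taylor c t)))) (at t)"
proof -
  have S: "taylor c t 0 \<in> S" using c t by (auto simp: taylor_0)
  have t1: "taylor c t (Suc 0) = curve_deriv (Suc 0) c t" by (simp add: taylor_def)
  have \<Gamma>': "ev D (Fac [] (Suc 0)) (taylor c t) = \<Gamma> (c t) (curve_deriv (Suc 0) c t)"
    using \<Gamma>[OF S] by (simp add: taylor_0 t1)
  show ?thesis
  proof (cases i)
    case 0
    have "\<Gamma> (c t) (curve_deriv (Suc 0) c t) o\<^sub>L id_blinfun = \<Gamma> (c t) (curve_deriv (Suc 0) c t)"
      by (rule blinfun_eqI) simp
    then show ?thesis unfolding 0 local_op_def by (simp add: \<Gamma>'[simplified])
  next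
    case (Suc j)
    have "((\<lambda>t. ev D (local_exp j) (taylor c t)) has_derivative
       (\<lambda>h. dv D (local_exp j) (taylor c t) (\<lambda>i. h *\<^sub>R shift (taylor c t) i))) (at t)"
      using taylor_deriv[OF c(1) t] S
      by (intro ev_has_derivative[OF D]) (auto simp: has_vector_derivative_def)
    \<comment> \<open>Homogeneity of the differential in its direction is read off from its being a
      derivative with respect to the real variable h.\<close>
    moreover from linear_scale[OF bounded_linear.linear[OF has_derivative_bounded_linear[OF this]], of _ 1]
    have "dv D (local_exp j) (taylor c t) (\<lambda>i. h *\<^sub>R shift (taylor c t) i) = h *\<^sub>R dv D (local_exp j) (taylor c t) (shift (taylor c t))" for h
      by simp
    ultimately have "((\<lambda>t. ev D (local_exp j) (taylor c t)) has_vector_derivative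
       ev D (shift_deriv (local_exp j)) (taylor c t)) (at t)"
      using ev_shift_deriv[OF D, where p = "taylor c t"] S by (simp add: has_vector_derivative_def)
    moreover have "ev D (shift_deriv (local_exp j)) (taylor c t) =
        real (Suc i) *\<^sub>R local_op D (Suc i) (taylor c t)
        - (\<Gamma> (c t) (curve_deriv (Suc 0) c t) o\<^sub>L local_op D i (taylor c t))"
      using \<Gamma>' by (simp add: Suc local_op_def del: of_nat_Suc ev.simps(1))
    moreover have "local_op D i = ev D (local_exp j)" by (rule ext) (simp add: Suc local_op_def)
    ultimately show ?thesis by simp
  qed
qed

text \<open>Let T_j be the sum on the right. The product rule and \<open>local_op_deriv\<close> give
  T_j' = (j + 1) T_(j+1) - \<Gamma>(c, c') T_j, that is, D_t T_j = (j + 1) T_(j+1), and the factors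
  accumulate to j!. Differentiability is recorded as well, because \<open>covD\<close> is defined
  through \<open>vector_derivative\<close>, which is meaningful only for differentiable
  curves.\<close>

lemma covD_power:
  assumes c: "csmooth I c" "c ` I \<subseteq> S" and y: "csmooth I y" and t: "t \<in> I"
  shows "(covD \<Gamma> c ^^ j) y t = fact j *\<^sub>R (\<Sum>i\<le>j. local_op D i (taylor c t) (taylor y t (j - i)))"
    and "\<exists>y'. ((covD \<Gamma> c ^^ j) y has_vector_derivative y') (at t)"
proof -
  define T where "T = (\<lambda>j t. \<Sum>i\<le>j. local_op D i (taylor c t) (taylor y t (j - i)))"
  define G where "G = (\<lambda>t. \<Gamma> (c t) (curve_deriv (Suc 0) c t))"
  have I: "open I" using c(1) by (rule csmooth_open)
  have T: "(T j has_vector_derivative real (Suc j) *\<^sub>R T (Suc j) t - G t (T j t)) (at t)" if t: "t \<in> I" for t j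
  proof -
    let ?a = "\<lambda>i. local_op D i (taylor c t) (taylor y t (Suc j - i))"
    have "((\<lambda>t. local_op D i (taylor c t) (taylor y t (j - i))) has_vector_derivative
       real (Suc i) *\<^sub>R ?a (Suc i) + real (Suc j - i) *\<^sub>R ?a i
         - G t (local_op D i (taylor c t) (taylor y t (j - i)))) (at t)" if "i \<le> j" for i
    proof -
      have "((\<lambda>t. local_op D i (taylor c t) (taylor y t (j - i))) has_vector_derivative
         (local_op D i (taylor c t) (shift (taylor y t) (j - i))
          + (real (Suc i) *\<^sub>R local_op D (Suc i) (taylor c t)
             - (G t o\<^sub>L local_op D i (taylor c t))) (taylor y t (j - i)))) (at t)"
        unfolding G_def
        by (intro bounded_bilinear.has_vector_derivative[OF bounded_bilinear_blinfun_apply] local_op_deriv[OF c t] taylor_deriv[OF y t])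
      then show ?thesis
        using that by (simp add: shift_def Suc_diff_le blinfun.diff_left blinfun.scaleR_left blinfun.scaleR_right algebra_simps del: of_nat_Suc)
    qed
    then have "(T j has_vector_derivative (\<Sum>i\<le>j. real (Suc i) *\<^sub>R ?a (Suc i) + real (Suc j - i) *\<^sub>R ?a i
         - G t (local_op D i (taylor c t) (taylor y t (j - i))))) (at t)"
      unfolding T_def by (intro has_vector_derivative_sum) auto
    also have "(\<Sum>i\<le>j. real (Suc i) *\<^sub>R ?a (Suc i) + real (Suc j - i) *\<^sub>R ?a i
         - G t (local_op D i (taylor c t) (taylor y t (j - i))))
       = (\<Sum>i\<le>j. real (Suc i) *\<^sub>R ?a (Suc i)) + (\<Sum>i\<le>j. real (Suc j - i) *\<^sub>R ?a i) - G t (T j t)"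
      by (simp add: T_def sum.distrib sum_subtractf blinfun.sum_right)
    \<comment> \<open>Both sums extend to all i up to j + 1, the added terms having weight 0. The
      weights i and j + 1 - i then add up to j + 1.\<close>
    also have "(\<Sum>i\<le>j. real (Suc i) *\<^sub>R ?a (Suc i)) = (\<Sum>i\<le>Suc j. real i *\<^sub>R ?a i)"
      by (subst sum.atMost_Suc_shift) simp
    also have "(\<Sum>i\<le>j. real (Suc j - i) *\<^sub>R ?a i) = (\<Sum>i\<le>Suc j. real (Suc j - i) *\<^sub>R ?a i)"
      by simp
    also have "(\<Sum>i\<le>Suc j. real i *\<^sub>R ?a i) + (\<Sum>i\<le>Suc j. real (Suc j - i) *\<^sub>R ?a i)
       = (\<Sum>i\<le>Suc j. real (Suc j) *\<^sub>R ?a i)"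
      unfolding sum.distrib[symmetric] scaleR_add_left[symmetric] by (intro sum.cong) auto
    also have "\<dots> = real (Suc j) *\<^sub>R T (Suc j) t"
      by (simp add: T_def scaleR_sum_right del: sum.atMost_Suc of_nat_Suc)
    finally show ?thesis .
  qed
  have eq: "(covD \<Gamma> c ^^ j) y t = fact j *\<^sub>R T j t" if "t \<in> I" for t j
    using that
  proof (induction j arbitrary: t)
    case 0 then show ?case by (simp add: T_def local_op_def taylor_0)
  next
    case (Suc j)
    have "((\<lambda>t. fact j *\<^sub>R T j t) has_vector_derivative fact j *\<^sub>R (real (Suc j) *\<^sub>R T (Suc j) t - G t (T j t))) (at t)"
      by (intro bounded_linear.has_vector_derivative[OF bounded_linear_scaleR_right] T Suc.prems)
    then have "((covD \<Gamma> c ^^ j) y has_vector_derivative fact j *\<^sub>R (real (Suc j) *\<^sub>R T (Suc j) t - G t (T j t))) (at t)"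
      by (rule has_vector_derivative_transform_within_open[OF _ I Suc.prems]) (simp add: Suc.IH)
    then have "(covD \<Gamma> c ^^ Suc j) y t = fact j *\<^sub>R (real (Suc j) *\<^sub>R T (Suc j) t - G t (T j t)) + G t (fact j *\<^sub>R T j t)"
      using Suc by (simp add: covD_def[of _ _ "(covD \<Gamma> c ^^ j) y"] vector_derivative_at G_def)
    then show ?case by (simp add: blinfun.scaleR_right algebra_simps)
  qed
  show "(covD \<Gamma> c ^^ j) y t = fact j *\<^sub>R (\<Sum>i\<le>j. local_op D i (taylor c t) (taylor y t (j - i)))"
    using eq[OF t] by (simp add: T_def)
  have "((\<lambda>t. fact j *\<^sub>R T j t) has_vector_derivative fact j *\<^sub>R (real (Suc j) *\<^sub>R T (Suc j) t - G t (T j t))) (at t)"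
    by (intro bounded_linear.has_vector_derivative[OF bounded_linear_scaleR_right] T t)
  then show "\<exists>y'. ((covD \<Gamma> c ^^ j) y has_vector_derivative y') (at t)"
    by (intro exI, rule has_vector_derivative_transform_within_open[OF _ I t]) (simp add: eq)
qed

lemma z_comp_covD:
  assumes c: "csmooth I c" "c ` I \<subseteq> S" and t: "0 \<in> I"
  shows "z_comp \<Gamma> c (Suc i) = (1 / fact (Suc i)) *\<^sub>R (covD \<Gamma> c ^^ i) (curve_deriv (Suc 0) c) 0"
proof -
  have S: "taylor c 0 0 \<in> S" using c t by (auto simp: taylor_0)
  \<comment> \<open>For y = c' the factor c^(i+1-j)/(i-j)! in z^(i+1) is the Taylor coefficient of y
    of order i - j, so the bracket in z^(i+1) is the sum in \<open>covD_power\<close>.\<close>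
  have y: "taylor (curve_deriv (Suc 0) c) 0 m = (1 / fact m) *\<^sub>R curve_deriv (Suc m) c 0" for m
    by (simp add: taylor_def curve_deriv_curve_deriv)
  have tc: "(\<lambda>m. (1 / fact m) *\<^sub>R curve_deriv m c 0) = taylor c 0"
    by (rule ext) (simp add: taylor_def)
  have "local_comp \<Gamma> j (\<lambda>m. (1 / fact m) *\<^sub>R curve_deriv m c 0) ((1 / fact (Suc i - j - 1)) *\<^sub>R curve_deriv (Suc i - j) c 0)
     = local_op D j (taylor c 0) (taylor (curve_deriv (Suc 0) c) 0 (i - j))" if "j \<in> {Suc 0..i}" for j
    using that local_comp_eq_ev[OF D \<Gamma>, of "taylor c 0" "j - 1"] S
    by (cases j) (auto simp: local_op_def y Suc_diff_Suc tc)
  then have "z_comp \<Gamma> c (Suc i) = (1 / real (Suc i)) *\<^sub>R (local_op D 0 (taylor c 0) (taylor (curve_deriv (Suc 0) c) 0 i)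
      + (\<Sum>j = Suc 0..i. local_op D j (taylor c 0) (taylor (curve_deriv (Suc 0) c) 0 (i - j))))"
    unfolding z_comp_def by (simp add: local_op_def y atLeastLessThanSuc_atLeastAtMost del: of_nat_Suc)
  also have "\<dots> = (1 / real (Suc i)) *\<^sub>R (\<Sum>j\<le>i. local_op D j (taylor c 0) (taylor (curve_deriv (Suc 0) c) 0 (i - j)))"
    by (simp add: atMost_atLeast0 sum.atLeast_Suc_atMost)
  also have "\<dots> = (1 / fact (Suc i)) *\<^sub>R (covD \<Gamma> c ^^ i) (curve_deriv (Suc 0) c) 0"
    unfolding covD_power(1)[OF c csmooth_curve_deriv[OF c(1)] t] by (simp del: of_nat_Suc)
  finally show ?thesis .
qed

end

section \<open>Symmetry of the second derivative\<close>

lemma derivs_on_has_derivative_0: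
  assumes "derivs_on S D" "x \<in> S"
  shows "((\<lambda>x. D 0 x []) has_derivative (\<lambda>h. D (Suc 0) x [h])) (at x)"
  using derivs_on_has_derivative[OF assms(1) has_derivative_ident, of x "[]" "[]" 0] assms(2) by simp

lemma derivs_on_linear_1: "derivs_on S D \<Longrightarrow> x \<in> S \<Longrightarrow> linear (\<lambda>h. D (Suc 0) x [h])"
  using has_derivative_bounded_linear[OF derivs_on_has_derivative_0] bounded_linear.linear by blast

text \<open>The function \<phi> moves h in from s = 0 to s = 1. Its derivative is a difference of
  two remainders of the first derivative at x, both small in operator norm, and the mean value
  inequality carries the bound over to \<phi> 1 - \<phi> 0.\<close>

lemma second_difference_bound:
  fixes D :: "nat \<Rightarrow> 'a::real_normed_vector \<Rightarrow> 'a list \<Rightarrow> 'b::real_normed_vector"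
  assumes D: "derivs_on S D" and x: "x \<in> S" and e: "e > 0"
    and d: "\<And>y v. norm (y - x) < d \<Longrightarrow> y \<in> S \<and>
       norm (D (Suc 0) y [v] - D (Suc 0) x [v] - D (Suc (Suc 0)) x [y - x, v]) \<le> e * norm (y - x) * norm v"
    and hk: "norm h + norm k < d"
  shows "norm (D 0 (x + h + k) [] - D 0 (x + h) [] - D 0 (x + k) [] + D 0 x [] - D (Suc (Suc 0)) x [k, h])
    \<le> 2 * e * (norm h + norm k)\<^sup>2"
proof -
  define B where "B = D (Suc (Suc 0)) x"
  define \<phi> where "\<phi> = (\<lambda>s. D 0 (x + s *\<^sub>R h + k) [] - D 0 (x + s *\<^sub>R h) [] - s *\<^sub>R B [k, h])"
  define \<phi>' where "\<phi>' = (\<lambda>s. D (Suc 0) (x + s *\<^sub>R h + k) [h] - D (Suc 0) (x + s *\<^sub>R h) [h] - B [k, h])"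
  have lin: "linear (\<lambda>v. B [v, h])"
    unfolding B_def using bounded_multilinear_linear_Cons[OF derivs_on_multilinear[OF D x], of "[h]"] by simp
  have n: "norm (s *\<^sub>R h) \<le> norm h" if "s \<in> {0..1}" for s :: real
    using that by (auto simp: mult_left_le_one_le)
  have n1: "norm ((x + s *\<^sub>R h + k) - x) \<le> norm h + norm k" if "s \<in> {0..1}" for s
    using norm_triangle_ineq[of "s *\<^sub>R h" k] n[OF that] by (simp add: add.assoc)
  have n2: "norm ((x + s *\<^sub>R h) - x) \<le> norm h + norm k" if "s \<in> {0..1}" for s
    using n[OF that] by (simp add: add_increasing2)
  have der: "(\<phi> has_derivative (\<lambda>r. r *\<^sub>R \<phi>' s)) (at s within {0..1})" if s: "s \<in> {0..1}" for s
  proof -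
    have 1: "((\<lambda>s. D 0 (x + s *\<^sub>R h + w) []) has_vector_derivative D (Suc 0) (x + s *\<^sub>R h + w) [h]) (at s)"
      if "x + s *\<^sub>R h + w \<in> S" for w
    proof -
      have "((\<lambda>s. x + s *\<^sub>R h + w) has_vector_derivative h) (at s)"
        by (auto intro!: derivative_eq_intros simp: has_vector_derivative_def)
      from derivs_on_has_vector_derivative[OF D this that, of "[]" "[]" 0] show ?thesis by simp
    qed
    have "x + s *\<^sub>R h + k \<in> S" "x + s *\<^sub>R h + 0 \<in> S"
      using d[of "x + s *\<^sub>R h + k"] d[of "x + s *\<^sub>R h"] n1[OF s] n2[OF s] hk by auto
    from 1[OF this(1)] 1[OF this(2)]
    have "(\<phi> has_vector_derivative D (Suc 0) (x + s *\<^sub>R h + k) [h] - D (Suc 0) (x + s *\<^sub>R h) [h] - 1 *\<^sub>R B [k, h]) (at s)"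
      unfolding \<phi>_def
      by (intro has_vector_derivative_diff) (auto intro!: derivative_eq_intros simp: has_vector_derivative_def)
    then show ?thesis
      by (auto simp: \<phi>'_def has_vector_derivative_def intro: has_derivative_at_withinI)
  qed
  have bound: "norm (\<phi>' s) \<le> 2 * e * (norm h + norm k)\<^sup>2" if s: "s \<in> {0..1}" for s
  proof -
    have eq: "\<phi>' s = (D (Suc 0) (x + s *\<^sub>R h + k) [h] - D (Suc 0) x [h] - B [(x + s *\<^sub>R h + k) - x, h])
       - (D (Suc 0) (x + s *\<^sub>R h) [h] - D (Suc 0) x [h] - B [(x + s *\<^sub>R h) - x, h])"
      using linear_add[OF lin, of "s *\<^sub>R h" k] by (simp add: \<phi>'_def add.assoc)
    have "norm (\<phi>' s) \<le> norm (D (Suc 0) (x + s *\<^sub>R h + k) [h] - D (Suc 0) x [h] - B [(x + s *\<^sub>R h + k) - x, h])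
       + norm (D (Suc 0) (x + s *\<^sub>R h) [h] - D (Suc 0) x [h] - B [(x + s *\<^sub>R h) - x, h])"
      unfolding eq by (rule norm_triangle_ineq4)
    also have "\<dots> \<le> e * norm ((x + s *\<^sub>R h + k) - x) * norm h + e * norm ((x + s *\<^sub>R h) - x) * norm h"
      unfolding B_def using n1[OF s] n2[OF s] hk
      by (intro add_mono d[THEN conjunct2]) linarith+
    also have "\<dots> \<le> e * (norm h + norm k) * (norm h + norm k) + e * (norm h + norm k) * (norm h + norm k)"
      using n1[OF s] n2[OF s] e by (intro add_mono mult_mono) auto
    finally show ?thesis by (simp add: power2_eq_square algebra_simps)
  qed
  have "norm (\<phi> 1 - \<phi> 0) \<le> 2 * e * (norm h + norm k)\<^sup>2 * norm (1 - 0 :: real)"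
  proof (rule differentiable_bound[OF _ der])
    fix s :: real assume s: "s \<in> {0..1}"
    show "onorm (\<lambda>r. r *\<^sub>R \<phi>' s) \<le> 2 * e * (norm h + norm k)\<^sup>2"
      using bound[OF s] by (intro onorm_le) (simp add: mult.commute mult_left_mono)
  qed auto
  also have "\<phi> 1 - \<phi> 0 = D 0 (x + h + k) [] - D 0 (x + h) [] - D 0 (x + k) [] + D 0 x [] - D (Suc (Suc 0)) x [k, h]"
    by (simp add: \<phi>_def B_def)
  finally show ?thesis by simp
qed

text \<open>The second difference with increments t h and t k is symmetric in h and k, and it lies
  within 2 e (t N)^2 of t^2 times either value of the second derivative. The factor t^2 cancels, and
  e is arbitrary.\<close>

lemma derivs_on_symmetric:
  fixes D :: "nat \<Rightarrow> 'a::real_normed_vector \<Rightarrow> 'a list \<Rightarrow> 'b::real_normed_vector"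
  assumes D: "derivs_on S D" and x: "x \<in> S"
  shows "D (Suc (Suc 0)) x [h, k] = D (Suc (Suc 0)) x [k, h]"
proof -
  define B where "B = D (Suc (Suc 0)) x"
  define N where "N = norm h + norm k"
  have bm: "bounded_multilinear (Suc (Suc 0)) B" unfolding B_def using D x by (rule derivs_on_multilinear)
  have sc: "B [t *\<^sub>R v, t *\<^sub>R w] = (t * t) *\<^sub>R B [v, w]" for t v w
    using linear_scale[OF bounded_multilinear_linear_Cons[OF bm], of "[t *\<^sub>R w]" t v]
      linear_scale[OF bounded_multilinear_linear_snoc[OF bm], of "[v]" t w] by simp
  have "norm (B [h, k] - B [k, h]) \<le> 4 * e * N\<^sup>2" if e: "e > 0" for e
  proof -
    obtain d where "d > 0" and d: "\<And>y v. norm (y - x) < d \<Longrightarrow> y \<in> S \<and>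
       norm (D (Suc 0) y [v] - D (Suc 0) x [v] - D (Suc (Suc 0)) x [y - x, v]) \<le> e * norm (y - x) * norm v"
    proof (rule derivs_on_remainder[OF D x e, of "Suc 0"])
      fix d :: real assume "d > 0" and d: "\<And>y vs. norm (y - x) < d \<Longrightarrow> y \<in> S \<and> (length vs = Suc 0 \<longrightarrow>
              norm (D (Suc 0) y vs - D (Suc 0) x vs - D (Suc (Suc 0)) x ((y - x) # vs))
                \<le> e * norm (y - x) * prod_list (map norm vs))"
      show thesis by (rule that[OF \<open>d > 0\<close>]) (use d[where vs="[_]"] in auto)
    qed
    \<comment> \<open>Small enough for both increments to stay within the radius d; the summand 1
      keeps the denominator positive when h = k = 0.\<close>
    define t where "t = d / (2 * (N + 1))"
    have "N \<ge> 0" by (simp add: N_def)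
    then have "t > 0" and "t * N = d * (N / (2 * (N + 1)))"
      using \<open>d > 0\<close> by (auto simp: t_def)
    moreover have "N / (2 * (N + 1)) < 1" using \<open>N \<ge> 0\<close> by (simp add: divide_less_eq)
    ultimately have t: "t > 0" "t * N < d"
      using mult_strict_left_mono[of "N / (2 * (N + 1))" 1 d] \<open>d > 0\<close> by auto
    have tN: "norm (t *\<^sub>R h) + norm (t *\<^sub>R k) = t * N" using t by (simp add: N_def algebra_simps)
    let ?\<Delta> = "D 0 (x + t *\<^sub>R h + t *\<^sub>R k) [] - D 0 (x + t *\<^sub>R h) [] - D 0 (x + t *\<^sub>R k) [] + D 0 x []"
    have 1: "norm (?\<Delta> - (t * t) *\<^sub>R B [k, h]) \<le> 2 * e * (t * N)\<^sup>2"
      using second_difference_bound[OF D x e d, where h = "t *\<^sub>R h" and k = "t *\<^sub>R k"] t tN by (simp add: B_def[symmetric] sc)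
    have tN': "norm (t *\<^sub>R k) + norm (t *\<^sub>R h) = t * N" using tN by simp
    have "D 0 (x + t *\<^sub>R k + t *\<^sub>R h) [] - D 0 (x + t *\<^sub>R k) [] - D 0 (x + t *\<^sub>R h) [] + D 0 x [] = ?\<Delta>"
      by (simp add: algebra_simps)
    then have 2: "norm (?\<Delta> - (t * t) *\<^sub>R B [h, k]) \<le> 2 * e * (t * N)\<^sup>2"
      using second_difference_bound[OF D x e d, of d "t *\<^sub>R k" "t *\<^sub>R h"] t(2)
      unfolding B_def[symmetric] sc tN' by metis
    have eq: "(t * t) *\<^sub>R (B [h, k] - B [k, h]) = (?\<Delta> - (t * t) *\<^sub>R B [k, h]) - (?\<Delta> - (t * t) *\<^sub>R B [h, k])"
      by (simp add: algebra_simps)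
    have "norm ((t * t) *\<^sub>R (B [h, k] - B [k, h])) \<le> norm (?\<Delta> - (t * t) *\<^sub>R B [k, h]) + norm (?\<Delta> - (t * t) *\<^sub>R B [h, k])"
      unfolding eq by (rule norm_triangle_ineq4)
    also have "\<dots> \<le> 2 * e * (t * N)\<^sup>2 + 2 * e * (t * N)\<^sup>2" using 1 2 by (rule add_mono)
    finally have "(t * t) * norm (B [h, k] - B [k, h]) \<le> (t * t) * (4 * e * N\<^sup>2)"
      unfolding norm_scaleR by (simp add: power2_eq_square mult_ac)
    then show ?thesis using t(1) by simp
  qed
  then have "norm (B [h, k] - B [k, h]) \<le> 0 + e" if "e > 0" for e
  proof -
    have "4 * (e / (4 * (N\<^sup>2 + 1))) * N\<^sup>2 \<le> e"
    proof -
      have "4 * (e / (4 * p)) * q = e * (q / p)" for p q :: real by simp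
      then have "4 * (e / (4 * (N\<^sup>2 + 1))) * N\<^sup>2 = e * (N\<^sup>2 / (N\<^sup>2 + 1))" .
      also have "\<dots> \<le> e * 1"
        using that by (intro mult_left_mono) (auto simp: divide_le_eq add_nonneg_pos intro: add_nonneg_nonneg)
      finally show ?thesis by simp
    qed
    moreover have "e / (4 * (N\<^sup>2 + 1)) > 0" using that by (simp add: add_nonneg_pos)
    ultimately show ?thesis using \<open>\<And>e. e > 0 \<Longrightarrow> norm (B [h, k] - B [k, h]) \<le> 4 * e * N\<^sup>2\<close> by fastforce
  qed
  then have "norm (B [h, k] - B [k, h]) \<le> 0" by (rule field_le_epsilon)
  then show ?thesis by (simp add: B_def)
qed

section \<open>Related connections\<close>

lemma jet_map_bundle:
  assumes "jet_atlas A" "jet_atlas B" "jet_smooth_map A B g" "c \<in> jet_bundle A k"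
  shows "jet_map B k g c \<in> jet_bundle B k" "foot (jet_map B k g c) = g (foot c)"
proof -
  obtain \<gamma> where \<gamma>: "smooth_curve A \<gamma>" "c = jet A k \<gamma>" using assms(4) by (elim jet_bundleE)
  note s = smooth_curve_comp[OF assms(1-3) \<gamma>(1)]
  show "jet_map B k g c \<in> jet_bundle B k" "foot (jet_map B k g c) = g (foot c)"
    unfolding \<gamma>(2) jet_map_jet[OF assms(1-3) \<gamma>(1)] foot_jet[OF \<gamma>(1)] foot_jet[OF s]
    using s by (simp_all add: jet_bundleI)
qed

text \<open>The test curve (a, b) in TM has a'(0) = y and b'(0) = 0, so K_M returns \<Gamma>_M(x,
  \<xi>) y alone. Its image under Tg is (g(a), dg(a) b), with velocity (dg y, d^2g(y, \<xi>)) at 0,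
  and K_N adds the connection term of N to the second component.\<close>

lemma g_related_local:
  fixes A :: "('m, 'e::real_normed_vector) atlas" and B :: "('n, 'f::real_normed_vector) atlas"
  assumes A: "smooth_atlas A" and B: "smooth_atlas B" and g: "smooth_map A B g"
    and cM: "linear_connection A \<Gamma>\<^sub>M K\<^sub>M" and cN: "linear_connection B \<Gamma>\<^sub>N K\<^sub>N" and rel: "g_related A B g K\<^sub>M K\<^sub>N"
    and U: "(U, \<phi>) \<in> A" and V: "(V, \<psi>) \<in> B"
    and D: "derivs_on (\<phi> ` (U \<inter> g -` V)) D" "\<And>x. x \<in> \<phi> ` (U \<inter> g -` V) \<Longrightarrow> D 0 x [] = (\<psi> \<circ> g \<circ> inv_into U \<phi>) x"
    and x: "x \<in> \<phi> ` (U \<inter> g -` V)"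
  shows "D (Suc 0) x [\<Gamma>\<^sub>M (U, \<phi>) x \<xi> y] = D (Suc (Suc 0)) x [\<xi>, y] + \<Gamma>\<^sub>N (V, \<psi>) (D 0 x []) (D (Suc 0) x [\<xi>]) (D (Suc 0) x [y])"
proof -
  note jA = smooth_atlas_jet_atlas[OF A] and jB = smooth_atlas_jet_atlas[OF B]
    and jg = smooth_map_jet_smooth_map[OF g]
    and tA = tangent_atlas_jet_atlas[OF A] and tB = tangent_atlas_jet_atlas[OF B]
    and tg = tangent_map_jet_smooth_map[OF A B g]
  define TU where "TU = {c \<in> jet_bundle A 1. foot c \<in> U}"
  define TV where "TV = {c \<in> jet_bundle B 1. foot c \<in> V}"
  define \<Phi> where "\<Phi> = snd (tangent_chart A (U, \<phi>))"
  define \<Psi> where "\<Psi> = snd (tangent_chart B (V, \<psi>))"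
  have cA: "tangent_chart A (U, \<phi>) = (TU, \<Phi>)" and cB: "tangent_chart B (V, \<psi>) = (TV, \<Psi>)"
    by (simp_all add: TU_def TV_def \<Phi>_def \<Psi>_def prod_eq_iff fst_tangent_chart)
  have TU: "(TU, \<Phi>) \<in> tangent_atlas A" and TV: "(TV, \<Psi>) \<in> tangent_atlas B"
    using U V by (auto simp: tangent_atlas_def cA[symmetric] cB[symmetric])
  have "(x, \<xi>) \<in> \<Phi> ` TU"
    using tangent_chart_image[OF jA U order_refl] x by (auto simp: TU_def \<Phi>_def)
  then obtain \<gamma> where \<gamma>: "smooth_curve (tangent_atlas A) \<gamma>" "\<gamma> 0 \<in> TU" "\<Phi> (\<gamma> 0) = (x, \<xi>)"
      "curve_deriv (Suc 0) (\<Phi> \<circ> \<gamma>) 0 = (y, 0)"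
    using chart_curve[OF tA TU] by metis
  \<comment> \<open>The coordinate x determines the foot in U by injectivity of \<phi>, and so
    guarantees that g sends the foot into V.\<close>
  have foot_unique: "foot c \<in> U \<inter> g -` V" if c: "c \<in> jet_bundle A 1" "foot c \<in> U" "fst (\<Phi> c) = x" for c
  proof -
    obtain \<delta> where \<delta>: "smooth_curve A \<delta>" "c = jet A 1 \<delta>" using c(1) by (elim jet_bundleE)
    have "\<delta> 0 \<in> U" using c \<delta> by (simp add: foot_jet)
    moreover from this have "\<phi> (\<delta> 0) = x" using c(3) tangent_chart_jet[OF jA \<delta>(1) U] by (simp add: \<Phi>_def \<delta>(2))
    ultimately show ?thesis
      using x inj_onD[OF jet_atlas_inj[OF jA U]] by (auto simp: \<delta>(2) foot_jet[OF \<delta>(1)])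
  qed
  define w where "w = jet (tangent_atlas A) 1 \<gamma>"
  have w: "w \<in> jet_bundle (tangent_atlas A) 1" unfolding w_def using \<gamma>(1) by (rule jet_bundleI)
  have fw: "foot w = \<gamma> 0" unfolding w_def using \<gamma>(1) by (rule foot_jet)
  have \<gamma>0: "\<gamma> 0 \<in> jet_bundle A 1" "foot (\<gamma> 0) \<in> U" "g (foot (\<gamma> 0)) \<in> V"
    using \<gamma>(2,3) foot_unique[of "\<gamma> 0"] by (auto simp: TU_def)
  have "snd (tangent_chart (tangent_atlas A) (tangent_chart A (U, \<phi>))) w = ((x, \<xi>), (y, 0))"
    unfolding w_def cA using tangent_chart_jet[OF tA \<gamma>(1) TU \<gamma>(2)] \<gamma>(3,4) by simp
  then have K: "K\<^sub>M w \<in> jet_bundle A 1" "foot (K\<^sub>M w) \<in> U" "\<Phi> (K\<^sub>M w) = (x, 0 + \<Gamma>\<^sub>M (U, \<phi>) x \<xi> y)"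
    using cM w U \<gamma>0(2) unfolding linear_connection_def \<Phi>_def fw[symmetric] by blast+
  have K1: "\<Psi> (jet_map B 1 g (K\<^sub>M w)) = (D 0 x [], D (Suc 0) x [\<Gamma>\<^sub>M (U, \<phi>) x \<xi> y])"
    using tangent_map_chart[OF jA jB jg U V D K(1,2)] foot_unique[OF K(1,2)] K(3) by (simp add: \<Phi>_def \<Psi>_def)
  define w' where "w' = jet_map (tangent_atlas B) 1 (jet_map B 1 g) w"
  have w': "w' = jet (tangent_atlas B) 1 (jet_map B 1 g \<circ> \<gamma>)"
    unfolding w'_def w_def by (rule jet_map_jet[OF tA tB tg \<gamma>(1)])
  note s' = smooth_curve_comp[OF tA tB tg \<gamma>(1)]
  have w'b: "w' \<in> jet_bundle (tangent_atlas B) 1" unfolding w' using s' by (rule jet_bundleI)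
  have fw': "foot w' = jet_map B 1 g (\<gamma> 0)" unfolding w' foot_jet[OF s'] by simp
  have g0: "jet_map B 1 g (\<gamma> 0) \<in> TV"
    using jet_map_bundle[OF jA jB jg \<gamma>0(1)] \<gamma>0 by (simp add: TV_def)
  obtain I where I: "0 \<in> I" "\<gamma> ` I \<subseteq> TU \<inter> jet_map B 1 g -` TV" "csmooth I (\<Phi> \<circ> \<gamma>)"
    using jet_smooth_map_chart[OF tA tg \<gamma>(1) TU \<gamma>(2) TV g0] by metis
  define a where "a = (\<lambda>t. fst (\<Phi> (\<gamma> t)))"
  define b where "b = (\<lambda>t. snd (\<Phi> (\<gamma> t)))"
  have eq: "\<Psi> (jet_map B 1 g (\<gamma> t)) = (D 0 (a t) [], D (Suc 0) (a t) [b t])" if t: "t \<in> I" for t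
  proof -
    have "\<gamma> t \<in> jet_bundle A 1" "foot (\<gamma> t) \<in> U" "g (foot (\<gamma> t)) \<in> V"
      using I(2)[THEN subsetD, OF imageI[OF t]] jet_map_bundle(2)[OF jA jB jg, of "\<gamma> t" 1] by (auto simp: TU_def TV_def)
    from tangent_map_chart[OF jA jB jg U V D this] show ?thesis by (simp add: \<Phi>_def \<Psi>_def a_def b_def)
  qed
  have \<Phi>': "((\<lambda>t. \<Phi> (\<gamma> t)) has_vector_derivative (y, 0)) (at 0)"
    using csmooth_deriv_0[OF I(3,1)] \<gamma>(4) by (simp add: o_def)
  have a': "(a has_vector_derivative y) (at 0)" and b': "(b has_vector_derivative 0) (at 0)"
    using bounded_linear.has_vector_derivative[OF bounded_linear_fst \<Phi>']
      bounded_linear.has_vector_derivative[OF bounded_linear_snd \<Phi>'] by (simp_all add: a_def b_def)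
  have ab0: "a 0 = x" "b 0 = \<xi>" using \<gamma>(3) by (simp_all add: a_def b_def)
  have lin: "linear (\<lambda>v. D (Suc 0) x [v])" using D(1) x by (rule derivs_on_linear_1)
  have 0: "((\<lambda>t. D 0 (a t) []) has_vector_derivative D (Suc 0) x [y]) (at 0)"
    using derivs_on_has_vector_derivative[OF D(1) a', of "[]" "[]" 0] x ab0 by simp
  have 1: "((\<lambda>t. D (Suc 0) (a t) [b t]) has_vector_derivative D (Suc (Suc 0)) x [y, \<xi>]) (at 0)"
    using derivs_on_has_vector_derivative[OF D(1) a', of "[b]" "[0]" "Suc 0"] x ab0 b' linear_0[OF lin] by simp
  have "((\<lambda>t. (D 0 (a t) [], D (Suc 0) (a t) [b t])) has_vector_derivative (D (Suc 0) x [y], D (Suc (Suc 0)) x [y, \<xi>])) (at 0)"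
    using 0 1 by (rule has_vector_derivative_Pair)
  then have "((\<Psi> \<circ> (jet_map B 1 g \<circ> \<gamma>)) has_vector_derivative (D (Suc 0) x [y], D (Suc (Suc 0)) x [y, \<xi>])) (at 0)"
    by (rule has_vector_derivative_transform_within_open[OF _ csmooth_open[OF I(3)] I(1)]) (simp add: eq[simplified])
  then have "snd (tangent_chart (tangent_atlas B) (tangent_chart B (V, \<psi>))) w'
     = ((D 0 x [], D (Suc 0) x [\<xi>]), (D (Suc 0) x [y], D (Suc (Suc 0)) x [y, \<xi>]))"
    unfolding w' cB using tangent_chart_jet[OF tB s' TV] g0 eq[OF I(1)] ab0
    by (simp add: curve_deriv_Suc vector_derivative_at)
  moreover have "foot (foot w') \<in> V" using g0 by (simp add: fw' TV_def)
  ultimately have "\<Psi> (K\<^sub>N w') = (D 0 x [], D (Suc (Suc 0)) x [y, \<xi>] + \<Gamma>\<^sub>N (V, \<psi>) (D 0 x []) (D (Suc 0) x [\<xi>]) (D (Suc 0) x [y]))"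
    using cN w'b V unfolding linear_connection_def \<Psi>_def by blast
  moreover have "K\<^sub>N w' = jet_map B 1 g (K\<^sub>M w)"
    using rel w unfolding g_related_def w'_def by blast
  ultimately show ?thesis using K1 derivs_on_symmetric[OF D(1) x, of \<xi> y] by simp
qed

section \<open>Covariant derivatives and the components z^i under related connections\<close>

lemma covD_power_cong:
  assumes I: "open I" and y: "\<And>t. t \<in> I \<Longrightarrow> y t = y' t" and t: "t \<in> I"
  shows "(covD \<Gamma> c ^^ j) y t = (covD \<Gamma> c ^^ j) y' t"
  using t
proof (induction j arbitrary: t)
  case (Suc j)
  have "curve_deriv (Suc 0) ((covD \<Gamma> c ^^ j) y) t = curve_deriv (Suc 0) ((covD \<Gamma> c ^^ j) y') t"
    by (rule curve_deriv_cong[OF I Suc.IH Suc.prems])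
  moreover have "(covD \<Gamma> c ^^ Suc j) y t = curve_deriv (Suc 0) ((covD \<Gamma> c ^^ j) y) t
      + \<Gamma> (c t) (curve_deriv (Suc 0) c t) ((covD \<Gamma> c ^^ j) y t)" for y
    by (simp add: covD_def[of \<Gamma> c "(covD \<Gamma> c ^^ j) y"] curve_deriv_Suc)
  ultimately show ?case using Suc by simp
qed (use y in simp)

text \<open>The derivative of dg(c) u is d^2g(c', u) + dg u', and relatedness says that the
  connection term of the target completes d^2g(c', u) to dg(\<Gamma>(c, c') u). Hence D_t (dg u) =
  dg (D_t u), which is iterated.\<close>

lemma covD_natural:
  fixes \<Gamma> :: "'e::real_normed_vector christoffel" and \<Gamma>' :: "'f::real_normed_vector christoffel"
  assumes \<Gamma>: "derivs_on S E" "\<And>x. x \<in> S \<Longrightarrow> \<Gamma> x = E 0 x []"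
    and D: "derivs_on T D" and TS: "T \<subseteq> S"
    and rel: "\<And>x \<xi> y. x \<in> T \<Longrightarrow> D (Suc 0) x [\<Gamma> x \<xi> y] = D (Suc (Suc 0)) x [\<xi>, y] + \<Gamma>' (D 0 x []) (D (Suc 0) x [\<xi>]) (D (Suc 0) x [y])"
    and c: "csmooth I c" "c ` I \<subseteq> T" and y: "csmooth I y" and t: "t \<in> I"
  shows "(covD \<Gamma>' (\<lambda>t. D 0 (c t) []) ^^ j) (\<lambda>t. D (Suc 0) (c t) [y t]) t = D (Suc 0) (c t) [(covD \<Gamma> c ^^ j) y t]"
  using t
proof (induction j arbitrary: t)
  case (Suc j)
  define u where "u = (covD \<Gamma> c ^^ j) y"
  define d where "d = (\<lambda>t. D 0 (c t) [])"
  have I: "open I" using c(1) by (rule csmooth_open)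
  have ct: "c t \<in> T" using c Suc.prems by auto
  have cd: "(c has_vector_derivative curve_deriv (Suc 0) c t) (at t)" using csmooth_deriv_0[OF c(1) Suc.prems] .
  \<comment> \<open>The iterated covariant derivative u is itself differentiable; this is what the
    smoothness of \<Gamma> supplies.\<close>
  obtain u' where u': "(u has_vector_derivative u') (at t)"
    using covD_power(2)[OF \<Gamma> c(1) _ y Suc.prems] c(2) TS unfolding u_def by blast
  have "((\<lambda>t. D (Suc 0) (c t) [u t]) has_vector_derivative
      D (Suc (Suc 0)) (c t) [curve_deriv (Suc 0) c t, u t] + D (Suc 0) (c t) [u']) (at t)"
    using derivs_on_has_vector_derivative[OF D cd ct, of "[u]" "[u']" "Suc 0"] u' by simp
  then have "((covD \<Gamma>' d ^^ j) (\<lambda>t. D (Suc 0) (c t) [y t]) has_vector_derivative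
      D (Suc (Suc 0)) (c t) [curve_deriv (Suc 0) c t, u t] + D (Suc 0) (c t) [u']) (at t)"
    by (rule has_vector_derivative_transform_within_open[OF _ I Suc.prems]) (simp add: Suc.IH d_def u_def)
  moreover have "(d has_vector_derivative D (Suc 0) (c t) [curve_deriv (Suc 0) c t]) (at t)"
    using derivs_on_has_vector_derivative[OF D cd ct, of "[]" "[]" 0] by (simp add: d_def)
  ultimately have "(covD \<Gamma>' d ^^ Suc j) (\<lambda>t. D (Suc 0) (c t) [y t]) t
     = D (Suc (Suc 0)) (c t) [curve_deriv (Suc 0) c t, u t] + D (Suc 0) (c t) [u']
       + \<Gamma>' (D 0 (c t) []) (D (Suc 0) (c t) [curve_deriv (Suc 0) c t]) (D (Suc 0) (c t) [u t])"
    using Suc.IH[OF Suc.prems]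
    by (simp add: covD_def[of \<Gamma>' d "(covD \<Gamma>' d ^^ j) _"] vector_derivative_at curve_deriv_Suc d_def[symmetric] u_def[symmetric])
       (simp add: d_def)
  also have "\<dots> = D (Suc 0) (c t) [u'] + D (Suc 0) (c t) [\<Gamma> (c t) (curve_deriv (Suc 0) c t) (u t)]"
    using rel[OF ct] by simp
  also have "\<dots> = D (Suc 0) (c t) [covD \<Gamma> c u t]"
    using u' by (simp add: covD_def vector_derivative_at linear_add[OF derivs_on_linear_1[OF D ct]])
  finally show ?case by (simp add: u_def d_def)
qed simp

lemma local_comp_cong:
  "(\<And>i. i \<le> j \<Longrightarrow> p i = q i) \<Longrightarrow> local_comp \<Gamma> j p y = local_comp \<Gamma> j q y"
proof (induction \<Gamma> j p y arbitrary: q rule: local_comp.induct)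
  case (3 \<Gamma> n p y)
  have "(\<lambda>u. local_comp \<Gamma> (Suc n) (p(i - 1 := u)) y) = (\<lambda>u. local_comp \<Gamma> (Suc n) (q(i - 1 := u)) y)" if "i \<in> {1..Suc (Suc n)}" for i
    using that 3 by (intro ext "3.IH"(1)) auto
  moreover have "local_comp \<Gamma> (Suc n) p y = local_comp \<Gamma> (Suc n) q y" using 3 by (intro "3.IH"(2)) auto
  moreover have "p 0 = q 0" "p 1 = q 1" "\<And>i. i \<in> {1..Suc (Suc n)} \<Longrightarrow> p (i - 1) = q (i - 1)" "\<And>i. i \<in> {1..Suc (Suc n)} \<Longrightarrow> p i = q i"
    using 3 by auto
  ultimately show ?case unfolding local_comp.simps
    by (intro arg_cong[where f="scaleR _"] arg_cong2[where f="(+)"] sum.cong refl) simp_all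
qed auto

text \<open>M^j sees only the Taylor coefficients up to order j, so z^i is a function of the i-jet.
  This makes the trivializations well defined on classes and allows a curve to be replaced by one
  with the same germ at 0.\<close>

lemma z_comp_cong:
  assumes "\<And>m. m \<le> i \<Longrightarrow> curve_deriv m c 0 = curve_deriv m d 0"
  shows "z_comp \<Gamma> c i = z_comp \<Gamma> d i"
  unfolding z_comp_def using assms
  by (auto intro!: arg_cong2[where f="(+)"] sum.cong arg_cong[where f="scaleR _"] simp: local_comp_cong[where p="\<lambda>m. (1 / fact m) *\<^sub>R curve_deriv m c 0" and q="\<lambda>m. (1 / fact m) *\<^sub>R curve_deriv m d 0"])

lemma z_comp_natural:
  fixes A :: "('m, 'e::real_normed_vector) atlas" and B :: "('n, 'f::real_normed_vector) atlas"
  assumes A: "smooth_atlas A" and B: "smooth_atlas B" and g: "smooth_map A B g"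
    and cM: "linear_connection A \<Gamma>\<^sub>M K\<^sub>M" and cN: "linear_connection B \<Gamma>\<^sub>N K\<^sub>N" and rel: "g_related A B g K\<^sub>M K\<^sub>N"
    and U: "(U, \<phi>) \<in> A" and V: "(V, \<psi>) \<in> B"
    and D: "derivs_on (\<phi> ` (U \<inter> g -` V)) D" "\<And>x. x \<in> \<phi> ` (U \<inter> g -` V) \<Longrightarrow> D 0 x [] = (\<psi> \<circ> g \<circ> inv_into U \<phi>) x"
    and \<gamma>: "smooth_curve A \<gamma>" "\<gamma> 0 \<in> U" "g (\<gamma> 0) \<in> V" and i: "i \<ge> 1"
  shows "z_comp (\<Gamma>\<^sub>N (V, \<psi>)) (\<psi> \<circ> (g \<circ> \<gamma>)) i = D (Suc 0) (\<phi> (\<gamma> 0)) [z_comp (\<Gamma>\<^sub>M (U, \<phi>)) (\<phi> \<circ> \<gamma>) i]"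
proof -
  obtain j where j: "i = Suc j" using i by (cases i) auto
  note jA = smooth_atlas_jet_atlas[OF A]
  let ?c = "\<phi> \<circ> \<gamma>" and ?T = "\<phi> ` (U \<inter> g -` V)"
  let ?d = "\<lambda>t. D 0 (?c t) []"
  obtain I where I: "0 \<in> I" "\<gamma> ` I \<subseteq> U \<inter> g -` V" "csmooth I ?c" "csmooth I (\<psi> \<circ> (g \<circ> \<gamma>))"
    using jet_smooth_map_chart[OF jA smooth_map_jet_smooth_map[OF g] \<gamma>(1) U \<gamma>(2) V \<gamma>(3)] .
  have o: "open I" using csmooth_open[OF I(3)] .
  have cT: "?c ` I \<subseteq> ?T" using image_mono[OF I(2), of \<phi>] by (simp add: image_comp)
  have d: "?d t = (\<psi> \<circ> (g \<circ> \<gamma>)) t" if "t \<in> I" for t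
  proof -
    have "\<gamma> t \<in> U \<inter> g -` V" using that I(2) by blast
    then show ?thesis using D(2)[of "\<phi> (\<gamma> t)"] by (simp add: jet_atlas_inv[OF jA U])
  qed
  have ds: "csmooth I ?d" by (rule csmooth_cong[OF _ I(4)]) (simp add: d[simplified])
  have dV: "?d ` I \<subseteq> \<psi> ` V" using d I(2) by auto
  have "smooth_on (\<phi> ` U) (\<Gamma>\<^sub>M (U, \<phi>))" using cM U unfolding linear_connection_def by blast
  then obtain E where E: "derivs_on (\<phi> ` U) E" "\<And>x. x \<in> \<phi> ` U \<Longrightarrow> \<Gamma>\<^sub>M (U, \<phi>) x = E 0 x []"
    unfolding smooth_on_derivs by metis
  have "smooth_on (\<psi> ` V) (\<Gamma>\<^sub>N (V, \<psi>))" using cN V unfolding linear_connection_def by blast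
  then obtain F where F: "derivs_on (\<psi> ` V) F" "\<And>x. x \<in> \<psi> ` V \<Longrightarrow> \<Gamma>\<^sub>N (V, \<psi>) x = F 0 x []"
    unfolding smooth_on_derivs by metis
  have c0: "?c 0 \<in> ?T" using cT I(1) by blast
  note lin = derivs_on_linear_1[OF D(1) c0]
  have d': "curve_deriv (Suc 0) ?d t = D (Suc 0) (?c t) [curve_deriv (Suc 0) ?c t]" if "t \<in> I" for t
  proof -
    have "?c t \<in> ?T" using cT that by blast
    from derivs_on_has_vector_derivative[OF D(1) csmooth_deriv_0[OF I(3) that] this, of "[]" "[]" 0]
    show ?thesis by (simp add: curve_deriv_Suc vector_derivative_at)
  qed

  have "z_comp (\<Gamma>\<^sub>N (V, \<psi>)) (\<psi> \<circ> (g \<circ> \<gamma>)) i = z_comp (\<Gamma>\<^sub>N (V, \<psi>)) ?d i"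
    by (intro z_comp_cong curve_deriv_cong[OF o _ I(1)] d[symmetric])
  also have "\<dots> = (1 / fact (Suc j)) *\<^sub>R (covD (\<Gamma>\<^sub>N (V, \<psi>)) ?d ^^ j) (curve_deriv (Suc 0) ?d) 0"
    unfolding j by (rule z_comp_covD[OF F ds dV I(1)])
  also have "\<dots> = (1 / fact (Suc j)) *\<^sub>R D (Suc 0) (?c 0) [(covD (\<Gamma>\<^sub>M (U, \<phi>)) ?c ^^ j) (curve_deriv (Suc 0) ?c) 0]"
  proof -
    have "(covD (\<Gamma>\<^sub>N (V, \<psi>)) ?d ^^ j) (curve_deriv (Suc 0) ?d) 0
      = (covD (\<Gamma>\<^sub>N (V, \<psi>)) ?d ^^ j) (\<lambda>t. D (Suc 0) (?c t) [curve_deriv (Suc 0) ?c t]) 0"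
      by (rule covD_power_cong[OF o d' I(1)])
    also have "\<dots> = D (Suc 0) (?c 0) [(covD (\<Gamma>\<^sub>M (U, \<phi>)) ?c ^^ j) (curve_deriv (Suc 0) ?c) 0]"
      by (rule covD_natural[OF E D(1) _ g_related_local[OF A B g cM cN rel U V D] I(3) cT csmooth_curve_deriv[OF I(3)] I(1)])
        auto
    finally show ?thesis by simp
  qed
  also have "\<dots> = D (Suc 0) (?c 0) [z_comp (\<Gamma>\<^sub>M (U, \<phi>)) ?c i]"
  proof -
    have cU: "?c ` I \<subseteq> \<phi> ` U" using cT by auto
    have "z_comp (\<Gamma>\<^sub>M (U, \<phi>)) ?c i = (1 / fact (Suc j)) *\<^sub>R (covD (\<Gamma>\<^sub>M (U, \<phi>)) ?c ^^ j) (curve_deriv (Suc 0) ?c) 0"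
      unfolding j by (rule z_comp_covD[OF E I(3) cU I(1)])
    then show ?thesis by (simp only: linear_scale[OF lin])
  qed
  finally show ?thesis by simp
qed

section \<open>Bundle morphisms between the induced bundles\<close>

lemma norm_vec_le:
  fixes v :: "'a::real_normed_vector ^ 'k::finite"
  assumes "\<And>a. norm (v $ a) \<le> r"
  shows "norm v \<le> real CARD('k) * r"
proof -
  have "norm v \<le> (\<Sum>a\<in>UNIV. norm (v $ a))" unfolding norm_vec_def by (rule L2_set_le_sum) simp
  also have "\<dots> \<le> (\<Sum>a\<in>(UNIV::'k set). r)" by (intro sum_mono assms)
  finally show ?thesis by simp
qed

lemma bounded_linear_componentwise:
  fixes f :: "'a::real_normed_vector \<Rightarrow> 'b::real_normed_vector"
  assumes "linear f" "\<And>v. norm (f v) \<le> C * norm v" "C \<ge> 0"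
  shows "bounded_linear (\<lambda>v :: 'a ^ 'k::finite. \<chi> a. f (v $ a))"
    and "norm (\<chi> a. f (v $ a)) \<le> real CARD('k) * C * norm (v :: 'a ^ 'k)"
proof -
  have n: "norm (\<chi> a. f (v $ a)) \<le> real CARD('k) * C * norm v" for v :: "'a ^ 'k"
  proof -
    have "norm (f (v $ a)) \<le> C * norm v" for a
      using assms(2)[of "v $ a"] mult_left_mono[OF Finite_Cartesian_Product.norm_nth_le[of v a] assms(3)] by linarith
    then show ?thesis using norm_vec_le[of "\<chi> a. f (v $ a)" "C * norm v"] by simp
  qed
  then show "norm (\<chi> a. f (v $ a)) \<le> real CARD('k) * C * norm v" .
  show "bounded_linear (\<lambda>v :: 'a ^ 'k. \<chi> a. f (v $ a))"
    using n by (intro bounded_linear_intro[where K="real CARD('k) * C"])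
      (auto simp: vec_eq_iff linear_add[OF assms(1)] linear_scale[OF assms(1)] mult.commute)
qed

text \<open>The n-th derivative of the diagonal operator dg is the diagonal operator formed from the
  derivative of order n + 1. The fibre vector occupies the last slot because each differentiation
  inserts its direction in front; the estimate for \<open>D\<close> at order n + 1 then becomes the
  operator norm estimate at order n.\<close>

lemma smooth_on_diagonal:
  fixes D :: "nat \<Rightarrow> 'a::real_normed_vector \<Rightarrow> 'a list \<Rightarrow> 'b::real_normed_vector"
  assumes D: "derivs_on S D"
  obtains L :: "'a \<Rightarrow> ('a ^ 'k::finite) \<Rightarrow>\<^sub>L ('b ^ 'k)"
  where "smooth_on S L" "\<And>x v. x \<in> S \<Longrightarrow> blinfun_apply (L x) v = (\<chi> a. D (Suc 0) x [v $ a])"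
proof -
  define E :: "nat \<Rightarrow> 'a \<Rightarrow> 'a list \<Rightarrow> ('a ^ 'k) \<Rightarrow>\<^sub>L ('b ^ 'k)"
    where "E = (\<lambda>n x vs. Blinfun (\<lambda>v. \<chi> a. D (Suc n) x (vs @ [v $ a])))"
  have bm: "bounded_multilinear (Suc n) (D (Suc n) x)" if "x \<in> S" for n x
    using derivs_on_multilinear[OF D that] .
  have lin: "linear (\<lambda>v. D (Suc n) x (vs @ [v]))" if "x \<in> S" "length vs = n" for n x vs
    using bounded_multilinear_linear_snoc[OF bm[OF that(1)] that(2)] .
  have bl: "bounded_linear (\<lambda>v :: 'a ^ 'k. \<chi> a. D (Suc n) x (vs @ [v $ a]))" if x: "x \<in> S" and vs: "length vs = n" for n x vs
  proof -
    obtain C where C: "C \<ge> 0" "\<And>vs. length vs = Suc n \<Longrightarrow> norm (D (Suc n) x vs) \<le> C * prod_list (map norm vs)"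
      using bounded_multilinear_bound[OF bm[OF x]] by blast
    show ?thesis
      using C(2)[of "vs @ [_]"] vs C(1)
      by (intro bounded_linear_componentwise(1)[where C="C * prod_list (map norm vs)"] lin[OF x vs])
        (auto simp: ac_simps intro!: mult_nonneg_nonneg prod_list_nonneg)
  qed
  have E: "blinfun_apply (E n x vs) v = (\<chi> a. D (Suc n) x (vs @ [v $ a]))" if "x \<in> S" "length vs = n" for n x vs v
    unfolding E_def using bl[OF that] by (simp add: bounded_linear_Blinfun_apply)
  have "derivs_on S E"
    unfolding derivs_on_def
  proof (intro conjI allI ballI impI)
    show "open S" using derivs_on_open[OF D] .
  next
    fix n x assume x: "x \<in> S"
    obtain C where C: "C \<ge> 0" "\<And>vs. length vs = Suc n \<Longrightarrow> norm (D (Suc n) x vs) \<le> C * prod_list (map norm vs)"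
      using bounded_multilinear_bound[OF bm[OF x]] by blast
    have lin': "linear (\<lambda>v. D (Suc n) x (us @ v # ws @ [w]))" if "length us + length ws + 1 = n" for us ws w
      using bounded_multilinear_linear[OF bm[OF x], of us "ws @ [w]" n] that by simp
    have "norm (E n x vs) \<le> (real CARD('k) * C) * prod_list (map norm vs)" if "length vs = n" for vs
    proof (rule norm_blinfun_bound)
      show "0 \<le> real CARD('k) * C * prod_list (map norm vs)" using C by (auto intro!: mult_nonneg_nonneg prod_list_nonneg)
      fix v :: "'a ^ 'k"
      show "norm (blinfun_apply (E n x vs) v) \<le> real CARD('k) * C * prod_list (map norm vs) * norm v"
        unfolding E[OF x that] using C(2)[of "vs @ [_]"] that C(1)
        by (intro order_trans[OF bounded_linear_componentwise(2)[where C="C * prod_list (map norm vs)", OF lin[OF x that]]])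
          (auto simp: ac_simps intro!: mult_nonneg_nonneg prod_list_nonneg)
    qed
    moreover have "linear (\<lambda>v. E n x (us @ v # ws))" if "length us + length ws + 1 = n" for us ws
      by (rule linearI; rule blinfun_eqI)
        (use that in \<open>simp_all add: E[OF x] blinfun.add_left blinfun.scaleR_left vec_eq_iff linear_add[OF lin'[OF that]] linear_scale[OF lin'[OF that]]\<close>)
    ultimately show "bounded_multilinear n (E n x)" unfolding bounded_multilinear_def by blast
  next
    fix n x and e :: real assume x: "x \<in> S" and e: "e > 0"
    \<comment> \<open>A bound on every component bounds the vector up to the factor
      \<open>CARD('k)\<close>, which \<open>e'\<close> absorbs.\<close>
    define e' where "e' = e / real CARD('k)"
    have e': "e' > 0" "real CARD('k) * e' = e" using e by (auto simp: e'_def)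
    obtain d where "d > 0" and d: "\<And>y vs. norm (y - x) < d \<Longrightarrow> y \<in> S \<and> (length vs = Suc n \<longrightarrow>
              norm (D (Suc n) y vs - D (Suc n) x vs - D (Suc (Suc n)) x ((y - x) # vs))
                \<le> e' * norm (y - x) * prod_list (map norm vs))"
      using derivs_on_remainder[OF D x e'(1)] by metis
    have "norm (E n y vs - E n x vs - E (Suc n) x ((y - x) # vs)) \<le> e * norm (y - x) * prod_list (map norm vs)"
      if y: "y \<in> S" "norm (y - x) < d" and vs: "length vs = n" for y vs
    proof (rule norm_blinfun_bound)
      show "0 \<le> e * norm (y - x) * prod_list (map norm vs)" using e by (auto intro!: mult_nonneg_nonneg prod_list_nonneg)
      fix v :: "'a ^ 'k"
      let ?f = "\<lambda>v. D (Suc n) y (vs @ [v]) - D (Suc n) x (vs @ [v]) - D (Suc (Suc n)) x ((y - x) # vs @ [v])"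
      have "linear ?f"
        using lin[OF y(1) vs] lin[OF x vs] lin[OF x, of "(y - x) # vs" "Suc n"] vs
        by (intro linear_compose_sub) auto
      moreover have "norm (?f v) \<le> (e' * norm (y - x) * prod_list (map norm vs)) * norm v" for v
        using d[OF y(2), of "vs @ [v]"] vs by (simp add: ac_simps)
      ultimately have "norm (\<chi> a. ?f (v $ a)) \<le> real CARD('k) * (e' * norm (y - x) * prod_list (map norm vs)) * norm v"
        using e'(1) by (intro bounded_linear_componentwise(2)) (auto intro!: mult_nonneg_nonneg prod_list_nonneg)
      also have "(\<chi> a. ?f (v $ a)) = blinfun_apply (E n y vs - E n x vs - E (Suc n) x ((y - x) # vs)) v"
        using vs E[OF x, of "(y - x) # vs" "Suc n" v] by (simp add: E[OF x vs] E[OF y(1) vs] blinfun.diff_left vec_eq_iff)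
      also have "real CARD('k) * (e' * norm (y - x) * prod_list (map norm vs)) * norm v
         = (real CARD('k) * e') * norm (y - x) * prod_list (map norm vs) * norm v" by (simp only: ac_simps)
      finally show "norm (blinfun_apply (E n y vs - E n x vs - E (Suc n) x ((y - x) # vs)) v)
        \<le> e * norm (y - x) * prod_list (map norm vs) * norm v" unfolding e'(2) .
    qed
    then show "\<exists>d>0. \<forall>y\<in>S. dist y x < d \<longrightarrow> (\<forall>vs. length vs = n \<longrightarrow>
        norm (E n y vs - E n x vs - E (Suc n) x ((y - x) # vs)) \<le> e * norm (y - x) * prod_list (map norm vs))"
      using \<open>d > 0\<close> by (auto simp: dist_norm)
  qed
  then show thesis
    using E[of _ "[]" 0] by (intro that[of "\<lambda>x. E 0 x []"]) (auto simp: smooth_on_derivs)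
qed

lemma induced_triv_jet:
  assumes A: "jet_atlas A" and \<gamma>: "smooth_curve A \<gamma>" and U: "(U, \<phi>) \<in> A" "\<gamma> 0 \<in> U" and ix: "range ix \<subseteq> {1..k}"
  shows "induced_triv ix \<Gamma> \<phi> (jet A k \<gamma>) = (\<phi> (\<gamma> 0), \<chi> a. z_comp \<Gamma> (\<phi> \<circ> \<gamma>) (ix a))"
  unfolding induced_triv_def
proof (rule the_elem_jet[OF \<gamma>])
  fix \<delta> assume \<delta>: "smooth_curve A \<delta>" "jet_equiv A k \<gamma> \<delta>"
  then have e: "\<gamma> 0 = \<delta> 0" "jeteq k 0 (\<phi> \<circ> \<gamma>) (\<phi> \<circ> \<delta>)" using jet_equiv_iff[OF A \<gamma> \<delta>(1) U] by auto
  have "z_comp \<Gamma> (\<phi> \<circ> \<delta>) (ix a) = z_comp \<Gamma> (\<phi> \<circ> \<gamma>) (ix a)" for a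
  proof (rule z_comp_cong)
    fix m assume "m \<le> ix a"
    moreover have "ix a \<le> k" using subsetD[OF ix rangeI, of a] by simp
    ultimately show "curve_deriv m (\<phi> \<circ> \<delta>) 0 = curve_deriv m (\<phi> \<circ> \<gamma>) 0" using e(2) by (simp add: jeteq_def)
  qed
  then show "(\<phi> (\<delta> 0), \<chi> a. z_comp \<Gamma> (\<phi> \<circ> \<delta>) (ix a)) = (\<phi> (\<gamma> 0), \<chi> a. z_comp \<Gamma> (\<phi> \<circ> \<gamma>) (ix a))"
    using e(1) by simp
qed

text \<open>Naturality of z^i is a hypothesis here, in place of relatedness of the connections, so
  that the result serves both g and its inverse: for the inverse, naturality is deduced from that of
  g.\<close>

lemma induced_bundle_morphism:
  fixes A :: "('m, 'e::real_normed_vector) atlas" and B :: "('n, 'f::real_normed_vector) atlas" and ix :: "'k::finite \<Rightarrow> nat"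
  assumes A: "smooth_atlas A" and B: "smooth_atlas B" and g: "smooth_map A B g" and ix: "range ix \<subseteq> {1..k}"
    and z: "\<And>U \<phi> V \<psi> D \<gamma> i. (U, \<phi>) \<in> A \<Longrightarrow> (V, \<psi>) \<in> B \<Longrightarrow> derivs_on (\<phi> ` (U \<inter> g -` V)) D \<Longrightarrow>
      (\<And>x. x \<in> \<phi> ` (U \<inter> g -` V) \<Longrightarrow> D 0 x [] = (\<psi> \<circ> g \<circ> inv_into U \<phi>) x) \<Longrightarrow>
      smooth_curve A \<gamma> \<Longrightarrow> \<gamma> 0 \<in> U \<Longrightarrow> g (\<gamma> 0) \<in> V \<Longrightarrow> i \<ge> 1 \<Longrightarrow>
      z_comp (\<Gamma>\<^sub>N (V, \<psi>)) (\<psi> \<circ> (g \<circ> \<gamma>)) i = D (Suc 0) (\<phi> (\<gamma> 0)) [z_comp (\<Gamma>\<^sub>M (U, \<phi>)) (\<phi> \<circ> \<gamma>) i]"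
  shows "vb_morphism (induced_bundle A \<Gamma>\<^sub>M k ix) (induced_bundle B \<Gamma>\<^sub>N k ix) g (jet_map B k g)"
proof -
  note jA = smooth_atlas_jet_atlas[OF A] and jB = smooth_atlas_jet_atlas[OF B]
    and jg = smooth_map_jet_smooth_map[OF g]
  have L: "\<exists>L :: 'e \<Rightarrow> ('e ^ 'k) \<Rightarrow>\<^sub>L ('f ^ 'k). smooth_on (\<phi> ` (U \<inter> g -` V)) L \<and>
      (\<forall>t\<in>jet_bundle A k. foot t \<in> U \<and> g (foot t) \<in> V \<longrightarrow>
        snd (induced_triv ix (\<Gamma>\<^sub>N (V, \<psi>)) \<psi> (jet_map B k g t)) =
        blinfun_apply (L (fst (induced_triv ix (\<Gamma>\<^sub>M (U, \<phi>)) \<phi> t))) (snd (induced_triv ix (\<Gamma>\<^sub>M (U, \<phi>)) \<phi> t)))"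
    if U: "(U, \<phi>) \<in> A" and V: "(V, \<psi>) \<in> B" for U \<phi> V \<psi>
  proof -
    have "smooth_on (\<phi> ` (U \<inter> g -` V)) (\<psi> \<circ> g \<circ> inv_into U \<phi>)" using g U V unfolding smooth_map_def by fast
    then obtain D where D: "derivs_on (\<phi> ` (U \<inter> g -` V)) D" "\<And>x. x \<in> \<phi> ` (U \<inter> g -` V) \<Longrightarrow> D 0 x [] = (\<psi> \<circ> g \<circ> inv_into U \<phi>) x"
      unfolding smooth_on_derivs by metis
    obtain L :: "'e \<Rightarrow> ('e ^ 'k) \<Rightarrow>\<^sub>L ('f ^ 'k)" where L: "smooth_on (\<phi> ` (U \<inter> g -` V)) L"
        "\<And>x v. x \<in> \<phi> ` (U \<inter> g -` V) \<Longrightarrow> blinfun_apply (L x) v = (\<chi> a. D (Suc 0) x [v $ a])"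
      using smooth_on_diagonal[OF D(1)] by blast
    show ?thesis
    proof (intro exI[of _ L] conjI L(1) ballI impI)
      fix t assume t: "t \<in> jet_bundle A k" and f: "foot t \<in> U \<and> g (foot t) \<in> V"
      obtain \<gamma> where \<gamma>: "smooth_curve A \<gamma>" "t = jet A k \<gamma>" using t by (elim jet_bundleE)
      have f': "\<gamma> 0 \<in> U" "g (\<gamma> 0) \<in> V" using f \<gamma> by (simp_all add: foot_jet)
      have "ix a \<ge> 1" for a using ix by (auto dest: subsetD[OF _ rangeI])
      then have "z_comp (\<Gamma>\<^sub>N (V, \<psi>)) (\<psi> \<circ> (g \<circ> \<gamma>)) (ix a) = D (Suc 0) (\<phi> (\<gamma> 0)) [z_comp (\<Gamma>\<^sub>M (U, \<phi>)) (\<phi> \<circ> \<gamma>) (ix a)]" for a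
        using z[OF U V D \<gamma>(1) f'] by blast
      then show "snd (induced_triv ix (\<Gamma>\<^sub>N (V, \<psi>)) \<psi> (jet_map B k g t)) =
        blinfun_apply (L (fst (induced_triv ix (\<Gamma>\<^sub>M (U, \<phi>)) \<phi> t))) (snd (induced_triv ix (\<Gamma>\<^sub>M (U, \<phi>)) \<phi> t))"
        unfolding \<gamma>(2) jet_map_jet[OF jA jB jg \<gamma>(1)] induced_triv_jet[OF jA \<gamma>(1) U f'(1) ix]
        using f' by (simp add: induced_triv_jet[OF jB smooth_curve_comp[OF jA jB jg \<gamma>(1)] V _ ix] L(2))
    qed
  qed
  show ?thesis
    unfolding vb_morphism_def induced_bundle_def
    using g L jet_map_bundle[OF jA jB jg, of _ k] by fastforce
qed

section \<open>The inverse map\<close>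

lemma derivs_on_inverse:
  assumes D: "derivs_on S D" and E: "derivs_on T E" and x: "x \<in> S"
    and inv: "\<And>x. x \<in> S \<Longrightarrow> D 0 x [] \<in> T \<and> E 0 (D 0 x []) [] = x"
  shows "E (Suc 0) (D 0 x []) [D (Suc 0) x [v]] = v"
proof -
  have "((\<lambda>x. D 0 x []) has_derivative (\<lambda>h. D (Suc 0) x [h])) (at x)"
    using D x by (rule derivs_on_has_derivative_0)
  moreover have "((\<lambda>y. E 0 y []) has_derivative (\<lambda>h. E (Suc 0) (D 0 x []) [h])) (at (D 0 x []))"
    using inv[OF x] by (intro derivs_on_has_derivative_0[OF E]) simp
  ultimately have "((\<lambda>x. E 0 (D 0 x []) []) has_derivative (\<lambda>h. E (Suc 0) (D 0 x []) [D (Suc 0) x [h]])) (at x)"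
    by (rule has_derivative_compose)
  \<comment> \<open>The composite is the identity on an open neighbourhood of x, and derivatives
    there are unique.\<close>
  moreover have "((\<lambda>x. E 0 (D 0 x []) []) has_derivative (\<lambda>h. h)) (at x)"
    by (rule has_derivative_transform_within_open[OF has_derivative_ident derivs_on_open[OF D] x]) (simp add: inv)
  ultimately show ?thesis by (metis has_derivative_unique)
qed

lemma smooth_curve_points_near:
  assumes "smooth_curve A \<gamma>"
  obtains I where "open I" "0 \<in> I" "\<gamma> ` I \<subseteq> points A"
  using assms unfolding smooth_curve_iff by (metis open_greaterThanLessThan greaterThanLessThan_iff neg_less_0_iff_less)

lemma jet_map_inverse:
  assumes A: "jet_atlas A" and B: "jet_atlas B" and g: "jet_smooth_map A B g" and h: "jet_smooth_map B A h"
    and inv: "\<And>x. x \<in> points A \<Longrightarrow> h (g x) = x" and c: "c \<in> jet_bundle A k"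
  shows "jet_map A k h (jet_map B k g c) = c"
proof -
  obtain \<gamma> where \<gamma>: "smooth_curve A \<gamma>" "c = jet A k \<gamma>" using c by (elim jet_bundleE)
  note s = smooth_curve_comp[OF A B g \<gamma>(1)]
  obtain I where I: "open I" "0 \<in> I" "\<gamma> ` I \<subseteq> points A" using smooth_curve_points_near[OF \<gamma>(1)] .
  have "jet A k (h \<circ> (g \<circ> \<gamma>)) = jet A k \<gamma>"
    by (rule jet_germ[OF A smooth_curve_comp[OF B A h s] \<gamma>(1) I(1,2)]) (use I(3) inv in auto)
  then show ?thesis unfolding \<gamma>(2) jet_map_jet[OF A B g \<gamma>(1)] jet_map_jet[OF B A h s] .
qed

theorem corollary3p5:
  fixes A :: "('m, 'e::banach) atlas"
    and B :: "('n, 'f::banach) atlas"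
    and g :: "'m \<Rightarrow> 'n"
    and \<Gamma>\<^sub>M :: "('m, 'e) chart \<Rightarrow> 'e christoffel"
    and \<Gamma>\<^sub>N :: "('n, 'f) chart \<Rightarrow> 'f christoffel"
    and K\<^sub>M :: "'m tangent tangent \<Rightarrow> 'm tangent"
    and K\<^sub>N :: "'n tangent tangent \<Rightarrow> 'n tangent"
    and k :: nat
    and ix :: "'k::finite \<Rightarrow> nat"
  assumes "smooth_atlas A"
    and "smooth_atlas B"
    and "smooth_map A B g"
    and "linear_connection A \<Gamma>\<^sub>M K\<^sub>M"
    and "linear_connection B \<Gamma>\<^sub>N K\<^sub>N"
    and "g_related A B g K\<^sub>M K\<^sub>N"
    and "bij_betw ix UNIV {1..k}"
    and "diffeomorphism A B g"
  shows "vb_isomorphism (induced_bundle A \<Gamma>\<^sub>M k ix) (induced_bundle B \<Gamma>\<^sub>N k ix) g (jet_map B k g)"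
proof -
  note A = assms(1) and B = assms(2) and g = assms(3)
  note jA = smooth_atlas_jet_atlas[OF A] and jB = smooth_atlas_jet_atlas[OF B]
    and jg = smooth_map_jet_smooth_map[OF g]
  note natural = z_comp_natural[OF A B g assms(4-6)]
  have ix: "range ix \<subseteq> {1..k}" using assms(7) by (simp add: bij_betw_def)
  obtain h where h: "smooth_map B A h" and gh: "inverse_on (points A) (points B) g h"
    using assms(8) unfolding diffeomorphism_def by blast
  note jh = smooth_map_jet_smooth_map[OF h]
  have hg: "h (g x) = x" if "x \<in> points A" for x using gh that unfolding inverse_on_def by blast
  have gh': "g (h y) = y" if "y \<in> points B" for y using gh that unfolding inverse_on_def by blast
  have "vb_morphism (induced_bundle A \<Gamma>\<^sub>M k ix) (induced_bundle B \<Gamma>\<^sub>N k ix) g (jet_map B k g)"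
    by (rule induced_bundle_morphism[OF A B g ix]) (rule natural)
  moreover have "vb_morphism (induced_bundle B \<Gamma>\<^sub>N k ix) (induced_bundle A \<Gamma>\<^sub>M k ix) h (jet_map A k h)"
  proof (rule induced_bundle_morphism[OF B A h ix])
    fix V \<psi> U \<phi> E \<delta> and i :: nat
    assume V: "(V, \<psi>) \<in> B" and U: "(U, \<phi>) \<in> A" and E: "derivs_on (\<psi> ` (V \<inter> h -` U)) E"
      "\<And>y. y \<in> \<psi> ` (V \<inter> h -` U) \<Longrightarrow> E 0 y [] = (\<phi> \<circ> h \<circ> inv_into V \<psi>) y"
      and \<delta>: "smooth_curve B \<delta>" "\<delta> 0 \<in> V" "h (\<delta> 0) \<in> U" and i: "1 \<le> i"
    have "smooth_on (\<phi> ` (U \<inter> g -` V)) (\<psi> \<circ> g \<circ> inv_into U \<phi>)" using g U V unfolding smooth_map_def by fast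
    then obtain D where D: "derivs_on (\<phi> ` (U \<inter> g -` V)) D" "\<And>x. x \<in> \<phi> ` (U \<inter> g -` V) \<Longrightarrow> D 0 x [] = (\<psi> \<circ> g \<circ> inv_into U \<phi>) x"
      unfolding smooth_on_derivs by metis
    let ?\<gamma> = "h \<circ> \<delta>" and ?v = "z_comp (\<Gamma>\<^sub>M (U, \<phi>)) (\<phi> \<circ> (h \<circ> \<delta>)) i"
    have \<gamma>: "smooth_curve A ?\<gamma>" using smooth_curve_comp[OF jB jA jh \<delta>(1)] .
    have g0: "g (?\<gamma> 0) = \<delta> 0" using gh' smooth_curve_points[OF \<delta>(1)] by simp
    have x: "\<phi> (?\<gamma> 0) \<in> \<phi> ` (U \<inter> g -` V)" using \<delta>(2,3) g0 by auto
    have D0: "D 0 (\<phi> u) [] = \<psi> (g u)" if "u \<in> U" "g u \<in> V" for u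
      using D(2)[of "\<phi> u"] that by (simp add: jet_atlas_inv[OF jA U])
    \<comment> \<open>In coordinates h o g is the identity where it is defined, so the first
      derivative of h inverts that of g from the left.\<close>
    have ED: "D 0 x [] \<in> \<psi> ` (V \<inter> h -` U) \<and> E 0 (D 0 x []) [] = x" if x: "x \<in> \<phi> ` (U \<inter> g -` V)" for x
    proof -
      obtain u where u: "x = \<phi> u" "u \<in> U" "g u \<in> V" using x by blast
      have hu: "h (g u) = u" using hg u(2) U by (auto simp: points_iff)
      have m: "D 0 x [] \<in> \<psi> ` (V \<inter> h -` U)" using u hu by (auto simp: D0)
      show ?thesis using E(2)[OF m] m u hu by (simp add: D0 jet_atlas_inv[OF jB V])
    qed
    obtain I where I: "open I" "0 \<in> I" "\<delta> ` I \<subseteq> points B" using smooth_curve_points_near[OF \<delta>(1)] .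
    \<comment> \<open>The curves \<delta> and g o h o \<delta> agree near 0. Naturality of g along h
      o \<delta> therefore writes z^i of \<delta> as dg of z^i of h o \<delta>, and applying dh
      solves this for the latter.\<close>
    have "z_comp (\<Gamma>\<^sub>N (V, \<psi>)) (\<psi> \<circ> \<delta>) i = z_comp (\<Gamma>\<^sub>N (V, \<psi>)) (\<psi> \<circ> (g \<circ> ?\<gamma>)) i"
      by (intro z_comp_cong curve_deriv_cong[OF I(1) _ I(2)]) (use I(3) gh' in auto)
    also have "\<dots> = D (Suc 0) (\<phi> (?\<gamma> 0)) [?v]"
      using natural[OF U V D \<gamma> _ _ i] \<delta>(2,3) g0 by simp
    finally have zN: "z_comp (\<Gamma>\<^sub>N (V, \<psi>)) (\<psi> \<circ> \<delta>) i = D (Suc 0) (\<phi> (?\<gamma> 0)) [?v]" .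
    have "D 0 (\<phi> (?\<gamma> 0)) [] = \<psi> (\<delta> 0)" using D0[of "?\<gamma> 0"] \<delta>(2,3) g0 by simp
    then show "?v = E (Suc 0) (\<psi> (\<delta> 0)) [z_comp (\<Gamma>\<^sub>N (V, \<psi>)) (\<psi> \<circ> \<delta>) i]"
      unfolding zN using derivs_on_inverse[OF D(1) E(1) x ED, of ?v] by simp
  qed
  moreover have "inverse_on (jet_bundle A k) (jet_bundle B k) (jet_map B k g) (jet_map A k h)"
    unfolding inverse_on_def
    using jet_map_bundle(1)[OF jA jB jg, of _ k] jet_map_bundle(1)[OF jB jA jh, of _ k]
      jet_map_inverse[OF jA jB jg jh hg, of _ k] jet_map_inverse[OF jB jA jh jg gh', of _ k] by blast
  ultimately show ?thesis
    unfolding vb_isomorphism_def using gh by (auto simp: induced_bundle_def)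
qed

end
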